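(* Let $G$ be one of the following groups: the first Grigorchuk group; or the GGS group $G_E$ with defining vector $E=(1,-1)$ (acting on the $3$-regular rooted tree); or a GGS group $G_E$ acting on the $p$-regular rooted tree, $p$ prime, with defining vector $E=(\epsilon_1,\dots,\epsilon_{p-1})$ such that the $\epsilon_i$ are not all zero and not all non-zero. Then $G$ has uncountably many automorphism equivalence classes of weakly maximal subgroups, all distinct from the automorphism equivalence classes of parabolic subgroups of any branch action of $G$ on a spherically regular tree.
   Context: Trees and actions. The $d$-regular rooted tree is the rooted tree in which every vertex has exactly $d$ children; its vertices are the finite words over an alphabet of $d$ letters. More generally, an infinite (locally finite) rooted tree is spherically regular if the degree of a vertex depends only on its distance from the root. Level $n$ is the set of vertices at distance $n$ from the root. For a group $G$ acting faithfully on a rooted tree $T$ by root-preserving automorphisms and a vertex $v$, let $T_v$ be the subtree consisting of $v$ and its descendants; the rigid stabilizer $\mathrm{Rist}_G(v)$ is the set of elements of $G$ acting trivially outside $T_v$, and $\mathrm{Rist}_G(n)$ is the subgroup generated by all $\mathrm{Rist}_G(v)$ with $v$ of level $n$. The action is branch if $G$ is transitive on each level and $\mathrm{Rist}_G(n)$ has finite index in $G$ for every $n$. The boundary $\partial T$ is the set of infinite rays of $T$ starting at the root; a parabolic subgroup of the action is the stabilizer in $G$ of a point of $\partial T$. Notation. If an automorphism $g$ of the $d$-regular rooted tree fixes the first level pointwise, write $g=(g_1,\dots,g_d)_1$, where $g_i$ is the action of $g$ on the subtree hanging at the $i$-th vertex of level 1 (identified with the whole tree). First Grigorchuk group: the group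 $\Gamma=\langle a,b,c,d\rangle$ of automorphisms of the binary rooted tree with vertices the words over $\{0,1\}$, where, for $x\in\{0,1\}$, every word $w$, and $\overline 0=1$, $\overline 1=0$: $a(xw)=\overline{x}w$; $b(0w)=0a(w)$, $b(1w)=1c(w)$; $c(0w)=0a(w)$, $c(1w)=1d(w)$; $d(0w)=0w$, $d(1w)=1b(w)$. GGS groups: let $a$ be the automorphism of the $d$-regular rooted tree permuting cyclically, via $(1,2,\dots,d)$, the subtrees hanging from the root. For a vector $E=(\epsilon_1,\dots,\epsilon_{d-1})$ of integers $0\le\epsilon_i<d$ (read modulo $d$, so $-1$ stands for $d-1$), the GGS group with defining vector $E$ is $G_E=\langle a,b\rangle$, where $b$ is defined recursively by $b=(a^{\epsilon_1},\dots,a^{\epsilon_{d-1}},b)_1$. A subgroup of $G$ is weakly maximal if it is maximal (with respect to inclusion) among the subgroups of infinite index in $G$. Two subgroups of $G$ are automorphism equivalent if some automorphism of the abstract group $G$ maps one onto the other. *)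

theory Defs
  imports
    "HOL-Algebra.Group_Action"
    "HOL-Algebra.Generated_Groups"
    "HOL-Computational_Algebra.Primes"
    "HOL-Library.Countable_Set"
    "HOL-Library.Sublist"
begin

section \<open>Rooted trees\<close>

text \<open>
  A rooted tree is given by its set of vertices, a prefix-closed set of words over the natural
  numbers; the root is the empty word, and a word is joined to its one-letter extensions.  Every
  locally finite rooted tree is isomorphic to one of this form.
\<close>

definition rooted_tree :: "nat list set \<Rightarrow> bool" where
  "rooted_tree T \<longleftrightarrow> [] \<in> T \<and> (\<forall>v\<in>T. \<forall>u. prefix u v \<longrightarrow> u \<in> T)"

definition adjacent :: "nat list \<Rightarrow> nat list \<Rightarrow> bool" where
  "adjacent u v \<longleftrightarrow> (\<exists>x. v = u @ [x] \<or> u = v @ [x])"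

definition neighbours :: "nat list set \<Rightarrow> nat list \<Rightarrow> nat list set" where
  "neighbours T v = {u \<in> T. adjacent v u}"

definition level :: "nat list set \<Rightarrow> nat \<Rightarrow> nat list set" where
  "level T n = {v \<in> T. length v = n}"

definition spherically_regular_tree :: "nat list set \<Rightarrow> bool" where
  "spherically_regular_tree T \<longleftrightarrow>
     rooted_tree T \<and> infinite T \<and> (\<forall>v\<in>T. finite (neighbours T v)) \<and>
     (\<forall>n. \<forall>u\<in>level T n. \<forall>v\<in>level T n. card (neighbours T u) = card (neighbours T v))"

definition subtree_at :: "nat list set \<Rightarrow> nat list \<Rightarrow> nat list set" where
  "subtree_at T v = {u \<in> T. prefix v u}"

text \<open>The letters of the regular tree are numbered from \<open>0\<close>.\<close>

definition regular_tree :: "nat \<Rightarrow> nat list set" where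
  "regular_tree d = lists {..<d}"

definition tree_auts :: "nat list set \<Rightarrow> (nat list \<Rightarrow> nat list) set" where
  "tree_auts T =
     {f \<in> Bij T. f [] = [] \<and> (\<forall>u\<in>T. \<forall>v\<in>T. adjacent (f u) (f v) \<longleftrightarrow> adjacent u v)}"

definition tree_aut_group :: "nat list set \<Rightarrow> (nat list \<Rightarrow> nat list) monoid" where
  "tree_aut_group T = (BijGroup T)\<lparr>carrier := tree_auts T\<rparr>"

text \<open>A ray is the sequence of the vertices it passes through.\<close>

definition boundary :: "nat list set \<Rightarrow> (nat \<Rightarrow> nat list) set" where
  "boundary T = {r. r 0 = [] \<and> (\<forall>n. r n \<in> T \<and> (\<exists>x. r (Suc n) = r n @ [x]))}"


section \<open>Branch actions, parabolic and weakly maximal subgroups\<close>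

definition finite_index :: "('g, 'm) monoid_scheme \<Rightarrow> 'g set \<Rightarrow> bool" where
  "finite_index G H \<longleftrightarrow> finite (rcosets\<^bsub>G\<^esub> H)"

definition rist ::
  "('g, 'm) monoid_scheme \<Rightarrow> nat list set \<Rightarrow> ('g \<Rightarrow> nat list \<Rightarrow> nat list) \<Rightarrow> nat list \<Rightarrow> 'g set" where
  "rist G T \<phi> v = {g \<in> carrier G. \<forall>u \<in> T - subtree_at T v. \<phi> g u = u}"

definition rist_level ::
  "('g, 'm) monoid_scheme \<Rightarrow> nat list set \<Rightarrow> ('g \<Rightarrow> nat list \<Rightarrow> nat list) \<Rightarrow> nat \<Rightarrow> 'g set" where
  "rist_level G T \<phi> n = generate G (\<Union>v \<in> level T n. rist G T \<phi> v)"

definition branch_action ::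
  "('g, 'm) monoid_scheme \<Rightarrow> nat list set \<Rightarrow> ('g \<Rightarrow> nat list \<Rightarrow> nat list) \<Rightarrow> bool" where
  "branch_action G T \<phi> \<longleftrightarrow>
     faithful_action G T \<phi> \<and> (\<forall>g \<in> carrier G. \<phi> g \<in> tree_auts T) \<and>
     (\<forall>n. \<forall>u \<in> level T n. \<forall>v \<in> level T n. \<exists>g \<in> carrier G. \<phi> g u = v) \<and>
     (\<forall>n. finite_index G (rist_level G T \<phi> n))"

definition parabolic_subgroups ::
  "('g, 'm) monoid_scheme \<Rightarrow> nat list set \<Rightarrow> ('g \<Rightarrow> nat list \<Rightarrow> nat list) \<Rightarrow> 'g set set" where
  "parabolic_subgroups G T \<phi> = {stabilizer G (\<lambda>g r. \<phi> g \<circ> r) \<xi> | \<xi>. \<xi> \<in> boundary T}"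

definition weakly_maximal :: "('g, 'm) monoid_scheme \<Rightarrow> 'g set \<Rightarrow> bool" where
  "weakly_maximal G H \<longleftrightarrow>
     subgroup H G \<and> \<not> finite_index G H \<and>
     (\<forall>K. subgroup K G \<and> \<not> finite_index G K \<and> H \<subseteq> K \<longrightarrow> K = H)"

definition automorphism_equivalent ::
  "('g, 'm) monoid_scheme \<Rightarrow> 'g set \<Rightarrow> 'g set \<Rightarrow> bool" where
  "automorphism_equivalent G H K \<longleftrightarrow> (\<exists>\<alpha> \<in> iso G G. \<alpha> ` H = K)"

definition aut_class :: "('g, 'm) monoid_scheme \<Rightarrow> 'g set \<Rightarrow> 'g set set" where
  "aut_class G H = {K. subgroup K G \<and> automorphism_equivalent G H K}"


section \<open>The first Grigorchuk group\<close>

fun grig_a :: "nat list \<Rightarrow> nat list" where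
  "grig_a [] = []"
| "grig_a (x # w) = (1 - x) # w"

fun grig_b :: "nat list \<Rightarrow> nat list"
  and grig_c :: "nat list \<Rightarrow> nat list"
  and grig_d :: "nat list \<Rightarrow> nat list" where
  "grig_b [] = []"
| "grig_b (x # w) = x # (if x = 0 then grig_a w else grig_c w)"
| "grig_c [] = []"
| "grig_c (x # w) = x # (if x = 0 then grig_a w else grig_d w)"
| "grig_d [] = []"
| "grig_d (x # w) = x # (if x = 0 then w else grig_b w)"

text \<open>
  Elements of \<^const>\<open>BijGroup\<close> are extensional functions, hence the restriction of the generators
  to the vertices of the tree.
\<close>

definition grigorchuk_group :: "(nat list \<Rightarrow> nat list) monoid" where
  "grigorchuk_group =
     (tree_aut_group (regular_tree 2))
       \<lparr>carrier := generate (tree_aut_group (regular_tree 2))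
          ((\<lambda>f. restrict f (regular_tree 2)) ` {grig_a, grig_b, grig_c, grig_d})\<rparr>"


section \<open>GGS groups\<close>

fun ggs_a :: "nat \<Rightarrow> nat list \<Rightarrow> nat list" where
  "ggs_a d [] = []"
| "ggs_a d (x # w) = (Suc x mod d) # w"

text \<open>As letters are numbered from \<open>0\<close>, the list entry \<open>E ! x\<close> is \<open>\<epsilon>\<^sub>x\<^sub>+\<^sub>1\<close>.\<close>

fun ggs_b :: "nat \<Rightarrow> nat list \<Rightarrow> nat list \<Rightarrow> nat list" where
  "ggs_b d E [] = []"
| "ggs_b d E (x # w) = x # (if x < d - 1 then (ggs_a d ^^ (E ! x)) w else ggs_b d E w)"

definition defining_vector :: "nat \<Rightarrow> nat list \<Rightarrow> bool" where
  "defining_vector d E \<longleftrightarrow> length E = d - 1 \<and> (\<forall>\<epsilon> \<in> set E. \<epsilon> < d)"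

definition GGS_group :: "nat \<Rightarrow> nat list \<Rightarrow> (nat list \<Rightarrow> nat list) monoid" where
  "GGS_group d E =
     (tree_aut_group (regular_tree d))
       \<lparr>carrier := generate (tree_aut_group (regular_tree d))
          ((\<lambda>f. restrict f (regular_tree d)) ` {ggs_a d, ggs_b d E})\<rparr>"

end

theory Submission
  imports Defs "HOL-Number_Theory.Cong"
begin

text \<open>
  Let \<open>Q\<close> be a finite subgroup of \<open>G\<close> such that, for every letter \<open>x\<close>, the group \<open>G\<close> is generated by
  \<open>Q\<close> and the elements acting trivially on the subtree \<open>T\<^sub>x\<close>.

  If the stabilizer \<open>H\<close> of a vertex \<open>v\<close> in some branch action contains \<open>Q\<close>, then the commutators
  of a finite index subgroup of some \<open>Rist(y)\<close>, \<open>y = x \<dots>\<close> a vertex of \<open>T\<close>, lie in the rigid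
  stabilizer of \<open>v\<close>.  An element \<open>g\<close> acting trivially on \<open>T\<^sub>x\<close> fixes these commutators, whereas it
  carries the rigid stabilizer of \<open>v\<close> to that of \<open>g v\<close>; if \<open>g v \<noteq> v\<close>, the two commute, which is
  impossible as \<open>Rist(y)\<close> is not virtually metabelian.  Hence \<open>H = G\<close>, and no automorphic image of
  \<open>Q\<close> is contained in a parabolic subgroup.

  For a ray \<open>\<xi>\<close> of \<open>T\<close>, the setwise stabilizer of \<open>Q \<xi>\<close> contains \<open>Q\<close> and has infinite index, so it
  lies in a weakly maximal subgroup by Zorn's lemma.  Two such stabilizers, for rays in distinct
  \<open>Q\<close>-orbits, generate a subgroup containing the rigid stabilizer of a level, which has finite
  index.  This yields uncountably many weakly maximal subgroups, while a finitely generated group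
  has only countably many automorphisms.

  One takes \<open>Q = \<langle>a, c\<rangle>\<close> for the Grigorchuk group, where \<open>d\<close> acts trivially on \<open>T\<^sub>0\<close>, and \<open>Q = \<langle>a\<rangle>\<close> for
  the GGS groups, where a conjugate of \<open>b\<close> (if some entry of the vector is zero) or a product of two
  conjugates (for \<open>(1, -1)\<close>) acts trivially on \<open>T\<^sub>x\<close>.
\<close>

text \<open>The obstacle is that the excluded parabolic subgroups come from arbitrary branch actions
  of the abstract group. The weakly maximal subgroups must therefore carry a mark that survives
  automorphisms, and this mark is the finite subgroup \<open>Q\<close>. Finiteness serves twice: the
  orbit of a ray under \<open>Q\<close> is finite, so that its setwise stabilizer still has infinite
  index, and two disjoint orbits separate at one common level. An automorphism is absorbed by
  twisting the second action with it.

  Infinite rigid stabilizers, and finite index of those of the levels, come from a normal subgroup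
  \<open>K\<close> of finite index that contains a copy of itself below every letter.
  \<open>K\<close> is a normal closure: of z = [b, a] for the Grigorchuk group and for (1, -1), but
  of [z, a] and [z, b] when the vector has a zero entry. In the last case the quotient has class
  two, so commutators of conjugates of b lie in \<open>K\<close>, and the zero entry serves to cut
  one of them, or a further commutator, down to a single nontrivial coordinate.\<close>

lemma image_factor:
  assumes "\<And>x y. x \<in> A \<Longrightarrow> y \<in> A \<Longrightarrow> c x = c y \<Longrightarrow> f x = f y"
  shows "f ` A = (\<lambda>r. f (inv_into A c r)) ` c ` A"
proof -
  have "f (inv_into A c (c x)) = f x" if "x \<in> A" for x
    using assms that by (metis f_inv_into_f image_eqI inv_into_into)
  then show ?thesis
    by (simp add: image_image)
qed

section \<open>Subgroups of finite index\<close>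

context group
begin

lemma rcos_eq_iff:
  assumes "subgroup H G" "g \<in> carrier G" "h \<in> carrier G"
  shows "H #> g = H #> h \<longleftrightarrow> g \<otimes> inv h \<in> H"
proof
  assume "H #> g = H #> h"
  then show "g \<otimes> inv h \<in> H"
    using assms by (metis diff_neutralizes rcos_self rcosetsI subgroup.subset)
next
  assume "g \<otimes> inv h \<in> H"
  then have "(g \<otimes> inv h) \<otimes> h \<in> H #> h"
    by (auto simp: r_coset_def)
  then have "g \<in> H #> h"
    using assms by (simp add: m_assoc)
  then show "H #> g = H #> h"
    using repr_independence assms by metis
qed

lemma subgroup_pow: "subgroup H G \<Longrightarrow> x \<in> H \<Longrightarrow> x [^] (n::nat) \<in> H"
  by (induction n) (simp_all add: subgroup.one_closed subgroup.m_closed)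

lemma rcosets_image: "rcosets H = (\<lambda>g. H #> g) ` carrier G"
  by (auto simp: RCOSETS_def)

text \<open>The values of \<open>c\<close> separate the right cosets of \<open>H\<close>, so
  finitely many values leave finitely many cosets. Vertex stabilizers and the subgroups
  \<open>K_level\<close> get their finite index from such an invariant.\<close>

lemma finite_index_mapI:
  assumes "subgroup H G" "finite (c ` carrier G)"
    and "\<And>g h. g \<in> carrier G \<Longrightarrow> h \<in> carrier G \<Longrightarrow> c g = c h \<Longrightarrow> g \<otimes> inv h \<in> H"
  shows "finite_index G H"
proof -
  have "(\<lambda>g. H #> g) ` carrier G = (\<lambda>r. H #> (inv_into (carrier G) c r)) ` c ` carrier G"
    using assms by (intro image_factor) (auto simp: rcos_eq_iff)
  then show ?thesis
    unfolding finite_index_def rcosets_image using assms(2) by simp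
qed

lemma finite_index_mono:
  assumes "finite_index G H" "subgroup H G" "subgroup K G" "H \<subseteq> K"
  shows "finite_index G K"
proof (rule finite_index_mapI[where c = "\<lambda>g. H #> g"])
  show "finite ((\<lambda>g. H #> g) ` carrier G)"
    using assms(1) by (simp add: finite_index_def rcosets_image)
qed (use assms in \<open>auto simp: rcos_eq_iff\<close>)

lemma finite_index_transversal:
  assumes "finite_index G H" "subgroup H G"
  obtains F where "finite F" "F \<subseteq> carrier G" "\<And>g. g \<in> carrier G \<Longrightarrow> \<exists>f\<in>F. g \<otimes> inv f \<in> H"
proof -
  define F where "F = inv_into (carrier G) (\<lambda>g. H #> g) ` (rcosets H)"
  have "finite F" using assms(1) by (simp add: F_def finite_index_def)
  moreover have "F \<subseteq> carrier G" by (auto simp: F_def rcosets_image inv_into_into)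
  moreover have "\<exists>f\<in>F. g \<otimes> inv f \<in> H" if g: "g \<in> carrier G" for g
  proof (rule bexI)
    let ?f = "inv_into (carrier G) (\<lambda>g. H #> g) (H #> g)"
    show "?f \<in> F" using g by (auto simp: F_def rcosets_image)
    have "?f \<in> carrier G" "H #> ?f = H #> g"
      using g by (auto simp: inv_into_into f_inv_into_f[of _ "\<lambda>g. H #> g"])
    then show "g \<otimes> inv ?f \<in> H" using rcos_eq_iff[OF assms(2) g, of ?f] by simp
  qed
  ultimately show ?thesis using that by blast
qed

text \<open>Pigeonhole: two of the infinitely many elements of \<open>R\<close> share a coset of
  \<open>H\<close>, and their quotient is the required element.\<close>

lemma finite_index_inter_infinite:
  assumes "finite_index G H" "subgroup H G" "subgroup R G" "infinite R"
  obtains h where "h \<in> R" "h \<in> H" "h \<noteq> \<one>"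
proof -
  have "finite ((\<lambda>g. H #> g) ` R)"
    using assms unfolding finite_index_def rcosets_image
    by (meson finite_subset image_mono subgroup.subset)
  then have "\<not> inj_on (\<lambda>g. H #> g) R"
    using assms(4) finite_imageD by blast
  then obtain x y where xy: "x \<in> R" "y \<in> R" "x \<noteq> y" "H #> x = H #> y"
    by (auto simp: inj_on_def)
  have cx: "x \<in> carrier G" "y \<in> carrier G"
    using xy assms(3) subgroup.subset by blast+
  then have "x \<otimes> inv y \<in> H"
    using xy(4) assms(2) rcos_eq_iff by simp
  moreover have "x \<otimes> inv y \<in> R"
    using xy assms(3) by (simp add: subgroup.m_closed subgroup.m_inv_closed)
  moreover have "x \<otimes> inv y \<noteq> \<one>"
    using xy(3) cx by (metis inv_closed inv_inv inv_equality)
  ultimately show ?thesis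
    using that by blast
qed

lemma infinite_of_finite_index:
  assumes "finite_index G H" "subgroup H G" "infinite (carrier G)"
  shows "infinite H"
proof
  assume "finite H"
  then have "finite (H #> g)" for g
    by (simp add: r_coset_def)
  then have "finite (\<Union> (rcosets H))"
    using assms(1) by (auto simp: finite_index_def rcosets_image)
  then show False
    using assms(2,3) rcosets_part_G by simp
qed

section \<open>Finitely generated groups\<close>

text \<open>Words in the generators and their inverses are coded as lists, so that countability of
  the set of lists gives countability of the group.\<close>

lemma generate_subset_foldr:
  assumes "S \<subseteq> carrier G"
  shows "generate G S \<subseteq> (\<lambda>xs. foldr (\<otimes>) xs \<one>) ` lists (S \<union> m_inv G ` S)"
proof
  let ?f = "\<lambda>xs. foldr (\<otimes>) xs \<one>"
  have closed: "?f xs \<in> carrier G" if "xs \<in> lists (S \<union> m_inv G ` S)" for xs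
    using that assms by (induction xs) auto
  have app: "?f (xs @ ys) = ?f xs \<otimes> ?f ys"
    if "xs \<in> lists (S \<union> m_inv G ` S)" "ys \<in> lists (S \<union> m_inv G ` S)" for xs ys
    using that(1)
  proof (induction xs)
    case Nil
    then show ?case using closed[OF that(2)] by simp
  next
    case (Cons x xs)
    then have "x \<in> carrier G" using assms by auto
    then show ?case using Cons closed[OF Cons.hyps(2)] closed[OF that(2)] by (simp add: m_assoc)
  qed
  show "g \<in> ?f ` lists (S \<union> m_inv G ` S)" if "g \<in> generate G S" for g
    using that
  proof induction
    case one
    show ?case by (rule image_eqI[of _ _ "[]"]) auto
  next
    case (incl h)
    then show ?case using assms by (intro image_eqI[of _ _ "[h]"]) auto
  next
    case (inv h)
    then show ?case using assms by (intro image_eqI[of _ _ "[inv h]"]) auto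
  next
    case (eng g h)
    then obtain xs ys where "xs \<in> lists (S \<union> m_inv G ` S)" "g = ?f xs"
      "ys \<in> lists (S \<union> m_inv G ` S)" "h = ?f ys" by blast
    then show ?case using app[of xs ys] by (intro image_eqI[of _ _ "xs @ ys"]) auto
  qed
qed

lemma countable_generate:
  assumes "S \<subseteq> carrier G" "countable S"
  shows "countable (generate G S)"
  using generate_subset_foldr[OF assms(1)] by (rule countable_subset) (simp add: assms)

text \<open>An automorphism is determined by its values on the finite list \<open>ss\<close> of
  generators, hence by one of the countably many lists over a countable group.\<close>

lemma countable_iso_images:
  assumes "finite S" "carrier G = generate G S" "H \<subseteq> carrier G"
  shows "countable ((\<lambda>\<alpha>. \<alpha> ` H) ` iso G G)"
proof -
  have S: "S \<subseteq> carrier G"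
    using assms(2) generate.incl by fast
  obtain ss where ss: "set ss = S"
    using finite_list[OF assms(1)] by blast
  have cG: "countable (carrier G)"
    using assms countable_generate[OF S] by (simp add: countable_finite)
  have agree: "\<alpha> ` H = \<beta> ` H"
    if "\<alpha> \<in> iso G G" "\<beta> \<in> iso G G" "map \<alpha> ss = map \<beta> ss" for \<alpha> \<beta>
  proof -
    interpret \<alpha>: group_hom G G \<alpha>
      using that by (simp add: group_hom_def group_hom_axioms_def iso_def is_group)
    interpret \<beta>: group_hom G G \<beta>
      using that by (simp add: group_hom_def group_hom_axioms_def iso_def is_group)
    have "\<alpha> g = \<beta> g" if "g \<in> generate G S" for g
      using that
    proof induction
      case (incl h)
      then show ?case using \<open>map \<alpha> ss = map \<beta> ss\<close> ss by simp
    next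
      case (inv h)
      then have "\<alpha> h = \<beta> h" using \<open>map \<alpha> ss = map \<beta> ss\<close> ss by simp
      then show ?case using inv S by auto
    next
      case (eng g h)
      then show ?case using generate_in_carrier[OF S] by simp
    qed simp
    then show ?thesis
      using \<open>H \<subseteq> carrier G\<close> assms(2) by (intro image_cong) auto
  qed
  have "(\<lambda>\<alpha>. \<alpha> ` H) ` iso G G =
      (\<lambda>r. inv_into (iso G G) (\<lambda>\<alpha>. map \<alpha> ss) r ` H) ` (\<lambda>\<alpha>. map \<alpha> ss) ` iso G G"
    by (rule image_factor) (rule agree)
  moreover have "(\<lambda>\<alpha>. map \<alpha> ss) ` iso G G \<subseteq> lists (carrier G)"
    using S ss by (auto simp: iso_def hom_def Pi_iff subset_iff)
  then have "countable ((\<lambda>\<alpha>. map \<alpha> ss) ` iso G G)"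
    using cG countable_lists countable_subset by metis
  ultimately show ?thesis
    by simp
qed

lemma countable_aut_class:
  assumes "finite S" "carrier G = generate G S" "H \<subseteq> carrier G"
  shows "countable (aut_class G H)"
  using countable_iso_images[OF assms]
  by (rule countable_subset[rotated]) (auto simp: aut_class_def automorphism_equivalent_def)

lemma aut_class_self: "subgroup H G \<Longrightarrow> H \<in> aut_class G H"
  using iso_set_refl by (auto simp: aut_class_def automorphism_equivalent_def intro!: bexI[of _ "\<lambda>x. x"])

text \<open>A union of a chain that has finite index already has a member of finite index: the finitely
  many elements \<open>t s t'\<inverse>\<close> of the union, with \<open>s\<close> a generator and \<open>t\<close>, \<open>t'\<close> coset
  representatives, lie in one member of the chain, so that finitely many cosets of this member are
  permuted by the generators.\<close>

lemma finite_index_closedI: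
  assumes "subgroup H G" "carrier G = generate G S" "S \<subseteq> carrier G"
    and "finite F" "F \<subseteq> carrier G" "F \<noteq> {}"
    and step: "\<And>f s. f \<in> F \<Longrightarrow> s \<in> S \<union> m_inv G ` S \<Longrightarrow> \<exists>f'\<in>F. f \<otimes> s \<otimes> inv f' \<in> H"
  shows "finite_index G H"
proof -
  have ex: "\<exists>f'\<in>F. H #> (f \<otimes> g) = H #> f'" if "g \<in> generate G S" "f \<in> F" for g f
    using that
  proof (induction arbitrary: f)
    case one
    then show ?case using assms(5) by (intro bexI[of _ f]) auto
  next
    case (incl s)
    then obtain f' where "f' \<in> F" "f \<otimes> s \<otimes> inv f' \<in> H" using step[of f s] by auto
    then show ?case using rcos_eq_iff[OF assms(1), of "f \<otimes> s" f'] incl assms(3,5) by auto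
  next
    case (inv s)
    then obtain f' where "f' \<in> F" "f \<otimes> inv s \<otimes> inv f' \<in> H" using step[of f "inv s"] by auto
    then show ?case using rcos_eq_iff[OF assms(1), of "f \<otimes> inv s" f'] inv assms(3,5) by auto
  next
    case (eng g h)
    have c: "g \<in> carrier G" "h \<in> carrier G"
      using eng generate_in_carrier[OF assms(3)] by auto
    obtain f' where f': "f' \<in> F" "H #> (f \<otimes> g) = H #> f'" using eng by blast
    obtain f'' where f'': "f'' \<in> F" "H #> (f' \<otimes> h) = H #> f''" using eng f' by blast
    have fc: "f \<in> carrier G" "f' \<in> carrier G" using eng f' assms(5) by auto
    have "H #> (f \<otimes> (g \<otimes> h)) = (H #> (f \<otimes> g)) #> h"
      using c fc assms(1) by (simp add: coset_mult_assoc m_assoc subgroup.subset)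
    also have "\<dots> = H #> (f' \<otimes> h)"
      using c fc f' assms(1) by (simp add: coset_mult_assoc subgroup.subset)
    finally show ?case using f'' by auto
  qed
  obtain f0 where f0: "f0 \<in> F" using assms(6) by blast
  have "rcosets H \<subseteq> (\<lambda>f. H #> f) ` F"
  proof
    fix C assume "C \<in> rcosets H"
    then obtain g where g: "g \<in> carrier G" "C = H #> g" by (auto simp: rcosets_image)
    \<comment> \<open>\<open>F\<close> may miss the identity, so the walk through the cosets starts
      at an arbitrary \<open>f0\<close>, and \<open>g\<close> is reached as
      \<open>f0 \<otimes> (inv f0 \<otimes> g)\<close>.\<close>
    have f0c: "f0 \<in> carrier G" using f0 assms(5) by auto
    then have "inv f0 \<otimes> g \<in> carrier G" using g by simp
    then have "inv f0 \<otimes> g \<in> generate G S" using assms(2) by simp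
    then obtain f' where "f' \<in> F" "H #> (f0 \<otimes> (inv f0 \<otimes> g)) = H #> f'" using ex f0 by blast
    then show "C \<in> (\<lambda>f. H #> f) ` F" using g f0c by (auto simp: m_assoc[symmetric])
  qed
  then show ?thesis
    using assms(4) finite_subset unfolding finite_index_def by blast
qed

lemma chain_union_infinite_index:
  assumes fg: "finite S" "carrier G = generate G S"
    and nonempty: "\<C> \<noteq> {}"
    and sub: "\<And>H. H \<in> \<C> \<Longrightarrow> subgroup H G"
    and inf: "\<And>H. H \<in> \<C> \<Longrightarrow> \<not> finite_index G H"
    and chain: "\<And>H K. H \<in> \<C> \<Longrightarrow> K \<in> \<C> \<Longrightarrow> H \<subseteq> K \<or> K \<subseteq> H"
  shows "subgroup (\<Union> \<C>) G" "\<not> finite_index G (\<Union> \<C>)"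
proof -
  define U where "U = \<Union> \<C>"
  have U: "x \<in> U \<longleftrightarrow> (\<exists>H\<in>\<C>. x \<in> H)" for x
    by (auto simp: U_def)
  have S: "S \<subseteq> carrier G"
    using fg(2) generate.incl by fast
  have subU: "subgroup U G"
  proof (rule subgroupI)
    show "U \<subseteq> carrier G"
      using subgroup.subset[OF sub] unfolding U_def by blast
    show "U \<noteq> {}"
      using nonempty sub subgroup.one_closed U by (metis all_not_in_conv)
    show "inv a \<in> U" if "a \<in> U" for a
      using that sub subgroup.m_inv_closed unfolding U by metis
    show "a \<otimes> b \<in> U" if ab: "a \<in> U" "b \<in> U" for a b
    proof -
      obtain H K where "a \<in> H" "H \<in> \<C>" "b \<in> K" "K \<in> \<C>" using ab U by metis
      then obtain M where "M \<in> \<C>" "a \<in> M" "b \<in> M" using chain by (metis subsetD)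
      then show ?thesis using sub subgroup.m_closed unfolding U by metis
    qed
  qed
  then show "subgroup (\<Union> \<C>) G"
    by (simp add: U_def)
  have "\<not> finite_index G U"
  proof
    assume fi: "finite_index G U"
    obtain F where F: "finite F" "F \<subseteq> carrier G"
      and cosets: "\<And>g. g \<in> carrier G \<Longrightarrow> \<exists>f\<in>F. g \<otimes> inv f \<in> U"
      using finite_index_transversal[OF fi subU] by metis
    have "F \<noteq> {}" using cosets[of \<one>] by auto
    have step: "\<exists>f'\<in>F. f \<otimes> s \<otimes> inv f' \<in> U" if "f \<in> F" "s \<in> S \<union> m_inv G ` S" for f s
      by (rule cosets) (use that F S in auto)
    define P where "P = (\<lambda>(f, s, f'). f \<otimes> s \<otimes> inv f') ` (F \<times> (S \<union> m_inv G ` S) \<times> F) \<inter> U"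
    have "finite P" unfolding P_def using F(1) fg(1) by simp
    moreover have "\<forall>x\<in>P. x \<in> U" by (simp add: P_def)
    ultimately have "\<exists>H\<in>\<C>. P \<subseteq> H"
    proof (induction P rule: finite_induct)
      case empty
      then show ?case using nonempty by auto
    next
      case (insert x A)
      then obtain H K where "A \<subseteq> H" "H \<in> \<C>" "x \<in> K" "K \<in> \<C>" using U by (metis insertCI)
      then show ?case using chain[of H K] by (metis insert_subset subset_trans subsetD)
    qed
    then obtain H where H: "H \<in> \<C>" "P \<subseteq> H" by blast
    have "finite_index G H"
    proof (rule finite_index_closedI[OF sub[OF H(1)] fg(2) S F \<open>F \<noteq> {}\<close>])
      show "\<exists>f'\<in>F. f \<otimes> s \<otimes> inv f' \<in> H" if fs: "f \<in> F" "s \<in> S \<union> m_inv G ` S" for f s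
      proof -
        obtain f' where f': "f' \<in> F" "f \<otimes> s \<otimes> inv f' \<in> U" using step[OF fs] by blast
        have "f \<otimes> s \<otimes> inv f' \<in> (\<lambda>(f, s, f'). f \<otimes> s \<otimes> inv f') ` (F \<times> (S \<union> m_inv G ` S) \<times> F)"
          using fs f'(1) by (intro image_eqI[of _ _ "(f, s, f')"]) simp_all
        then have "f \<otimes> s \<otimes> inv f' \<in> P" using f'(2) by (simp add: P_def)
        then show ?thesis using H(2) f'(1) by blast
      qed
    qed
    then show False using inf H(1) by simp
  qed
  then show "\<not> finite_index G (\<Union> \<C>)"
    by (simp add: U_def)
qed

text \<open>Zorn's lemma, with upper bounds from \<open>chain_union_infinite_index\<close>; this is
  where finite generation enters.\<close>

lemma weakly_maximal_above:
  assumes fg: "finite S" "carrier G = generate G S"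
    and H: "subgroup H G" "\<not> finite_index G H"
  obtains W where "weakly_maximal G W" "H \<subseteq> W"
proof -
  define A where "A = {K. subgroup K G \<and> \<not> finite_index G K \<and> H \<subseteq> K}"
  have "\<exists>M\<in>A. \<forall>X\<in>A. M \<subseteq> X \<longrightarrow> X = M"
  proof (rule subset_Zorn_nonempty)
    show "A \<noteq> {}" using H by (auto simp: A_def)
    fix \<C> assume c: "\<C> \<noteq> {}" "subset.chain A \<C>"
    have sub: "subgroup K G" "\<not> finite_index G K" "H \<subseteq> K" if "K \<in> \<C>" for K
      using that c unfolding subset.chain_def A_def by blast+
    moreover have "K \<subseteq> L \<or> L \<subseteq> K" if "K \<in> \<C>" "L \<in> \<C>" for K L
      using that c unfolding subset.chain_def by blast
    ultimately have "subgroup (\<Union> \<C>) G" "\<not> finite_index G (\<Union> \<C>)"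
      using chain_union_infinite_index[OF fg c(1)] by simp_all
    moreover have "H \<subseteq> \<Union> \<C>" using sub c(1) by blast
    ultimately show "\<Union> \<C> \<in> A" by (simp add: A_def)
  qed
  then obtain M where "M \<in> A" "\<forall>X\<in>A. M \<subseteq> X \<longrightarrow> X = M" by blast
  then have M: "subgroup M G" "\<not> finite_index G M" "H \<subseteq> M"
    and max: "\<And>K. subgroup K G \<Longrightarrow> \<not> finite_index G K \<Longrightarrow> H \<subseteq> K \<Longrightarrow> M \<subseteq> K \<Longrightarrow> K = M"
    by (simp_all add: A_def)
  have "weakly_maximal G M"
    unfolding weakly_maximal_def using M max[OF _ _ subset_trans[OF M(3)]] by simp
  then show ?thesis using that M(3) by simp
qed

end

definition commutator :: "('a, 'b) monoid_scheme \<Rightarrow> 'a \<Rightarrow> 'a \<Rightarrow> 'a" where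
  "commutator G g h = g \<otimes>\<^bsub>G\<^esub> h \<otimes>\<^bsub>G\<^esub> inv\<^bsub>G\<^esub> g \<otimes>\<^bsub>G\<^esub> inv\<^bsub>G\<^esub> h"

context group
begin

lemma commutator_closed [simp]:
  "g \<in> carrier G \<Longrightarrow> h \<in> carrier G \<Longrightarrow> commutator G g h \<in> carrier G"
  by (simp add: commutator_def)

lemma commutator_eq_one_iff:
  assumes "g \<in> carrier G" "h \<in> carrier G"
  shows "commutator G g h = \<one> \<longleftrightarrow> g \<otimes> h = h \<otimes> g"
proof -
  have "commutator G g h = (g \<otimes> h) \<otimes> inv (h \<otimes> g)"
    using assms by (simp add: commutator_def inv_mult_group m_assoc)
  then show ?thesis
    using assms by (metis inv_closed inv_equality inv_inv m_closed r_inv)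
qed

end

section \<open>Actions on rooted trees\<close>

text \<open>Weaker than a branch action: a faithful action respecting lengths and prefixes. The same
  locale thus serves the given action, an arbitrary second branch action, and the latter twisted by
  an automorphism.\<close>

locale tree_action = group G for G (structure) +
  fixes T :: "nat list set" and \<phi> :: "'a \<Rightarrow> nat list \<Rightarrow> nat list"
  assumes tree: "rooted_tree T"
    and act_closed: "g \<in> carrier G \<Longrightarrow> u \<in> T \<Longrightarrow> \<phi> g u \<in> T"
    and act_length: "g \<in> carrier G \<Longrightarrow> u \<in> T \<Longrightarrow> length (\<phi> g u) = length u"
    and act_prefix: "g \<in> carrier G \<Longrightarrow> v \<in> T \<Longrightarrow> prefix u v \<Longrightarrow> prefix (\<phi> g u) (\<phi> g v)"
    and act_mult: "g \<in> carrier G \<Longrightarrow> h \<in> carrier G \<Longrightarrow> u \<in> T \<Longrightarrow> \<phi> (g \<otimes> h) u = \<phi> g (\<phi> h u)"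
    and act_one: "u \<in> T \<Longrightarrow> \<phi> \<one> u = u"
    and faithful: "g \<in> carrier G \<Longrightarrow> (\<And>u. u \<in> T \<Longrightarrow> \<phi> g u = u) \<Longrightarrow> g = \<one>"
begin

abbreviation "Rist v \<equiv> rist G T \<phi> v"

lemma act_inv [simp]:
  assumes "g \<in> carrier G" "u \<in> T"
  shows "\<phi> (inv g) (\<phi> g u) = u" "\<phi> g (\<phi> (inv g) u) = u"
  using assms by (simp_all add: act_mult[symmetric] act_one)

lemma act_inj: "g \<in> carrier G \<Longrightarrow> u \<in> T \<Longrightarrow> v \<in> T \<Longrightarrow> \<phi> g u = \<phi> g v \<longleftrightarrow> u = v"
  by (metis act_inv(1))

lemma prefix_closed: "v \<in> T \<Longrightarrow> prefix u v \<Longrightarrow> u \<in> T"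
  using tree by (auto simp: rooted_tree_def)

lemma Nil_in: "[] \<in> T"
  using tree by (simp add: rooted_tree_def)

lemma rist_iff:
  "g \<in> Rist v \<longleftrightarrow> g \<in> carrier G \<and> (\<forall>u\<in>T. \<not> prefix v u \<longrightarrow> \<phi> g u = u)"
  by (auto simp: rist_def subtree_at_def)

text \<open>If \<open>g\<close> moved \<open>v\<close>, the image would be another vertex of the
  same length, hence outside the subtree of \<open>v\<close> and fixed by \<open>g\<close>, against
  injectivity.\<close>

lemma rist_fix:
  assumes "g \<in> Rist v" "v \<in> T"
  shows "\<phi> g v = v"
proof (rule ccontr)
  assume ne: "\<phi> g v \<noteq> v"
  have g: "g \<in> carrier G" using assms by (simp add: rist_iff)
  then have "\<not> prefix v (\<phi> g v)"
    using ne assms(2) act_length[OF g assms(2)] by (auto simp: prefix_def)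
  then have "\<phi> g (\<phi> g v) = \<phi> g v"
    using assms act_closed[OF g] by (simp add: rist_iff)
  then show False
    using ne g assms(2) by (simp add: act_inj act_closed)
qed

lemma rist_subgroup:
  assumes "v \<in> T"
  shows "subgroup (Rist v) G"
proof (rule subgroupI)
  have "\<one> \<in> Rist v" by (simp add: rist_iff act_one)
  then show "Rist v \<noteq> {}" by blast
  show "Rist v \<subseteq> carrier G" by (auto simp: rist_iff)
  show "inv a \<in> Rist v" if "a \<in> Rist v" for a
    using that unfolding rist_iff by (metis act_inv(1) inv_closed)
  show "a \<otimes> b \<in> Rist v" if "a \<in> Rist v" "b \<in> Rist v" for a b
    using that unfolding rist_iff by (simp add: act_mult)
qed

lemma rist_mono: "prefix u v \<Longrightarrow> Rist v \<subseteq> Rist u"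
  by (auto simp: rist_iff)

lemma rist_conj:
  assumes "h \<in> Rist v" "g \<in> carrier G" "v \<in> T"
  shows "g \<otimes> h \<otimes> inv g \<in> Rist (\<phi> g v)"
  unfolding rist_iff
proof (intro conjI ballI impI)
  have h: "h \<in> carrier G" using assms(1) by (simp add: rist_iff)
  show "g \<otimes> h \<otimes> inv g \<in> carrier G" using h assms by simp
  fix u assume u: "u \<in> T" "\<not> prefix (\<phi> g v) u"
  have "\<phi> (inv g) u \<in> T" using u assms by (simp add: act_closed)
  moreover have "\<not> prefix v (\<phi> (inv g) u)"
    using u assms act_prefix[of g "\<phi> (inv g) u" v] calculation by auto
  ultimately have "\<phi> h (\<phi> (inv g) u) = \<phi> (inv g) u" using assms(1) by (simp add: rist_iff)
  then show "\<phi> (g \<otimes> h \<otimes> inv g) u = u"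
    using u h assms by (simp add: act_mult act_closed)
qed

lemma same_length_prefix: "length u = length v \<Longrightarrow> prefix u w \<Longrightarrow> prefix v w \<Longrightarrow> u = v"
  by (metis prefix_def append_eq_append_conv)

lemma rist_disjoint:
  assumes "h \<in> Rist u" "h \<in> Rist v" "length u = length v" "u \<noteq> v"
  shows "h = \<one>"
  using assms by (intro faithful) (auto simp: rist_iff dest: same_length_prefix)

lemma act_eqI:
  assumes "g \<in> carrier G" "h \<in> carrier G" "\<And>u. u \<in> T \<Longrightarrow> \<phi> g u = \<phi> h u"
  shows "g = h"
proof -
  have "inv h \<otimes> g = \<one>"
    using assms by (intro faithful) (simp_all add: act_mult)
  then show ?thesis
    using assms by (metis inv_equality inv_inv inv_closed)
qed

lemma rist_commute:
  assumes "h \<in> Rist u" "k \<in> Rist v" "length u = length v" "u \<noteq> v" "u \<in> T" "v \<in> T"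
  shows "h \<otimes> k = k \<otimes> h"
proof (rule act_eqI)
  have c: "h \<in> carrier G" "k \<in> carrier G" using assms by (simp_all add: rist_iff)
  then show "h \<otimes> k \<in> carrier G" "k \<otimes> h \<in> carrier G" by simp_all
  fix w assume w: "w \<in> T"
  \<comment> \<open>Stated for fresh variables, so that it also applies with the roles of
    \<open>h\<close>, \<open>u\<close> and \<open>k\<close>, \<open>v\<close> exchanged.\<close>
  have *: "\<phi> h (\<phi> k w) = \<phi> k (\<phi> h w)"
    if "prefix u w" "h \<in> Rist u" "k \<in> Rist v" "u \<in> T" "v \<in> T" "length u = length v" "u \<noteq> v" for h k u v
  proof -
    have c: "h \<in> carrier G" "k \<in> carrier G" using that by (simp_all add: rist_iff)
    have "prefix u (\<phi> h w)" using act_prefix[of h w u] rist_fix[of h u] that c w by simp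
    then have "\<not> prefix v w" "\<not> prefix v (\<phi> h w)" using that same_length_prefix by blast+
    then show ?thesis using that w c by (simp add: rist_iff act_closed)
  qed
  consider "prefix u w" | "prefix v w" | "\<not> prefix u w" "\<not> prefix v w" by blast
  then have "\<phi> h (\<phi> k w) = \<phi> k (\<phi> h w)"
  proof cases
    case 3
    then show ?thesis using assms w by (simp add: rist_iff)
  qed (use *[of u h k v] *[of v k h u] assms in auto)
  then show "\<phi> (h \<otimes> k) w = \<phi> (k \<otimes> h) w" using c w by (simp add: act_mult)
qed

text \<open>If \<open>k\<close> commuted with \<open>g\<close>, it would equal its conjugate by
  \<open>g\<close> and so act trivially outside two disjoint subtrees.\<close>

lemma rist_moved_not_commute:
  assumes "g \<in> carrier G" "z \<in> T" "\<phi> g z \<noteq> z" "k \<in> Rist z" "k \<noteq> \<one>"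
  shows "g \<otimes> k \<noteq> k \<otimes> g"
proof
  assume eq: "g \<otimes> k = k \<otimes> g"
  have k: "k \<in> carrier G" using assms by (simp add: rist_iff)
  have "g \<otimes> k \<otimes> inv g = k" using eq k assms(1) by (simp add: m_assoc)
  then have "k \<in> Rist (\<phi> g z)" using rist_conj[of k z g] assms by simp
  then show False using rist_disjoint[of k "\<phi> g z" z] assms by (simp add: act_length)
qed

lemma rist_moves_below:
  assumes "k \<in> Rist z" "k \<noteq> \<one>"
  obtains w where "w \<in> T" "prefix z w" "\<phi> k w \<noteq> w"
  using assms faithful[of k] by (auto simp: rist_iff)

text \<open>Take any nontrivial \<open>k\<close> and then a nontrivial \<open>l\<close> supported
  below a vertex that \<open>k\<close> moves.\<close>

lemma rist_noncommuting:
  assumes inf: "\<And>z. z \<in> T \<Longrightarrow> infinite (Rist z)"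
    and H: "subgroup H G" "finite_index G H" and z: "z \<in> T"
  obtains k l where "k \<in> Rist z \<inter> H" "l \<in> Rist z \<inter> H" "k \<otimes> l \<noteq> l \<otimes> k"
proof -
  obtain k where k: "k \<in> Rist z" "k \<in> H" "k \<noteq> \<one>"
    using finite_index_inter_infinite[OF H(2,1) rist_subgroup inf] z by metis
  obtain w where w: "w \<in> T" "prefix z w" "\<phi> k w \<noteq> w"
    using rist_moves_below k by metis
  obtain l where l: "l \<in> Rist w" "l \<in> H" "l \<noteq> \<one>"
    using finite_index_inter_infinite[OF H(2,1) rist_subgroup inf] w(1) by metis
  have "k \<otimes> l \<noteq> l \<otimes> k"
    using rist_moved_not_commute[of k w l] k l w by (simp add: rist_iff)
  moreover have "l \<in> Rist z" using l(1) w(2) rist_mono by blast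
  ultimately show ?thesis using that k l by blast
qed

end

lemma (in tree_action) stabilizer_subgroup:
  assumes "v \<in> T"
  shows "subgroup {g \<in> carrier G. \<phi> g v = v} G"
proof (rule subgroupI)
  show "inv a \<in> {g \<in> carrier G. \<phi> g v = v}" if "a \<in> {g \<in> carrier G. \<phi> g v = v}" for a
    using that assms act_inv(1)[of a v] by auto
qed (use assms in \<open>auto simp: act_one act_mult\<close>)

text \<open>\<open>finite_index\<close> counts right cosets, and the right coset of \<open>g\<close>
  is determined by the image of \<open>v\<close> under the inverse of \<open>g\<close>; hence the
  inverse in the invariant.\<close>

lemma (in tree_action) stabilizer_finite_index:
  assumes "v \<in> T" "finite (level T (length v))"
  shows "finite_index G {g \<in> carrier G. \<phi> g v = v}"
proof (rule finite_index_mapI[OF stabilizer_subgroup[OF assms(1)], of "\<lambda>g. \<phi> (inv g) v"])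
  show "finite ((\<lambda>g. \<phi> (inv g) v) ` carrier G)"
    by (rule finite_subset[OF _ assms(2)]) (use assms(1) in \<open>auto simp: level_def act_closed act_length\<close>)
  fix g h assume gh: "g \<in> carrier G" "h \<in> carrier G" "\<phi> (inv g) v = \<phi> (inv h) v"
  then have "\<phi> (g \<otimes> inv h) v = \<phi> g (\<phi> (inv g) v)" using assms(1) by (simp add: act_mult)
  also have "\<dots> = v" using gh(1) assms(1) by simp
  finally show "g \<otimes> inv h \<in> {g \<in> carrier G. \<phi> g v = v}" using gh by simp
qed

text \<open>For a second action \<open>\<psi>\<close>, put \<open>R = Rist\<^sub>\<psi>(v)\<close> and let \<open>H\<close> be the stabilizer of \<open>v\<close>.  If
  \<open>r \<in> R\<close> moves \<open>y\<close>, then \<open>[[r, k], l] = [k\<inverse>, l]\<close> for \<open>k, l \<in> Rist\<^sub>\<phi>(y) \<inter> H\<close>, so that \<open>R\<close>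
  contains all commutators of \<open>Rist\<^sub>\<phi>(y) \<inter> H\<close>.  An element \<open>g\<close> outside \<open>H\<close> makes \<open>R\<close> commute with its
  conjugate by \<open>g\<close>; but these commutators are not changed by \<open>g\<close> if \<open>g\<close> fixes the descendants of
  \<open>y\<close>, and they do not all commute.\<close>

lemma (in tree_action) fixator_le_stabilizer:
  assumes inf: "\<And>z. z \<in> T \<Longrightarrow> infinite (Rist z)"
    and T': "tree_action G T' \<psi>" and v: "v \<in> T'" "finite (level T' (length v))"
    and nontriv: "rist G T' \<psi> v \<noteq> {\<one>}"
  obtains x y where "x # y \<in> T"
    "\<And>g. g \<in> carrier G \<Longrightarrow> (\<And>u. u \<in> T \<Longrightarrow> prefix [x] u \<Longrightarrow> \<phi> g u = u) \<Longrightarrow> \<psi> g v = v"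
proof -
  interpret T': tree_action G T' \<psi> by (rule T')
  define H where "H = {g \<in> carrier G. \<psi> g v = v}"
  have H: "subgroup H G" "finite_index G H"
    using T'.stabilizer_subgroup T'.stabilizer_finite_index v by (simp_all add: H_def)
  have Hc: "g \<in> carrier G" if "g \<in> H" for g using that by (simp add: H_def)
  have Rsub: "subgroup (T'.Rist v) G" by (rule T'.rist_subgroup[OF v(1)])
  then obtain r where r: "r \<in> T'.Rist v" "r \<noteq> \<one>"
    using nontriv subgroup.one_closed by blast
  have rc: "r \<in> carrier G" using r by (simp add: T'.rist_iff)
  then obtain w where w: "w \<in> T" "\<phi> r w \<noteq> w" using r faithful by blast
  then obtain x y where xy: "w = x # y"
    using act_length[OF rc Nil_in] by (cases w) auto
  have normR: "k \<otimes> s \<otimes> inv k \<in> T'.Rist v" if "s \<in> T'.Rist v" "k \<in> H" for s k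
    using T'.rist_conj[OF that(1) _ v(1), of k] that(2) by (simp add: H_def)
  have commR: "commutator G k l \<in> T'.Rist v" if kl: "k \<in> Rist w \<inter> H" "l \<in> Rist w \<inter> H" for k l
  proof -
    have c: "k \<in> carrier G" "l \<in> carrier G" using kl Hc by blast+
    define q where "q = r \<otimes> k \<otimes> inv r"
    have qc: "q \<in> carrier G" using c rc by (simp add: q_def)
    have "q \<in> Rist (\<phi> r w)" unfolding q_def using rist_conj[of k w r] kl rc w by simp
    then have ql: "q \<otimes> l = l \<otimes> q"
      using rist_commute[of q "\<phi> r w" l w] kl w rc by (simp add: act_closed act_length)
    have "k \<otimes> inv r \<otimes> inv k \<in> T'.Rist v"
      using normR[of "inv r" k] kl r Rsub by (simp add: subgroup.m_inv_closed)
    then have "r \<otimes> (k \<otimes> inv r \<otimes> inv k) \<in> T'.Rist v"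
      using r Rsub by (simp add: subgroup.m_closed)
    then have s: "q \<otimes> inv k \<in> T'.Rist v"
      using c rc by (simp add: q_def m_assoc)
    \<comment> \<open>\<open>q \<otimes> inv k\<close> is the commutator of \<open>r\<close> and
      \<open>k\<close>. As \<open>q\<close> commutes with \<open>l\<close>, it cancels in the
      commutator taken next with \<open>l\<close>, and only \<open>k\<close> and \<open>l\<close>
      remain.\<close>
    have "inv (q \<otimes> inv k) \<otimes> (l \<otimes> (q \<otimes> inv k) \<otimes> inv l) \<in> T'.Rist v"
      using s normR[OF s, of l] kl Rsub by (simp add: subgroup.m_inv_closed subgroup.m_closed)
    also have "inv (q \<otimes> inv k) \<otimes> (l \<otimes> (q \<otimes> inv k) \<otimes> inv l) = k \<otimes> inv q \<otimes> (l \<otimes> q) \<otimes> inv k \<otimes> inv l"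
      using c qc by (simp add: inv_mult_group m_assoc)
    also have "\<dots> = k \<otimes> l \<otimes> inv k \<otimes> inv l"
      unfolding ql[symmetric] using c qc by (simp add: m_assoc) (simp add: m_assoc[symmetric])
    finally show ?thesis by (simp add: commutator_def)
  qed
  obtain k l where kl: "k \<in> Rist w \<inter> H" "l \<in> Rist w \<inter> H" "k \<otimes> l \<noteq> l \<otimes> k"
    using rist_noncommuting[OF inf H w(1)] by blast
  define c where "c = commutator G k l"
  have c: "c \<in> Rist w" "c \<in> T'.Rist v" "c \<noteq> \<one>" "c \<in> carrier G"
    using kl commR[OF kl(1,2)] Hc rist_subgroup[OF w(1)]
    by (simp_all add: c_def commutator_eq_one_iff)
      (simp add: commutator_def subgroup.m_closed subgroup.m_inv_closed)
  \<comment> \<open>Below a vertex moved by \<open>c\<close>, a second nontrivial commutator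
    \<open>e\<close> cannot commute with \<open>c\<close>. This pair will contradict the commutation
    of the rigid stabilizers of \<open>v\<close> and of its image under \<open>g\<close>.\<close>
  obtain z where z: "z \<in> T" "prefix w z" "\<phi> c z \<noteq> z"
    using rist_moves_below[OF c(1,3)] by blast
  obtain m n where mn: "m \<in> Rist z \<inter> H" "n \<in> Rist z \<inter> H" "m \<otimes> n \<noteq> n \<otimes> m"
    using rist_noncommuting[OF inf H z(1)] by blast
  define e where "e = commutator G m n"
  have e: "e \<in> Rist z" "e \<noteq> \<one>"
    using mn Hc rist_subgroup[OF z(1)]
    by (simp_all add: e_def commutator_eq_one_iff)
      (simp add: commutator_def subgroup.m_closed subgroup.m_inv_closed)
  have eR: "e \<in> T'.Rist v"
    unfolding e_def by (rule commR) (use mn rist_mono[OF z(2)] in auto)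
  have ce: "c \<otimes> e \<noteq> e \<otimes> c"
    using rist_moved_not_commute[OF c(4) z(1,3) e] .
  have "\<psi> g v = v" if g: "g \<in> carrier G" "\<And>u. u \<in> T \<Longrightarrow> prefix [x] u \<Longrightarrow> \<phi> g u = u" for g
  proof (rule ccontr)
    assume ne: "\<psi> g v \<noteq> v"
    have "g \<otimes> c = c \<otimes> g"
    proof (rule act_eqI)
      fix u assume u: "u \<in> T"
      have "\<phi> g (\<phi> c u) = \<phi> c (\<phi> g u)"
      proof (cases "prefix [x] u")
        case True
        have xw: "prefix [x] w" using xy by simp
        have "prefix (\<phi> c [x]) w" using act_prefix[OF c(4) w(1) xw] rist_fix[OF c(1) w(1)] by simp
        moreover have "length (\<phi> c [x]) = length [x]"
          using act_length[OF c(4) prefix_closed[OF w(1) xw]] by simp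
        ultimately have "\<phi> c [x] = [x]" by (intro same_length_prefix[of _ _ w]) (use xw in simp_all)
        then have "prefix [x] (\<phi> c u)" using act_prefix[OF c(4) u True] by simp
        then show ?thesis using g u True c(4) by (simp add: act_closed)
      next
        case False
        have "\<not> prefix [x] (\<phi> g u)"
        proof
          assume "prefix [x] (\<phi> g u)"
          then have "\<phi> g (\<phi> g u) = \<phi> g u" using g u by (simp add: act_closed)
          then have "\<phi> g u = u" using g(1) u by (simp add: act_inj act_closed)
          then show False using False \<open>prefix [x] (\<phi> g u)\<close> by simp
        qed
        then have "\<not> prefix w (\<phi> g u)" "\<not> prefix w u" using False xy by (auto simp: prefix_def)
        then show ?thesis using c(1) u g(1) by (simp add: rist_iff act_closed)
      qed
      then show "\<phi> (g \<otimes> c) u = \<phi> (c \<otimes> g) u" using g(1) c(4) u by (simp add: act_mult)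
    qed (use g(1) c(4) in simp_all)
    then have "g \<otimes> c \<otimes> inv g = c" using g(1) c(4) by (simp add: m_assoc)
    then have "c \<in> T'.Rist (\<psi> g v)" using T'.rist_conj[OF c(2) g(1) v(1)] by simp
    then show False
      using T'.rist_commute[OF _ eR] ne v(1) g(1) ce by (simp add: T'.act_length T'.act_closed)
  qed
  then show ?thesis using that w(1) xy by blast
qed

section \<open>Tree automorphisms respect prefixes; branch actions as instances of
  \<open>tree_action\<close>\<close>

lemma tree_auts_child:
  assumes T: "rooted_tree T" and f: "f \<in> tree_auts T" and u: "u @ [x] \<in> T"
  shows "\<exists>x'. f (u @ [x]) = f u @ [x']"
  using u
proof (induction u arbitrary: x rule: rev_induct)
  case Nil
  moreover have "[] \<in> T" using T by (simp add: rooted_tree_def)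
  moreover have "adjacent [] [x]" by (simp add: adjacent_def)
  ultimately have "adjacent (f []) (f [x])"
    using f Nil by (simp add: tree_auts_def del: append.simps(1)) (metis append_Nil)
  then show ?case using f by (simp add: tree_auts_def adjacent_def)
next
  case (snoc z u)
  have uT: "u @ [z] \<in> T" "u \<in> T"
    using snoc.prems T by (auto simp: rooted_tree_def prefix_def)
  have inj: "inj_on f T"
    using f by (auto simp: tree_auts_def Bij_def bij_betw_def)
  obtain z' where z': "f (u @ [z]) = f u @ [z']" using snoc.IH[OF uT(1)] by blast
  have "adjacent (f (u @ [z])) (f ((u @ [z]) @ [x]))"
    using f uT(1) snoc.prems by (simp add: tree_auts_def adjacent_def)
  then consider y where "f ((u @ [z]) @ [x]) = f (u @ [z]) @ [y]"
    | y where "f (u @ [z]) = f ((u @ [z]) @ [x]) @ [y]"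
    by (auto simp: adjacent_def)
  then show ?case
  proof cases
    \<comment> \<open>The other kind of neighbour of \<open>f (u @ [z])\<close> is its parent
      \<open>f u\<close>, which is already the image of \<open>u\<close>; injectivity excludes
      it.\<close>
    case 2
    then have "f u = f ((u @ [z]) @ [x])" using z' by simp
    then have "u = (u @ [z]) @ [x]" using inj_onD[OF inj] uT(2) snoc.prems by blast
    then show ?thesis by simp
  qed blast
qed

lemma tree_auts_prefix:
  assumes T: "rooted_tree T" and f: "f \<in> tree_auts T" and v: "u @ w \<in> T"
  shows "prefix (f u) (f (u @ w)) \<and> length (f (u @ w)) = length (f u) + length w"
  using v
proof (induction w rule: rev_induct)
  case (snoc x w)
  then have "u @ w \<in> T" using T by (auto simp: rooted_tree_def prefix_def)
  moreover obtain x' where "f ((u @ w) @ [x]) = f (u @ w) @ [x']"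
    using tree_auts_child[OF T f, of "u @ w" x] snoc.prems by auto
  ultimately show ?case using snoc.IH by (auto simp: prefix_def)
qed simp

lemma tree_action_faithfulI:
  assumes T: "rooted_tree T" and act: "faithful_action G T \<phi>"
    and aut: "\<And>g. g \<in> carrier G \<Longrightarrow> \<phi> g \<in> tree_auts T"
  shows "tree_action G T \<phi>"
proof -
  interpret faithful_action G T \<phi> by (rule act)
  interpret group_hom G "BijGroup T" \<phi> by (rule group_hom)
  have Bij: "\<phi> g \<in> Bij T" if "g \<in> carrier G" for g
    using aut[OF that] by (simp add: tree_auts_def)
  have one: "\<phi> \<one>\<^bsub>G\<^esub> = (\<lambda>x\<in>T. x)"
    using hom_one by (simp add: BijGroup_def)
  show ?thesis
  proof
    fix g u v
    assume g: "g \<in> carrier G"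
    have root: "\<phi> g [] = []" using aut[OF g] by (simp add: tree_auts_def)
    show "\<phi> g u \<in> T" if "u \<in> T" using Bij[OF g] that by (auto simp: Bij_def bij_betw_def)
    show "length (\<phi> g u) = length u" if "u \<in> T"
      using tree_auts_prefix[OF T aut[OF g], of "[]" u] that root by simp
    show "prefix (\<phi> g u) (\<phi> g v)" if "v \<in> T" "prefix u v"
      using tree_auts_prefix[OF T aut[OF g], of u] that by (auto simp: prefix_def)
    show "g = \<one>\<^bsub>G\<^esub>" if "\<And>u. u \<in> T \<Longrightarrow> \<phi> g u = u"
    proof -
      have "\<phi> g = \<phi> \<one>\<^bsub>G\<^esub>"
        unfolding one by (rule extensionalityI[of _ T]) (use that Bij[OF g] in \<open>auto simp: Bij_def\<close>)
      then show ?thesis using faithful g by (simp add: inj_on_def)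
    qed
  next
    fix g h u assume "g \<in> carrier G" "h \<in> carrier G" "u \<in> T"
    then show "\<phi> (g \<otimes>\<^bsub>G\<^esub> h) u = \<phi> g (\<phi> h u)"
      using Bij by (simp add: BijGroup_def compose_def)
  qed (use T one in simp_all)
qed

text \<open>Twisting turns a question about the image of a subgroup under \<open>\<beta>\<close>
  into one about the subgroup itself, acting through another tree action.\<close>

lemma (in tree_action) tree_action_comp:
  assumes "\<beta> \<in> iso G G"
  shows "tree_action G T (\<lambda>g. \<phi> (\<beta> g))"
proof -
  interpret \<beta>: group_hom G G \<beta>
    using assms by (simp add: group_hom_def group_hom_axioms_def iso_def is_group)
  have "g = \<one>" if "g \<in> carrier G" "\<And>u. u \<in> T \<Longrightarrow> \<phi> (\<beta> g) u = u" for g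
  proof -
    have "\<beta> g = \<beta> \<one>" using faithful[of "\<beta> g"] that by simp
    then show ?thesis using assms that(1) by (auto simp: iso_def bij_betw_def inj_on_def)
  qed
  then show ?thesis
    by unfold_locales (auto simp: tree act_closed act_length act_prefix act_mult act_one)
qed

lemma spherically_regular_finite_level:
  assumes "spherically_regular_tree T"
  shows "finite (level T n)"
proof (induction n)
  case 0
  have "level T 0 \<subseteq> {[]}" by (auto simp: level_def)
  then show ?case by (rule finite_subset) simp
next
  case (Suc n)
  have "level T (Suc n) \<subseteq> (\<Union>v\<in>level T n. neighbours T v)"
  proof
    fix u assume u: "u \<in> level T (Suc n)"
    then obtain v x where vx: "u = v @ [x]" by (cases u rule: rev_cases) (auto simp: level_def)
    then have "v \<in> level T n" "u \<in> neighbours T v"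
      using u assms
      by (auto simp: level_def neighbours_def adjacent_def spherically_regular_tree_def
        rooted_tree_def prefix_def)
    then show "u \<in> (\<Union>v\<in>level T n. neighbours T v)" by blast
  qed
  moreover have "finite (neighbours T v)" if "v \<in> level T n" for v
    using that assms by (auto simp: spherically_regular_tree_def level_def)
  ultimately show ?case using Suc by (meson finite_UN_I finite_subset)
qed

lemma branch_action_tree_action:
  assumes "spherically_regular_tree T" "branch_action G T \<phi>"
  shows "tree_action G T \<phi>"
  using assms tree_action_faithfulI by (auto simp: branch_action_def spherically_regular_tree_def)

lemma boundary_in:
  assumes "r \<in> boundary T"
  shows "r n \<in> T" "length (r n) = n" "m \<le> n \<Longrightarrow> prefix (r m) (r n)"
proof -
  show "r n \<in> T" using assms by (simp add: boundary_def)
  show "length (r n) = n"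
  proof (induction n)
    case (Suc n)
    obtain x where "r (Suc n) = r n @ [x]" using assms by (auto simp: boundary_def)
    then show ?case using Suc by simp
  qed (use assms in \<open>simp add: boundary_def\<close>)
  show "prefix (r m) (r n)" if "m \<le> n"
    using that
  proof (induction n rule: dec_induct)
    case (step n)
    obtain x where "r (Suc n) = r n @ [x]" using assms by (auto simp: boundary_def)
    then show ?case using step by simp
  qed simp
qed

text \<open>By transitivity the rigid stabilizers of one level are conjugate. If one were trivial,
  the whole level would have a trivial rigid stabilizer of finite index, and the group would be
  finite.\<close>

lemma branch_action_rist_nontrivial:
  fixes G (structure)
  assumes "spherically_regular_tree T" "branch_action G T \<phi>" "infinite (carrier G)" "v \<in> T"
  shows "rist G T \<phi> v \<noteq> {\<one>}"
proof
  interpret tree_action G T \<phi> by (rule branch_action_tree_action[OF assms(1,2)])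
  assume triv: "Rist v = {\<one>}"
  have "Rist w = {\<one>}" if w: "w \<in> level T (length v)" for w
  proof -
    obtain g where g: "g \<in> carrier G" "\<phi> g w = v"
      using assms(2,4) w unfolding branch_action_def level_def by blast
    have "h = \<one>" if h: "h \<in> Rist w" for h
    proof -
      have "g \<otimes> h \<otimes> inv g \<in> Rist v" using rist_conj[OF h g(1)] w g(2) by (simp add: level_def)
      then have "g \<otimes> h \<otimes> inv g = \<one>" using triv by simp
      then have "g \<otimes> h = g"
        using g(1) h by (metis inv_closed inv_equality inv_inv m_closed rist_iff)
      then show ?thesis using g(1) h by (simp add: rist_iff)
    qed
    moreover have "\<one> \<in> Rist w" by (simp add: rist_iff act_one)
    ultimately show ?thesis by blast
  qed
  then have "(\<Union>w \<in> level T (length v). Rist w) \<subseteq> {\<one>}" by blast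
  then have "rist_level G T \<phi> (length v) \<subseteq> {\<one>}"
    unfolding rist_level_def using generate_subgroup_incl[OF _ triv_subgroup] by blast
  then have "finite (rist_level G T \<phi> (length v))" by (rule finite_subset) simp
  moreover have "finite_index G (rist_level G T \<phi> (length v))"
    using assms(2) by (simp add: branch_action_def)
  moreover have "subgroup (rist_level G T \<phi> (length v)) G"
    unfolding rist_level_def by (rule generate_is_subgroup) (auto simp: rist_iff)
  ultimately show False using infinite_of_finite_index assms(3) by blast
qed

text \<open>An infinite group acting faithfully moves some vertex, and hence, by transitivity, every
  vertex of that level.\<close>

lemma branch_action_moves_ray:
  fixes G (structure)
  assumes "spherically_regular_tree T" "branch_action G T \<phi>" "infinite (carrier G)" "r \<in> boundary T"
  obtains n g where "g \<in> carrier G" "\<phi> g (r n) \<noteq> r n"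
proof -
  interpret tree_action G T \<phi> by (rule branch_action_tree_action[OF assms(1,2)])
  have "\<not> carrier G \<subseteq> {\<one>}" using assms(3) finite_subset by blast
  then obtain g u where g: "g \<in> carrier G" "u \<in> T" "\<phi> g u \<noteq> u" using faithful by blast
  have lev: "r (length u) \<in> level T (length u)" "u \<in> level T (length u)"
    using boundary_in[OF assms(4)] g by (auto simp: level_def)
  show ?thesis
  proof (cases "r (length u) = u")
    case False
    obtain h where "h \<in> carrier G" "\<phi> h (r (length u)) = u"
      using assms(2) lev unfolding branch_action_def by blast
    then show ?thesis using False that[of h "length u"] by auto
  qed (use g that[of g "length u"] in auto)
qed

section \<open>Weakly maximal subgroups of branch groups\<close>

lemma rooted_regular_tree: "rooted_tree (regular_tree d)"
  by (auto simp: rooted_tree_def regular_tree_def prefix_def)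

lemma level_regular_tree: "level (regular_tree d) n = {xs. set xs \<subseteq> {..<d} \<and> length xs = n}"
  by (auto simp: level_def regular_tree_def)

lemma card_level_regular_tree: "card (level (regular_tree d) n) = d ^ n"
  by (simp add: level_regular_tree card_lists_length_eq)

lemma finite_level_regular_tree: "finite (level (regular_tree d) n)"
  by (simp add: level_regular_tree finite_lists_length_eq)

text \<open>The bound lets \<open>n\<close> be chosen as the size of a finite set supposed to cover
  level \<open>n\<close>; the level is then too large.\<close>

lemma less_card_level_regular_tree:
  assumes "2 \<le> d"
  shows "n < card (level (regular_tree d) n)"
proof -
  have "n < 2 ^ n" by (rule less_exp)
  also have "(2::nat) ^ n \<le> d ^ n" using assms by (intro power_mono) auto
  finally show ?thesis by (simp add: card_level_regular_tree)
qed

text \<open>Each set of naturals yields the ray of its indicator words, so Cantor's theorem applies;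
  the letters 0 and 1 exist because \<open>d\<close> is at least 2.\<close>

lemma uncountable_boundary_regular_tree:
  assumes "2 \<le> d"
  shows "uncountable (boundary (regular_tree d))"
proof
  define ray :: "nat set \<Rightarrow> nat \<Rightarrow> nat list" where
    "ray = (\<lambda>A n. map (\<lambda>i. if i \<in> A then 1 else 0) [0..<n])"
  assume "countable (boundary (regular_tree d))"
  moreover have "range ray \<subseteq> boundary (regular_tree d)"
    using assms by (auto simp: ray_def boundary_def regular_tree_def)
  ultimately have "countable (range ray)" using countable_subset by blast
  moreover have "inj ray"
  proof (rule injI)
    fix A B assume eq: "ray A = ray B"
    have "i \<in> A \<longleftrightarrow> i \<in> B" for i
    proof -
      have "ray A (Suc i) ! i = ray B (Suc i) ! i" using eq by simp
      then show ?thesis by (simp add: ray_def del: upt_Suc split: if_splits)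
    qed
    then show "A = B" by blast
  qed
  ultimately have "countable (UNIV :: nat set set)" using countable_image_inj_on by blast
  then have "range (from_nat_into (UNIV :: nat set set)) = UNIV"
    by (intro range_from_nat_into) auto
  then show False using Cantors_theorem[of "UNIV :: nat set"] by (metis Pow_UNIV)
qed

text \<open>All that the general argument uses of a concrete group.
  \<open>generated_by_fixator\<close> is the condition that makes \<open>Q\<close> too large for a
  parabolic subgroup; finiteness of \<open>S\<close> gives both weakly maximal overgroups and
  countability of the automorphism classes.\<close>

locale branch_with_finite_subgroup = tree_action G "regular_tree d" \<phi>
  for G (structure) and d and \<phi> +
  fixes S Q :: "'a set"
  assumes two_le: "2 \<le> d"
    and finite_S: "finite S" and carrier_generated: "carrier G = generate G S"
    and infinite_rist: "v \<in> regular_tree d \<Longrightarrow> infinite (Rist v)"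
    and finite_index_rist_level: "finite_index G (rist_level G (regular_tree d) \<phi> n)"
    and transitive: "u \<in> level (regular_tree d) n \<Longrightarrow> v \<in> level (regular_tree d) n \<Longrightarrow>
      \<exists>g\<in>carrier G. \<phi> g u = v"
    and Q: "subgroup Q G" "finite Q"
    and generated_by_fixator: "x < d \<Longrightarrow>
      generate G (Q \<union> {g \<in> carrier G. \<forall>u\<in>regular_tree d. prefix [x] u \<longrightarrow> \<phi> g u = u}) = carrier G"
begin

lemma infinite_carrier: "infinite (carrier G)"
  using infinite_rist[OF Nil_in] rist_subgroup[OF Nil_in] subgroup.subset infinite_super by blast

text \<open>In the action \<open>\<psi>\<close> twisted by \<open>\<beta>\<close>, every vertex
  stabilizer along the ray would contain \<open>Q\<close> and, by
  \<open>fixator_le_stabilizer\<close>, the fixator of the subtree of a letter. It would be the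
  whole group, although some vertex of the ray is moved.\<close>

lemma Q_not_in_parabolic:
  assumes T': "spherically_regular_tree T'" and br: "branch_action G T' \<psi>"
    and P: "P \<in> parabolic_subgroups G T' \<psi>" and \<beta>: "\<beta> \<in> iso G G"
  shows "\<not> \<beta> ` Q \<subseteq> P"
proof
  assume QP: "\<beta> ` Q \<subseteq> P"
  obtain r where r: "r \<in> boundary T'" "P = stabilizer G (\<lambda>g r. \<psi> g \<circ> r) r"
    using P by (auto simp: parabolic_subgroups_def)
  obtain n g where g: "g \<in> carrier G" "\<psi> g (r n) \<noteq> r n"
    using branch_action_moves_ray[OF T' br infinite_carrier r(1)] by blast
  interpret T': tree_action G T' \<psi> by (rule branch_action_tree_action[OF T' br])
  interpret B: tree_action G T' "\<lambda>g. \<psi> (\<beta> g)" by (rule T'.tree_action_comp[OF \<beta>])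
  have \<beta>_onto: "\<exists>h'\<in>carrier G. \<beta> h' = h" if "h \<in> carrier G" for h
  proof -
    have "h \<in> \<beta> ` carrier G" using \<beta> that by (simp add: iso_def bij_betw_def)
    then show ?thesis by blast
  qed
  have \<beta>_closed: "\<beta> h \<in> carrier G" if "h \<in> carrier G" for h
    using \<beta> that by (auto simp: iso_def hom_def)
  have v: "r n \<in> T'" using boundary_in[OF r(1)] by simp
  obtain h where h: "h \<in> T'.Rist (r n)" "h \<noteq> \<one>"
    using branch_action_rist_nontrivial[OF T' br infinite_carrier v]
      subgroup.one_closed[OF T'.rist_subgroup[OF v]] by blast
  obtain h' where h': "h' \<in> carrier G" "\<beta> h' = h" using h \<beta>_onto by (auto simp: T'.rist_iff)
  have "h' \<in> B.Rist (r n)" using h h' by (simp add: B.rist_iff T'.rist_iff)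
  moreover have "h' \<noteq> \<one>" using h h' B.act_one T'.faithful \<beta>_closed by auto
  ultimately have nontriv: "B.Rist (r n) \<noteq> {\<one>}" by blast
  obtain x y where xy: "x # y \<in> regular_tree d" and
    stab: "\<And>g. g \<in> carrier G \<Longrightarrow> (\<And>u. u \<in> regular_tree d \<Longrightarrow> prefix [x] u \<Longrightarrow> \<phi> g u = u) \<Longrightarrow>
      \<psi> (\<beta> g) (r n) = r n"
    using fixator_le_stabilizer[OF infinite_rist B.tree_action_axioms v
          spherically_regular_finite_level[OF T'] nontriv] by blast
  define H where "H = {g \<in> carrier G. \<psi> (\<beta> g) (r n) = r n}"
  have "Q \<subseteq> H"
  proof
    fix q assume q: "q \<in> Q"
    then have "\<psi> (\<beta> q) \<circ> r = r" using QP r(2) by (auto simp: stabilizer_def)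
    then have "\<psi> (\<beta> q) (r n) = r n" by (metis comp_apply)
    then show "q \<in> H" using q Q(1) subgroup.mem_carrier by (fastforce simp: H_def)
  qed
  moreover have "{g \<in> carrier G. \<forall>u\<in>regular_tree d. prefix [x] u \<longrightarrow> \<phi> g u = u} \<subseteq> H"
    using stab by (auto simp: H_def)
  moreover have "subgroup H G" using B.stabilizer_subgroup[OF v] by (simp add: H_def)
  ultimately have "generate G (Q \<union>
      {g \<in> carrier G. \<forall>u\<in>regular_tree d. prefix [x] u \<longrightarrow> \<phi> g u = u}) \<subseteq> H"
    by (intro generate_subgroup_incl) auto
  moreover have "x < d" using xy by (simp add: regular_tree_def)
  ultimately have "carrier G \<subseteq> H" using generated_by_fixator by simp
  moreover obtain g' where "g' \<in> carrier G" "\<beta> g' = g" using \<beta>_onto g by blast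
  ultimately show False using g by (auto simp: H_def)
qed

section \<open>Setwise stabilizers of the finite \<open>Q\<close>-orbits of rays\<close>

definition ray_orbit :: "(nat \<Rightarrow> nat list) \<Rightarrow> (nat \<Rightarrow> nat list) set" where
  "ray_orbit r = (\<lambda>q n. \<phi> q (r n)) ` Q"

definition ray_stabilizer :: "(nat \<Rightarrow> nat list) \<Rightarrow> 'a set" where
  "ray_stabilizer r = {g \<in> carrier G. (\<lambda>s n. \<phi> g (s n)) ` ray_orbit r = ray_orbit r}"

lemma Q_carrier: "q \<in> Q \<Longrightarrow> q \<in> carrier G"
  using Q(1) subgroup.mem_carrier by fastforce

context
  fixes r assumes r: "r \<in> boundary (regular_tree d)"
begin

lemma ray_orbit_in: "s \<in> ray_orbit r \<Longrightarrow> s n \<in> regular_tree d \<and> length (s n) = n"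
  using boundary_in[OF r] Q_carrier by (auto simp: ray_orbit_def act_closed act_length)

lemma finite_ray_orbit: "finite (ray_orbit r)"
  using Q(2) by (simp add: ray_orbit_def)

lemma self_in_ray_orbit: "r \<in> ray_orbit r"
  unfolding ray_orbit_def
  by (rule image_eqI[of _ _ \<one>]) (use Q(1) boundary_in[OF r] in \<open>simp_all add: act_one subgroup.one_closed\<close>)

lemma ray_action_mult:
  assumes "g \<in> carrier G" "h \<in> carrier G"
  shows "(\<lambda>s n. \<phi> (g \<otimes> h) (s n)) ` ray_orbit r = (\<lambda>s n. \<phi> g (s n)) ` (\<lambda>s n. \<phi> h (s n)) ` ray_orbit r"
  unfolding image_image by (rule image_cong) (use assms ray_orbit_in in \<open>simp_all add: act_mult\<close>)

lemma ray_action_one: "(\<lambda>s n. \<phi> \<one> (s n)) ` ray_orbit r = ray_orbit r"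
proof -
  have "(\<lambda>s n. \<phi> \<one> (s n)) ` ray_orbit r = (\<lambda>s. s) ` ray_orbit r"
    by (rule image_cong) (use ray_orbit_in in \<open>simp_all add: act_one\<close>)
  then show ?thesis by simp
qed

lemma ray_stabilizer_subgroup: "subgroup (ray_stabilizer r) G"
proof (rule subgroupI)
  show "ray_stabilizer r \<subseteq> carrier G" by (auto simp: ray_stabilizer_def)
  have "\<one> \<in> ray_stabilizer r" using ray_action_one by (simp add: ray_stabilizer_def)
  then show "ray_stabilizer r \<noteq> {}" by blast
  show "inv g \<in> ray_stabilizer r" if "g \<in> ray_stabilizer r" for g
    using that ray_action_mult[of "inv g" g] ray_action_one by (simp add: ray_stabilizer_def)
  show "g \<otimes> h \<in> ray_stabilizer r" if "g \<in> ray_stabilizer r" "h \<in> ray_stabilizer r" for g h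
    using that ray_action_mult[of g h] by (simp add: ray_stabilizer_def)
qed

lemma Q_subset_ray_stabilizer: "Q \<subseteq> ray_stabilizer r"
proof
  fix q assume q: "q \<in> Q"
  have "(\<lambda>s n. \<phi> q (s n)) ` ray_orbit r = (\<lambda>p n. \<phi> p (r n)) ` (\<lambda>p. q \<otimes> p) ` Q"
    unfolding ray_orbit_def image_image
    by (rule image_cong) (use q Q_carrier boundary_in[OF r] in \<open>simp_all add: act_mult\<close>)
  also have "(\<lambda>p. q \<otimes> p) ` Q = Q"
  proof
    show "(\<lambda>p. q \<otimes> p) ` Q \<subseteq> Q" using q Q(1) by (auto simp: subgroup.m_closed)
    show "Q \<subseteq> (\<lambda>p. q \<otimes> p) ` Q"
    proof
      fix p assume "p \<in> Q"
      then show "p \<in> (\<lambda>p. q \<otimes> p) ` Q"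
        using q Q(1) Q_carrier by (intro image_eqI[of _ _ "inv q \<otimes> p"])
          (simp_all add: subgroup.m_closed subgroup.m_inv_closed m_assoc[symmetric])
    qed
  qed
  finally show "q \<in> ray_stabilizer r" using q Q_carrier by (simp add: ray_stabilizer_def ray_orbit_def)
qed

text \<open>With finite index, finitely many translates of the finite orbit would by transitivity
  pass through every vertex of level \<open>n\<close>. Taking \<open>n\<close> to be the number of
  pairs of a translation and a ray contradicts the growth of the levels.\<close>

lemma ray_stabilizer_infinite_index: "\<not> finite_index G (ray_stabilizer r)"
proof
  assume "finite_index G (ray_stabilizer r)"
  then obtain F where F: "finite F" "F \<subseteq> carrier G"
    "\<And>g. g \<in> carrier G \<Longrightarrow> \<exists>f\<in>F. g \<otimes> inv f \<in> ray_stabilizer r"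
    using finite_index_transversal ray_stabilizer_subgroup by metis
  define n where "n = card (F \<times> ray_orbit r)"
  have "level (regular_tree d) n \<subseteq> (\<lambda>(f, s). \<phi> (inv f) (s n)) ` (F \<times> ray_orbit r)"
  proof
    fix v assume v: "v \<in> level (regular_tree d) n"
    obtain g where g: "g \<in> carrier G" "\<phi> g (r n) = v"
      using transitive[OF _ v, of "r n"] boundary_in[OF r] by (auto simp: level_def)
    \<comment> \<open>The representatives are for right cosets, so \<open>inv g\<close> is
      decomposed; inverting then puts \<open>f \<otimes> g\<close> into the stabilizer.\<close>
    obtain f where f: "f \<in> F" "inv g \<otimes> inv f \<in> ray_stabilizer r" using F(3)[of "inv g"] g by auto
    then have fc: "f \<in> carrier G" using F by blast
    have "inv (inv g \<otimes> inv f) \<in> ray_stabilizer r"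
      using f ray_stabilizer_subgroup by (simp add: subgroup.m_inv_closed)
    then have fg: "f \<otimes> g \<in> ray_stabilizer r" using fc g by (simp add: inv_mult_group)
    define s where "s = (\<lambda>n. \<phi> (f \<otimes> g) (r n))"
    have "s \<in> ray_orbit r" using fg self_in_ray_orbit by (auto simp: ray_stabilizer_def s_def)
    moreover have "v = \<phi> (inv f) (s n)"
      using g fc boundary_in[OF r] v by (simp add: s_def act_mult act_closed level_def)
    ultimately show "v \<in> (\<lambda>(f, s). \<phi> (inv f) (s n)) ` (F \<times> ray_orbit r)" using f(1) by force
  qed
  then have "card (level (regular_tree d) n) \<le> n"
    unfolding n_def using F(1) finite_ray_orbit by (intro surj_card_le) auto
  then show False using less_card_level_regular_tree[OF two_le, of n] by simp
qed

text \<open>A ray that misses \<open>v\<close> at level \<open>n\<close> never enters the subtree of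
  \<open>v\<close>, so each ray of the orbit is even fixed vertex by vertex.\<close>

lemma rist_subset_ray_stabilizer:
  assumes v: "v \<in> level (regular_tree d) n" "\<And>s. s \<in> ray_orbit r \<Longrightarrow> s n \<noteq> v"
  shows "Rist v \<subseteq> ray_stabilizer r"
proof
  fix g assume g: "g \<in> Rist v"
  have "\<phi> g (s m) = s m" if "s \<in> ray_orbit r" for s m
  proof -
    obtain q where q: "q \<in> Q" "s = (\<lambda>n. \<phi> q (r n))" using \<open>s \<in> ray_orbit r\<close> by (auto simp: ray_orbit_def)
    have "\<not> prefix v (s m)"
    proof
      assume pre: "prefix v (s m)"
      then have "n \<le> m" using v(1) ray_orbit_in[OF that, of m] prefix_length_le by (fastforce simp: level_def)
      then have "prefix (s n) (s m)"
        using q Q_carrier boundary_in[OF r] by (simp add: act_prefix)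
      then have "s n = v"
        using same_length_prefix[OF _ _ pre] v(1) ray_orbit_in[OF that, of n] by (simp add: level_def)
      then show False using v(2) that by blast
    qed
    then show ?thesis using g ray_orbit_in[OF that, of m] by (simp add: rist_iff)
  qed
  then have "(\<lambda>s n. \<phi> g (s n)) ` ray_orbit r = (\<lambda>s. s) ` ray_orbit r"
    by (intro image_cong) auto
  then show "g \<in> ray_stabilizer r" using g by (simp add: ray_stabilizer_def rist_iff)
qed

end

text \<open>Two rays in distinct \<open>Q\<close>-orbits are separated by the orbits of their \<open>n\<close>-th vertices for some
  \<open>n\<close>, and then their stabilizers together contain the rigid stabilizers of all vertices of level
  \<open>n\<close>.\<close>

lemma ray_stabilizers_in_finite_index:
  assumes r: "r \<in> boundary (regular_tree d)" "t \<in> boundary (regular_tree d)" "t \<notin> ray_orbit r"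
    and W: "subgroup W G" "ray_stabilizer r \<subseteq> W" "ray_stabilizer t \<subseteq> W"
  shows "finite_index G W"
proof -
  have "\<exists>n. \<forall>m\<ge>n. \<phi> q (r m) \<noteq> t m" if q: "q \<in> Q" for q
  proof -
    have "(\<lambda>n. \<phi> q (r n)) \<noteq> t" using r(3) q by (auto simp: ray_orbit_def)
    then obtain n where n: "\<phi> q (r n) \<noteq> t n" by auto
    have "\<phi> q (r m) \<noteq> t m" if "n \<le> m" for m
    proof
      assume eq: "\<phi> q (r m) = t m"
      have "prefix (\<phi> q (r n)) (t m)"
        using boundary_in[OF r(1)] Q_carrier q that eq act_prefix by metis
      moreover have "prefix (t n) (t m)" using boundary_in[OF r(2)] that by simp
      moreover have "length (\<phi> q (r n)) = length (t n)"
        using boundary_in[OF r(1)] boundary_in[OF r(2)] Q_carrier q by (simp add: act_length)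
      ultimately show False using n same_length_prefix by blast
    qed
    then show ?thesis by blast
  qed
  then obtain N where N: "\<And>q m. q \<in> Q \<Longrightarrow> N q \<le> m \<Longrightarrow> \<phi> q (r m) \<noteq> t m" by metis
  \<comment> \<open>From level \<open>N q\<close> on, \<open>t\<close> and the translate of
    \<open>r\<close> by \<open>q\<close> stay apart; finiteness of \<open>Q\<close> gives one level
    for all \<open>q\<close>.\<close>
  define n where "n = Max (N ` Q)"
  have n: "\<phi> q (r n) \<noteq> t n" if "q \<in> Q" for q
    using N[OF that, of n] that Q(2) by (simp add: n_def)
  have sep: "s n \<noteq> s' n" if ss: "s \<in> ray_orbit r" "s' \<in> ray_orbit t" for s s'
  proof
    assume eq: "s n = s' n"
    obtain p q where pq: "p \<in> Q" "q \<in> Q" "s = (\<lambda>n. \<phi> p (r n))" "s' = (\<lambda>n. \<phi> q (t n))"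
      using ss by (auto simp: ray_orbit_def)
    \<comment> \<open>Translating back by \<open>inv q\<close> reduces a coincidence between the
      orbits to one between \<open>t\<close> and a translate of \<open>r\<close>.\<close>
    have "\<phi> (inv q \<otimes> p) (r n) = \<phi> (inv q) (\<phi> q (t n))"
      using eq pq Q_carrier boundary_in[OF r(1)] by (simp add: act_mult)
    also have "\<dots> = t n" using pq Q_carrier boundary_in[OF r(2)] by simp
    finally show False using n[of "inv q \<otimes> p"] pq Q(1) by (simp add: subgroup.m_closed subgroup.m_inv_closed)
  qed
  have "Rist v \<subseteq> W" if v: "v \<in> level (regular_tree d) n" for v
  proof (cases "\<exists>s\<in>ray_orbit r. s n = v")
    case True
    then have "Rist v \<subseteq> ray_stabilizer t"
      using sep by (intro rist_subset_ray_stabilizer[OF r(2) v]) blast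
    then show ?thesis using W by blast
  next
    case False
    then have "Rist v \<subseteq> ray_stabilizer r"
      by (intro rist_subset_ray_stabilizer[OF r(1) v]) blast
    then show ?thesis using W by blast
  qed
  then have "rist_level G (regular_tree d) \<phi> n \<subseteq> W"
    unfolding rist_level_def by (intro generate_subgroup_incl[OF _ W(1)] UN_least)
  moreover have "subgroup (rist_level G (regular_tree d) \<phi> n) G"
    unfolding rist_level_def by (rule generate_is_subgroup) (auto simp: rist_iff)
  ultimately show ?thesis using finite_index_mono finite_index_rist_level W(1) by blast
qed

text \<open>Two rays with the same \<open>W\<close> lie in one \<open>Q\<close>-orbit, since
  otherwise \<open>W\<close> would have finite index. So the fibres of \<open>W\<close> are finite
  and each class is countable: countably many classes would make the boundary countable.\<close>

theorem uncountably_many_classes: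
  "\<exists>\<C>. uncountable \<C> \<and>
     (\<forall>C \<in> \<C>. (\<exists>W. weakly_maximal G W \<and> C = aut_class G W) \<and>
       (\<forall>T \<psi> P. spherically_regular_tree T \<longrightarrow> branch_action G T \<psi> \<longrightarrow>
          P \<in> parabolic_subgroups G T \<psi> \<longrightarrow> C \<noteq> aut_class G P))"
proof -
  let ?B = "boundary (regular_tree d)"
  have "\<exists>W. weakly_maximal G W \<and> ray_stabilizer r \<subseteq> W" if "r \<in> ?B" for r
    using weakly_maximal_above[OF finite_S carrier_generated ray_stabilizer_subgroup
        ray_stabilizer_infinite_index] that by metis
  then obtain W where W: "\<And>r. r \<in> ?B \<Longrightarrow> weakly_maximal G (W r)"
    "\<And>r. r \<in> ?B \<Longrightarrow> ray_stabilizer r \<subseteq> W r" by metis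
  have Wsub: "subgroup (W r) G" if "r \<in> ?B" for r
    using W(1)[OF that] by (simp add: weakly_maximal_def)
  have fibre: "t \<in> ray_orbit r" if "r \<in> ?B" "t \<in> ?B" "W r = W t" for r t
    using ray_stabilizers_in_finite_index[of r t "W r"] that W[of r] W(2)[of t]
    by (auto simp: weakly_maximal_def)
  define \<C> where "\<C> = (\<lambda>r. aut_class G (W r)) ` ?B"
  have "uncountable \<C>"
  proof
    assume "countable \<C>"
    moreover have "countable C" if C: "C \<in> \<C>" for C
    proof -
      obtain r where "r \<in> ?B" "C = aut_class G (W r)" using C by (auto simp: \<C>_def)
      then show ?thesis
        using countable_aut_class[OF finite_S carrier_generated subgroup.subset[OF Wsub]] by simp
    qed
    ultimately have "countable (\<Union>C\<in>\<C>. C)" by (intro countable_UN)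
    then have "countable (\<Union> \<C>)" by simp
    moreover have "W ` ?B \<subseteq> \<Union> \<C>"
      using aut_class_self[OF Wsub] by (auto simp: \<C>_def)
    ultimately have cW: "countable (W ` ?B)" using countable_subset by blast
    define rep where "rep = inv_into ?B W"
    have "?B \<subseteq> (\<Union>V\<in>W ` ?B. ray_orbit (rep V))"
    proof
      fix t assume t: "t \<in> ?B"
      have "rep (W t) \<in> ?B" "W (rep (W t)) = W t"
        using t by (simp_all add: rep_def inv_into_into f_inv_into_f)
      then show "t \<in> (\<Union>V\<in>W ` ?B. ray_orbit (rep V))" using fibre[of "rep (W t)" t] t by blast
    qed
    moreover have "countable (ray_orbit (rep V))" if "V \<in> W ` ?B" for V
      using finite_ray_orbit that by (simp add: ray_orbit_def Q(2) countable_finite)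
    ultimately have "countable ?B" using cW by (meson countable_UN countable_subset)
    then show False using uncountable_boundary_regular_tree two_le by blast
  qed
  moreover have "aut_class G (W r) \<noteq> aut_class G P"
    if r: "r \<in> ?B" and T: "spherically_regular_tree T" "branch_action G T \<psi>"
      "P \<in> parabolic_subgroups G T \<psi>" for r T \<psi> P
  proof
    assume "aut_class G (W r) = aut_class G P"
    then have "W r \<in> aut_class G P" using aut_class_self[OF Wsub[OF r]] by simp
    then obtain \<alpha> where \<alpha>: "\<alpha> \<in> iso G G" "\<alpha> ` P = W r"
      by (auto simp: aut_class_def automorphism_equivalent_def)
    \<comment> \<open>\<open>Q\<close> is contained in \<open>W r\<close>, so the inverse
      automorphism carries it into the parabolic subgroup.\<close>
    have "inv_into (carrier G) \<alpha> ` Q \<subseteq> P"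
    proof
      fix p assume "p \<in> inv_into (carrier G) \<alpha> ` Q"
      then obtain q where q: "q \<in> Q" "p = inv_into (carrier G) \<alpha> q" by blast
      then have "q \<in> \<alpha> ` P" using \<alpha>(2) W(2)[OF r] Q_subset_ray_stabilizer[OF r] by blast
      then obtain p' where p': "p' \<in> P" "q = \<alpha> p'" by blast
      have "p' \<in> carrier G" using p' T(3) by (auto simp: parabolic_subgroups_def stabilizer_def)
      then have "p = p'" using q p' \<alpha>(1) by (simp add: iso_def bij_betw_def)
      then show "p \<in> P" using p' by simp
    qed
    then show False using Q_not_in_parabolic[OF T iso_set_sym[OF \<alpha>(1)]] by blast
  qed
  moreover have "\<exists>V. weakly_maximal G V \<and> aut_class G (W r) = aut_class G V" if "r \<in> ?B" for r
    using W(1)[OF that] by blast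
  ultimately show ?thesis by (intro exI[of _ \<C>]) (simp add: \<C>_def)
qed

end

section \<open>Automorphisms of regular trees\<close>

lemma tree_auts_subgroup:
  assumes "[] \<in> T"
  shows "subgroup (tree_auts T) (BijGroup T)"
proof (rule group.subgroupI[OF group_BijGroup])
  show "tree_auts T \<subseteq> carrier (BijGroup T)"
    by (auto simp: tree_auts_def BijGroup_def)
  have "(\<lambda>x\<in>T. x) \<in> tree_auts T" using assms by (simp add: tree_auts_def id_Bij)
  then show "tree_auts T \<noteq> {}" by blast
  fix f assume f: "f \<in> tree_auts T"
  then have fB: "f \<in> Bij T" "inj_on f T" by (auto simp: tree_auts_def Bij_def bij_betw_def)
  have inv: "inv_into T f u \<in> T" "f (inv_into T f u) = u" if "u \<in> T" for u
    using fB(1) that inv_into_into[of u f T] f_inv_into_f[of u f T]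
    by (simp_all add: Bij_def bij_betw_def)
  have "adjacent (inv_into T f u) (inv_into T f v) \<longleftrightarrow> adjacent u v" if "u \<in> T" "v \<in> T" for u v
  proof -
    have "adjacent (f (inv_into T f u)) (f (inv_into T f v)) \<longleftrightarrow>
        adjacent (inv_into T f u) (inv_into T f v)"
      using f inv(1) that by (simp add: tree_auts_def)
    then show ?thesis using inv(2) that by simp
  qed
  moreover have "inv_into T f [] = []" using assms f fB by (simp add: tree_auts_def inv_into_f_eq)
  ultimately show "inv\<^bsub>BijGroup T\<^esub> f \<in> tree_auts T"
    using assms fB by (simp add: inv_BijGroup tree_auts_def restrict_inv_into_Bij del: restrict_apply)
      simp
next
  fix f g assume fg: "f \<in> tree_auts T" "g \<in> tree_auts T"
  then have "f \<in> Bij T" "g \<in> Bij T" "\<And>u. u \<in> T \<Longrightarrow> g u \<in> T"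
    by (auto simp: tree_auts_def Bij_def bij_betw_def)
  then show "f \<otimes>\<^bsub>BijGroup T\<^esub> g \<in> tree_auts T"
    using fg assms by (simp add: BijGroup_def tree_auts_def compose_Bij) (simp add: compose_def)
qed

lemma Cons_in_regular_tree [simp]: "x # w \<in> regular_tree d \<longleftrightarrow> x < d \<and> w \<in> regular_tree d"
  and Nil_in_regular_tree [simp]: "[] \<in> regular_tree d"
  by (auto simp: regular_tree_def)

lemma take_in_regular_tree [simp]: "w \<in> regular_tree d \<Longrightarrow> take n w \<in> regular_tree d"
  by (auto simp: regular_tree_def dest: in_set_takeD)

text \<open>Compatibility with \<open>take\<close> replaces both directions of the adjacency
  condition. Surjectivity follows from injectivity, because levels are finite and preserved.\<close>

lemma regular_tree_autI:
  assumes ext: "f \<in> extensional (regular_tree d)"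
    and closed: "\<And>u. u \<in> regular_tree d \<Longrightarrow> f u \<in> regular_tree d"
    and inj: "inj_on f (regular_tree d)"
    and take: "\<And>u n. u \<in> regular_tree d \<Longrightarrow> take n (f u) = f (take n u)"
    and len: "\<And>u. u \<in> regular_tree d \<Longrightarrow> length (f u) = length u"
  shows "f \<in> tree_auts (regular_tree d)"
proof -
  have "f ` regular_tree d = regular_tree d"
  proof
    show "regular_tree d \<subseteq> f ` regular_tree d"
    proof
      fix u assume u: "u \<in> regular_tree d"
      let ?L = "level (regular_tree d) (length u)"
      have "f ` ?L \<subseteq> ?L" using closed len by (auto simp: level_def)
      moreover have "inj_on f ?L" using inj by (rule inj_on_subset) (auto simp: level_def)
      ultimately have "f ` ?L = ?L" using finite_level_regular_tree endo_inj_surj by blast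
      then have "u \<in> f ` ?L" using u by (simp add: level_def)
      then show "u \<in> f ` regular_tree d" by (auto simp: level_def)
    qed
  qed (use closed in auto)
  then have "f \<in> Bij (regular_tree d)" using ext inj by (simp add: Bij_def bij_betw_def)
  moreover have "f [] = []" using len[of "[]"] by simp
  moreover have adj: "(\<exists>x. f v = f u @ [x]) \<longleftrightarrow> (\<exists>x. v = u @ [x])"
    if uv: "u \<in> regular_tree d" "v \<in> regular_tree d" for u v
  proof
    assume "\<exists>x. f v = f u @ [x]"
    then obtain x where x: "f v = f u @ [x]" by blast
    then have "f (take (length u) v) = f u" using uv len take[of v "length u"] by simp
    then have "take (length u) v = u" using inj uv by (simp add: inj_on_def)
    moreover have "length v = Suc (length u)" using x uv len[of u] len[of v] by simp
    ultimately show "\<exists>x. v = u @ [x]"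
      by (metis append_take_drop_id Cons_nth_drop_Suc drop_all le_refl lessI)
  next
    assume "\<exists>x. v = u @ [x]"
    then obtain x where x: "v = u @ [x]" by blast
    then have "take (length u) (f v) = f u" "length (f v) = Suc (length u)"
      using uv len[of v] take[of v "length u"] by simp_all
    then show "\<exists>x. f v = f u @ [x]"
      by (metis append_take_drop_id Cons_nth_drop_Suc drop_all le_refl lessI)
  qed
  ultimately show ?thesis by (simp add: tree_auts_def adjacent_def ex_disj_distrib)
qed

text \<open>\<open>A\<close> is a parameter fixed by an equation, so that it can be the implicit
  structure of \<open>\<otimes>\<close>, \<open>inv\<close> and \<open>\<one>\<close>.\<close>

locale regular_tree_auts =
  fixes d :: nat and A :: "(nat list \<Rightarrow> nat list) monoid" (structure)
  assumes A_eq: "A = tree_aut_group (regular_tree d)"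

sublocale regular_tree_auts \<subseteq> group A
proof -
  have "group ((BijGroup (regular_tree d))\<lparr>carrier := tree_auts (regular_tree d)\<rparr>)"
    by (rule subgroup.subgroup_is_group[OF tree_auts_subgroup group_BijGroup]) simp
  then show "group A" by (simp add: A_eq tree_aut_group_def)
qed

context regular_tree_auts
begin

abbreviation "T \<equiv> regular_tree d"

lemma carrier_eq: "carrier A = tree_auts T"
  by (simp add: A_eq tree_aut_group_def)

lemma Bij: "f \<in> carrier A \<Longrightarrow> f \<in> Bij T"
  by (simp add: carrier_eq tree_auts_def)

lemma mult_eq: "f \<in> carrier A \<Longrightarrow> g \<in> carrier A \<Longrightarrow> f \<otimes> g = compose T f g"
  using Bij[of f] Bij[of g] by (simp add: A_eq tree_aut_group_def BijGroup_def)

lemma mult_apply: "f \<in> carrier A \<Longrightarrow> g \<in> carrier A \<Longrightarrow> u \<in> T \<Longrightarrow> (f \<otimes> g) u = f (g u)"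
  by (simp add: mult_eq compose_def)

lemma one_eq: "\<one> = (\<lambda>x\<in>T. x)"
  by (simp add: A_eq tree_aut_group_def BijGroup_def)

lemma one_apply [simp]: "u \<in> T \<Longrightarrow> \<one> u = u"
  by (simp add: one_eq)

lemma apply_in [simp]: "f \<in> carrier A \<Longrightarrow> u \<in> T \<Longrightarrow> f u \<in> T"
  using Bij[of f] by (auto simp: Bij_def bij_betw_def)

lemma apply_eqI:
  assumes "f \<in> carrier A" "g \<in> carrier A" "\<And>u. u \<in> T \<Longrightarrow> f u = g u"
  shows "f = g"
  by (rule extensionalityI[of _ T]) (use assms Bij[of f] Bij[of g] in \<open>auto simp: Bij_def\<close>)

lemma apply_inj: "f \<in> carrier A \<Longrightarrow> u \<in> T \<Longrightarrow> v \<in> T \<Longrightarrow> f u = f v \<longleftrightarrow> u = v"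
  using Bij[of f] by (auto simp: Bij_def bij_betw_def inj_on_def)

lemma apply_inv:
  assumes "g \<in> carrier A" "u \<in> T"
  shows "(inv g) (g u) = u"
  using mult_apply[of "inv g" g u] assms by simp

lemma apply_length [simp]: "f \<in> carrier A \<Longrightarrow> u \<in> T \<Longrightarrow> length (f u) = length u"
  using tree_auts_prefix[OF rooted_regular_tree, of f d "[]" u]
  by (simp add: carrier_eq tree_auts_def)

lemma apply_take:
  assumes "f \<in> carrier A" "u \<in> T"
  shows "take n (f u) = f (take n u)"
proof (cases "n \<le> length u")
  case True
  have "prefix (f (take n u)) (f u)"
    using tree_auts_prefix[OF rooted_regular_tree, of f d "take n u" "drop n u"] assms
    by (simp add: carrier_eq)
  then obtain zs where "f u = f (take n u) @ zs" by (auto simp: prefix_def)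
  moreover have "length (f (take n u)) = n" using assms True by simp
  ultimately show ?thesis by simp
qed (use assms in simp)

lemma apply_Nil [simp]: "f \<in> carrier A \<Longrightarrow> f [] = []"
  by (simp add: carrier_eq tree_auts_def)

text \<open>With \<open>sec\<close> this is the wreath recursion: the permutation of the first
  level, and the sections (states) at its vertices. By \<open>sec_eqI\<close> they determine the
  automorphism.\<close>

definition lead :: "(nat list \<Rightarrow> nat list) \<Rightarrow> nat \<Rightarrow> nat" where
  "lead f x = hd (f [x])"

definition sec :: "nat \<Rightarrow> (nat list \<Rightarrow> nat list) \<Rightarrow> nat list \<Rightarrow> nat list" where
  "sec x f = (\<lambda>w\<in>T. tl (f (x # w)))"

text \<open>The automorphism \<open>(F\<^sub>0, \<dots>, F\<^sub>d\<^sub>-\<^sub>1)\<^sub>1\<close>.\<close>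

definition dir :: "(nat \<Rightarrow> nat list \<Rightarrow> nat list) \<Rightarrow> nat list \<Rightarrow> nat list" where
  "dir F = (\<lambda>u\<in>T. case u of [] \<Rightarrow> [] | x # w \<Rightarrow> x # F x w)"

definition emb :: "nat \<Rightarrow> (nat list \<Rightarrow> nat list) \<Rightarrow> nat list \<Rightarrow> nat list" where
  "emb x k = dir (\<lambda>y. if y = x then k else \<one>)"

lemma apply_Cons:
  assumes "f \<in> carrier A" "x < d" "w \<in> T"
  shows "f (x # w) = lead f x # sec x f w"
proof -
  have 1: "f [x] = take 1 (f (x # w))" using assms apply_take[of f "x # w" 1] by simp
  have "length (f (x # w)) = Suc (length w)" using assms by simp
  then obtain a v where "f (x # w) = a # v" by (cases "f (x # w)") auto
  then show ?thesis using assms 1 by (simp add: lead_def sec_def)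
qed

lemma lead_less [simp]:
  assumes "f \<in> carrier A" "x < d"
  shows "lead f x < d"
  using apply_in[of f "[x]"] apply_Cons[of f x "[]"] assms by simp

lemma sec_closed [simp]:
  assumes "f \<in> carrier A" "x < d"
  shows "sec x f \<in> carrier A"
  unfolding carrier_eq
proof (rule regular_tree_autI)
  show "sec x f \<in> extensional T" by (simp add: sec_def)
  show "inj_on (sec x f) T"
    using assms apply_inj[of f "x # _" "x # _"] by (auto simp: inj_on_def apply_Cons)
  fix u n assume u: "u \<in> T"
  have f: "f (x # u) = lead f x # sec x f u" using assms u by (rule apply_Cons)
  show "sec x f u \<in> T" using apply_in[of f "x # u"] f assms u by simp
  show "length (sec x f u) = length u" using apply_length[of f "x # u"] f assms u by simp
  show "take n (sec x f u) = sec x f (take n u)"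
    using apply_take[of f "x # u" "Suc n"] f assms u by (simp add: apply_Cons)
qed

lemma dir_closed [simp]:
  assumes "\<And>x. x < d \<Longrightarrow> F x \<in> carrier A"
  shows "dir F \<in> carrier A"
  unfolding carrier_eq
proof (rule regular_tree_autI)
  show "dir F \<in> extensional T" by (simp add: dir_def)
  show "inj_on (dir F) T"
    using assms apply_inj by (auto simp: inj_on_def dir_def split: list.splits)
  fix u n assume u: "u \<in> T"
  then show "dir F u \<in> T" using assms by (auto simp: dir_def split: list.splits)
  show "length (dir F u) = length u" using u assms by (auto simp: dir_def split: list.splits)
  show "take n (dir F u) = dir F (take n u)"
    using u assms by (cases u; cases n) (auto simp: dir_def apply_take)
qed

lemma dir_apply: "x < d \<Longrightarrow> w \<in> T \<Longrightarrow> dir F (x # w) = x # F x w"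
  by (simp add: dir_def)

lemma sec_eqI:
  assumes "f \<in> carrier A" "g \<in> carrier A" "\<And>x. x < d \<Longrightarrow> lead f x = lead g x"
    "\<And>x. x < d \<Longrightarrow> sec x f = sec x g"
  shows "f = g"
proof (rule apply_eqI[OF assms(1,2)])
  fix u assume "u \<in> T"
  then show "f u = g u" using assms by (cases u) (auto simp: apply_Cons)
qed

lemma secI:
  assumes "f \<in> carrier A" "k \<in> carrier A" "x < d" "\<And>w. w \<in> T \<Longrightarrow> f (x # w) = y # k w"
  shows "lead f x = y" "sec x f = k"
proof -
  show "lead f x = y" using assms(4)[of "[]"] by (simp add: lead_def)
  show "sec x f = k"
  proof (rule apply_eqI)
    show "sec x f w = k w" if "w \<in> T" for w using assms(4) that by (simp add: sec_def)
  qed (use assms(1-3) in simp_all)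
qed

lemma
  assumes "\<And>x. x < d \<Longrightarrow> F x \<in> carrier A" "x < d"
  shows lead_dir: "lead (dir F) x = x" and sec_dir: "sec x (dir F) = F x"
  by (rule secI[of "dir F" "F x" x x]; use assms in \<open>simp add: dir_apply\<close>)+

lemma dir_eqI: "(\<And>x. x < d \<Longrightarrow> F x = F' x) \<Longrightarrow> dir F = dir F'"
  unfolding dir_def by (rule restrict_ext) (auto split: list.splits)

lemma
  assumes "x < d"
  shows lead_one [simp]: "lead \<one> x = x" and sec_one [simp]: "sec x \<one> = \<one>"
  by (rule secI[of \<one> \<one> x x]; use assms in simp)+

lemma
  assumes "f \<in> carrier A" "g \<in> carrier A" "x < d"
  shows lead_mult: "lead (f \<otimes> g) x = lead f (lead g x)"
    and sec_mult: "sec x (f \<otimes> g) = sec (lead g x) f \<otimes> sec x g"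
proof -
  have *: "(f \<otimes> g) (x # w) = lead f (lead g x) # (sec (lead g x) f \<otimes> sec x g) w" if "w \<in> T" for w
  proof -
    have "(f \<otimes> g) (x # w) = f (g (x # w))" using assms that by (simp add: mult_apply)
    then show ?thesis
      using assms that by (simp add: apply_Cons[of g] apply_Cons[of f] mult_apply)
  qed
  show "lead (f \<otimes> g) x = lead f (lead g x)" "sec x (f \<otimes> g) = sec (lead g x) f \<otimes> sec x g"
    by (rule secI[where x = x and k = "sec (lead g x) f \<otimes> sec x g" and y = "lead f (lead g x)"];
      use assms * in simp)+
qed

lemma lead_inv:
  assumes "g \<in> carrier A" "x < d"
  shows "lead (inv g) (lead g x) = x" "lead g (lead (inv g) x) = x"
  using assms lead_mult[of "inv g" g x] lead_mult[of g "inv g" x] by simp_all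

lemma sec_inv:
  assumes "g \<in> carrier A" "x < d"
  shows "sec x (inv g) = inv (sec (lead (inv g) x) g)"
proof -
  have "sec (lead (inv g) x) g \<otimes> sec x (inv g) = \<one>" using sec_mult[of g "inv g" x] assms by simp
  then show ?thesis
    using assms by (metis inv_closed inv_equality inv_inv lead_less sec_closed)
qed

lemma dir_sec:
  assumes "f \<in> carrier A" "\<And>x. x < d \<Longrightarrow> lead f x = x"
  shows "dir (\<lambda>x. sec x f) = f"
  by (rule sec_eqI) (use assms in \<open>simp_all add: lead_dir sec_dir\<close>)

lemma dir_mult:
  assumes "\<And>x. x < d \<Longrightarrow> F x \<in> carrier A" "\<And>x. x < d \<Longrightarrow> F' x \<in> carrier A"
  shows "dir F \<otimes> dir F' = dir (\<lambda>x. F x \<otimes> F' x)"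
  by (rule sec_eqI) (use assms in \<open>simp_all add: lead_dir sec_dir lead_mult sec_mult\<close>)

lemma dir_one: "dir (\<lambda>x. \<one>) = \<one>"
  by (rule sec_eqI) (simp_all add: lead_dir sec_dir)

lemma dir_inv:
  assumes "\<And>x. x < d \<Longrightarrow> F x \<in> carrier A"
  shows "inv (dir F) = dir (\<lambda>x. inv (F x))"
proof (rule inv_equality)
  have "dir (\<lambda>x. inv (F x)) \<otimes> dir F = dir (\<lambda>x. inv (F x) \<otimes> F x)"
    using assms by (simp add: dir_mult)
  also have "\<dots> = dir (\<lambda>x. \<one>)" using assms by (intro dir_eqI) simp
  finally show "dir (\<lambda>x. inv (F x)) \<otimes> dir F = \<one>" by (simp add: dir_one)
qed (use assms in simp_all)

lemma dir_commutator:
  assumes "\<And>x. x < d \<Longrightarrow> F x \<in> carrier A" "\<And>x. x < d \<Longrightarrow> F' x \<in> carrier A"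
  shows "commutator A (dir F) (dir F') = dir (\<lambda>x. commutator A (F x) (F' x))"
  using assms by (simp add: commutator_def dir_inv dir_mult)

lemma dir_pow:
  assumes "\<And>x. x < d \<Longrightarrow> F x \<in> carrier A"
  shows "dir F [^] (n::nat) = dir (\<lambda>x. F x [^] n)"
  using assms by (induction n) (simp_all add: dir_one dir_mult)

lemma emb_closed [simp]: "k \<in> carrier A \<Longrightarrow> emb x k \<in> carrier A"
  by (simp add: emb_def)

lemma emb_mult: "k \<in> carrier A \<Longrightarrow> l \<in> carrier A \<Longrightarrow> emb x (k \<otimes> l) = emb x k \<otimes> emb x l"
  unfolding emb_def by (subst dir_mult) (auto intro: dir_eqI)

lemma emb_one [simp]: "emb x \<one> = \<one>"
  by (simp add: emb_def dir_one)

lemma emb_inv: "k \<in> carrier A \<Longrightarrow> emb x (inv k) = inv (emb x k)"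
  unfolding emb_def by (subst dir_inv) (auto intro: dir_eqI)

lemma
  assumes "k \<in> carrier A" "y < d"
  shows lead_emb: "lead (emb x k) y = y" and sec_emb: "sec y (emb x k) = (if y = x then k else \<one>)"
  using assms by (simp_all add: emb_def lead_dir sec_dir)

text \<open>Conjugation moves the copy below \<open>x\<close> to the letter \<open>lead h x\<close>
  and conjugates it by the section of \<open>h\<close>. This allows both the passage between letters
  and, via elements of prescribed section, conjugation inside one letter.\<close>

lemma conj_emb:
  assumes "h \<in> carrier A" "k \<in> carrier A" "x < d"
  shows "h \<otimes> emb x k \<otimes> inv h = emb (lead h x) (sec x h \<otimes> k \<otimes> inv (sec x h))"
proof -
  have "h \<otimes> emb x k = emb (lead h x) (sec x h \<otimes> k \<otimes> inv (sec x h)) \<otimes> h"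
  proof (rule sec_eqI)
    fix y assume y: "y < d"
    have "lead h y = lead h x \<longleftrightarrow> y = x"
      using apply_inj[of h "[y]" "[x]"] assms y apply_Cons[of h _ "[]"] by simp
    then show "sec y (h \<otimes> emb x k) = sec y (emb (lead h x) (sec x h \<otimes> k \<otimes> inv (sec x h)) \<otimes> h)"
      using assms y by (simp add: sec_mult lead_emb sec_emb m_assoc)
  qed (use assms in \<open>simp_all add: lead_mult lead_emb\<close>)
  then show ?thesis using assms by (simp add: m_assoc)
qed

text \<open>The generator a of the GGS groups and, for \<open>d = 2\<close>, also that of the
  Grigorchuk group.\<close>

definition rot :: "nat list \<Rightarrow> nat list" where
  "rot = restrict (ggs_a d) T"

lemma rot_closed [simp]: "rot \<in> carrier A"
  unfolding carrier_eq
proof (rule regular_tree_autI)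
  have inj: "x = y" if "Suc x mod d = Suc y mod d" "x < d" "y < d" for x y
    using that by (auto simp: mod_Suc split: if_splits)
  show "inj_on rot T"
  proof (rule inj_onI)
    fix u v assume "u \<in> T" "v \<in> T" "rot u = rot v"
    then show "u = v" by (cases u; cases v) (auto simp: rot_def dest: inj)
  qed
  fix u n assume u: "u \<in> T"
  then show "rot u \<in> T" by (cases u) (auto simp: rot_def)
  show "length (rot u) = length u" using u by (cases u) (auto simp: rot_def)
  show "take n (rot u) = rot (take n u)" using u by (cases u; cases n) (auto simp: rot_def)
qed (simp add: rot_def)

lemma rot_apply: "x < d \<Longrightarrow> w \<in> T \<Longrightarrow> rot (x # w) = (Suc x mod d) # w"
  by (simp add: rot_def)

lemma
  assumes "x < d"
  shows lead_rot: "lead rot x = Suc x mod d" and sec_rot: "sec x rot = \<one>"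
  by (rule secI[of rot \<one> x "Suc x mod d"]; use assms in \<open>simp add: rot_apply\<close>)+

lemma lead_rot_pow:
  assumes "x < d"
  shows "lead (rot [^] (n::nat)) x = (x + n) mod d" "sec x (rot [^] n) = \<one>"
proof -
  have "lead (rot [^] n) x = (x + n) mod d \<and> sec x (rot [^] n) = \<one>"
    using assms
  proof (induction n arbitrary: x)
    case (Suc n)
    have "Suc x mod d < d" using Suc.prems by simp
    then show ?case
      using Suc by (simp add: lead_mult sec_mult lead_rot sec_rot mod_simps)
  qed simp
  then show "lead (rot [^] n) x = (x + n) mod d" "sec x (rot [^] n) = \<one>" by simp_all
qed

lemma rot_pow_d: "rot [^] d = \<one>"
  by (rule sec_eqI) (simp_all add: lead_rot_pow)

lemma emb_inj: "k \<in> carrier A \<Longrightarrow> l \<in> carrier A \<Longrightarrow> x < d \<Longrightarrow> emb x k = emb x l \<longleftrightarrow> k = l"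
  by (metis sec_emb)

lemma faithful_action_subgroup:
  assumes "subgroup C A"
  shows "faithful_action (A\<lparr>carrier := C\<rparr>) T (\<lambda>g. g)"
proof -
  have C: "C \<subseteq> carrier A" using assms subgroup.subset by blast
  have "group_hom (A\<lparr>carrier := C\<rparr>) (BijGroup T) (\<lambda>g. g)"
  proof (intro group_hom.intro group_hom_axioms.intro homI)
    show "group (A\<lparr>carrier := C\<rparr>)" using assms subgroup_imp_group by blast
    show "group (BijGroup T)" by (rule group_BijGroup)
    show "g \<in> carrier (BijGroup T)" if "g \<in> carrier (A\<lparr>carrier := C\<rparr>)" for g
      using that C Bij by (auto simp: BijGroup_def)
  qed (simp add: A_eq tree_aut_group_def)
  then show ?thesis
    by (simp add: faithful_action_def group_action_def faithful_action_axioms_def)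
qed

end

section \<open>Finite quotients\<close>

lemma prime_cong_solve:
  fixes k m p :: nat
  assumes "prime p" "\<not> p dvd k"
  shows "\<exists>n. [k * n = m] (mod p)"
proof -
  have "coprime k p" using prime_imp_coprime[OF assms] by (simp add: coprime_commute)
  then obtain n where "[k * n = 1] (mod p)" using cong_solve_coprime_nat by auto
  then have "[k * (n * m) = m] (mod p)" by (metis cong_scalar_right mult.assoc mult_1)
  then show ?thesis by blast
qed

context group
begin

lemma pow_two: "x \<in> carrier G \<Longrightarrow> x [^] (2::nat) = x \<otimes> x"
  by (simp add: numeral_2_eq_2)

lemma pow_mod_eq:
  assumes "x \<in> carrier G" "x [^] (p::nat) = \<one>"
  shows "x [^] (n mod p) = x [^] n"
proof -
  have "x [^] n = x [^] (p * (n div p) + n mod p)" by simp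
  also have "\<dots> = (x [^] p) [^] (n div p) \<otimes> x [^] (n mod p)"
    using assms(1) by (simp only: nat_pow_mult nat_pow_pow)
  finally show ?thesis using assms by (simp add: nat_pow_one)
qed

lemma finite_powers:
  assumes "x \<in> carrier G" "x [^] (p::nat) = \<one>" "0 < p"
  shows "finite (range (\<lambda>n::nat. x [^] n))"
proof -
  have "range (\<lambda>n::nat. x [^] n) \<subseteq> (\<lambda>n. x [^] n) ` {..<p}"
    using pow_mod_eq[OF assms(1,2)] assms(3) by (metis (no_types, lifting) image_eqI image_subsetI lessThan_iff mod_less_divisor)
  then show ?thesis by (rule finite_subset) simp
qed

lemma finite_power_products:
  assumes "x \<in> carrier G" "y \<in> carrier G" "w \<in> carrier G"
    and "x [^] (l::nat) = \<one>" "0 < l" "y [^] (m::nat) = \<one>" "0 < m" "w [^] (n::nat) = \<one>" "0 < n"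
  shows "finite {x [^] i \<otimes> (y [^] j \<otimes> w [^] k) | (i::nat) (j::nat) (k::nat). True}"
proof -
  have "{x [^] i \<otimes> (y [^] j \<otimes> w [^] k) | (i::nat) (j::nat) (k::nat). True} \<subseteq> (\<lambda>(u, v, w). u \<otimes> (v \<otimes> w)) `
      (range (\<lambda>n::nat. x [^] n) \<times> range (\<lambda>n::nat. y [^] n) \<times> range (\<lambda>n::nat. w [^] n))"
  proof
    fix g assume "g \<in> {x [^] i \<otimes> (y [^] j \<otimes> w [^] k) | (i::nat) (j::nat) (k::nat). True}"
    then obtain i j k :: nat where "g = x [^] i \<otimes> (y [^] j \<otimes> w [^] k)" by blast
    then show "g \<in> (\<lambda>(u, v, w). u \<otimes> (v \<otimes> w)) `
        (range (\<lambda>n::nat. x [^] n) \<times> range (\<lambda>n::nat. y [^] n) \<times> range (\<lambda>n::nat. w [^] n))"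
      by (intro image_eqI[of _ _ "(x [^] i, y [^] j, w [^] k)"]) auto
  qed
  then show ?thesis
    using assms by (elim finite_subset) (intro finite_imageI finite_cartesian_product finite_powers)
qed

lemma pow_Suc_left:
  assumes "x \<in> carrier G" "y \<in> carrier G"
  shows "x \<otimes> (x [^] (n::nat) \<otimes> y) = x [^] n \<otimes> (x \<otimes> y)"
proof -
  have "x \<otimes> x [^] n = x [^] n \<otimes> x" using nat_pow_Suc2[OF assms(1), of n] by simp
  then show ?thesis using assms by (simp add: m_assoc[symmetric])
qed

text \<open>As the generators have finite order, their inverses are natural powers of them, and
  closure under left multiplication by generators is enough.\<close>

lemma generate_subset_of_closed:
  assumes S: "S \<subseteq> carrier G" "\<And>s. s \<in> S \<Longrightarrow> \<exists>n>0. s [^] (n::nat) = \<one>"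
    and F: "F \<subseteq> carrier G" "\<one> \<in> F" "\<And>s f. s \<in> S \<Longrightarrow> f \<in> F \<Longrightarrow> s \<otimes> f \<in> F"
  shows "generate G S \<subseteq> F"
proof -
  have "g \<otimes> f \<in> F" if "g \<in> generate G S" "f \<in> F" for g f
    using that
  proof (induction arbitrary: f)
    case one
    then show ?case using F(1) by auto
  next
    case (inv s)
    have s: "s \<in> carrier G" using inv S by auto
    obtain n :: nat where n: "0 < n" "s [^] n = \<one>" using S(2) inv by blast
    then have "s [^] (n - 1) \<otimes> s = \<one>" by (metis Suc_diff_1 nat_pow_Suc)
    then have "inv s = s [^] (n - 1)" using s by (simp add: inv_equality)
    moreover have "s [^] k \<otimes> f \<in> F" for k :: nat
    proof (induction k)
      case (Suc k)
      have "s [^] Suc k \<otimes> f = s \<otimes> (s [^] k \<otimes> f)"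
        using s inv F(1) pow_Suc_left[of s f k] by (simp add: m_assoc subsetD)
      then show ?case using F(3)[OF inv(1) Suc] by simp
    qed (use inv F(1) in auto)
    ultimately show ?case by simp
  next
    case (eng g h)
    then have "g \<in> carrier G" "h \<in> carrier G" "f \<in> carrier G"
      using generate_in_carrier[OF S(1)] F(1) by auto
    then show ?case using eng by (simp add: m_assoc)
  qed (use F in auto)
  then have "g \<otimes> \<one> \<in> F" if "g \<in> generate G S" for g using that F(2) by blast
  then show ?thesis using generate_in_carrier[OF S(1)] by auto
qed

lemma commute_pow:
  assumes "x \<in> carrier G" "y \<in> carrier G" "x \<otimes> y = y \<otimes> x"
  shows "x \<otimes> y [^] (n::nat) = y [^] n \<otimes> x"
proof (induction n)
  case (Suc n)
  have "x \<otimes> y [^] Suc n = (x \<otimes> y [^] n) \<otimes> y" using assms by (simp add: m_assoc)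
  also have "\<dots> = y [^] n \<otimes> (x \<otimes> y)" unfolding Suc using assms by (simp add: m_assoc)
  also have "\<dots> = y [^] Suc n \<otimes> x" using assms by (simp add: m_assoc)
  finally show ?case .
qed (use assms in simp)

lemma commute_generate:
  assumes "x \<in> carrier G" "S \<subseteq> carrier G" "\<And>s. s \<in> S \<Longrightarrow> x \<otimes> s = s \<otimes> x" "g \<in> generate G S"
  shows "x \<otimes> g = g \<otimes> x"
  using assms(4)
proof induction
  case (inv s)
  then have s: "s \<in> carrier G" "x \<otimes> s = s \<otimes> x" using assms by auto
  have "inv s \<otimes> (x \<otimes> s) = x" using s assms(1) by (simp add: m_assoc[symmetric])
  then have "inv s \<otimes> x \<otimes> s = x" using s(1) assms(1) by (simp add: m_assoc)
  then have "x \<otimes> inv s = inv s \<otimes> x \<otimes> s \<otimes> inv s" by simp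
  also have "\<dots> = inv s \<otimes> x" using s(1) assms(1) by (simp add: m_assoc)
  finally show ?case .
next
  case (eng g h)
  then have c: "g \<in> carrier G" "h \<in> carrier G" using generate_in_carrier[OF assms(2)] by auto
  have "x \<otimes> (g \<otimes> h) = (g \<otimes> x) \<otimes> h" using c assms(1) eng by (simp add: m_assoc[symmetric])
  also have "\<dots> = (g \<otimes> h) \<otimes> x" using c assms(1) eng by (simp add: m_assoc)
  finally show ?case .
qed (use assms in auto)

lemma commutator_swap:
  assumes "a \<in> carrier G" "b \<in> carrier G"
  shows "b \<otimes> a = commutator G b a \<otimes> (a \<otimes> b)"
proof -
  have "commutator G b a \<otimes> (a \<otimes> b) = b \<otimes> a \<otimes> inv b \<otimes> (inv a \<otimes> a) \<otimes> b"
    unfolding commutator_def using assms by (simp only: m_assoc inv_closed m_closed)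
  then show ?thesis using assms by (simp add: m_assoc)
qed

lemma commutator_eqI:
  assumes "a \<in> carrier G" "b \<in> carrier G" "c \<in> carrier G" "b \<otimes> a = c \<otimes> (a \<otimes> b)"
  shows "commutator G b a = c"
  using commutator_swap[OF assms(1,2)] assms by simp

text \<open>Each passage of \<open>b\<close> across one \<open>a\<close> produces a factor
  \<open>z\<close>, which moves to the front because it commutes with \<open>a\<close>.\<close>

lemma central_commutator_pow:
  assumes "a \<in> carrier G" "b \<in> carrier G" and z: "z = commutator G b a" "z \<otimes> a = a \<otimes> z"
  shows "b \<otimes> a [^] (i::nat) = z [^] i \<otimes> (a [^] i \<otimes> b)"
proof (induction i)
  case (Suc i)
  have zc: "z \<in> carrier G" using assms by simp
  have za: "z \<otimes> a [^] i = a [^] i \<otimes> z" using commute_pow zc assms by simp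
  have "b \<otimes> a [^] Suc i = (b \<otimes> a [^] i) \<otimes> a" using assms(1,2) by (simp add: m_assoc)
  also have "\<dots> = z [^] i \<otimes> a [^] i \<otimes> (b \<otimes> a)" unfolding Suc using assms(1,2) zc by (simp add: m_assoc)
  also have "b \<otimes> a = z \<otimes> (a \<otimes> b)" unfolding z(1) by (rule commutator_swap[OF assms(1,2)])
  also have "z [^] i \<otimes> a [^] i \<otimes> (z \<otimes> (a \<otimes> b)) = z [^] i \<otimes> (a [^] i \<otimes> z) \<otimes> (a \<otimes> b)"
    using assms(1,2) zc by (simp add: m_assoc)
  also have "\<dots> = z [^] Suc i \<otimes> (a [^] Suc i \<otimes> b)"
    unfolding za[symmetric] using assms(1,2) zc by (simp add: m_assoc)
  finally show ?case .
qed (use assms in simp)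

text \<open>The words \<open>a\<^sup>i b\<^sup>j z\<^sup>k\<close> with \<open>z = [b, a]\<close> exhaust the group.\<close>

lemma finite_class_two:
  assumes gen: "carrier G = generate G {a, b}" and ab: "a \<in> carrier G" "b \<in> carrier G"
    and p: "0 < p" "a [^] (p::nat) = \<one>" "b [^] p = \<one>"
    and z: "z = commutator G b a" "z \<otimes> a = a \<otimes> z" "z \<otimes> b = b \<otimes> z"
  shows "finite (carrier G)"
proof -
  have zc: "z \<in> carrier G" using ab z by simp
  \<comment> \<open>The exponent \<open>p\<close> kills the power of \<open>a\<close> in
    \<open>central_commutator_pow\<close> and leaves only the power of \<open>z\<close>.\<close>
  have "b = z [^] p \<otimes> b" using central_commutator_pow[OF ab z(1,2), of p] p ab zc by simp
  then have zp: "z [^] p = \<one>" using ab zc by simp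
  define F where "F = {a [^] i \<otimes> (b [^] j \<otimes> z [^] k) | (i::nat) (j::nat) (k::nat). True}"
  have F_iff: "g \<in> F \<longleftrightarrow> (\<exists>(i::nat) (j::nat) (k::nat). g = a [^] i \<otimes> (b [^] j \<otimes> z [^] k))" for g
    by (auto simp: F_def)
  have "finite F"
    unfolding F_def by (rule finite_power_products[of _ _ _ p p p]) (use p ab zc zp in simp_all)
  moreover have "generate G {a, b} \<subseteq> F"
  proof (rule generate_subset_of_closed)
    show "F \<subseteq> carrier G" using ab zc by (auto simp: F_iff)
    show "\<one> \<in> F" unfolding F_iff by (rule exI[of _ 0], rule exI[of _ 0], rule exI[of _ 0]) simp
    fix s f assume s: "s \<in> {a, b}" and "f \<in> F"
    then obtain i j k :: nat where f: "f = a [^] i \<otimes> (b [^] j \<otimes> z [^] k)" by (auto simp: F_iff)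
    show "s \<otimes> f \<in> F"
    proof (cases "s = a")
      case True
      then have "s \<otimes> f = a [^] Suc i \<otimes> (b [^] j \<otimes> z [^] k)"
        unfolding f using ab zc by (simp add: pow_Suc_left m_assoc)
      then show ?thesis unfolding F_iff by blast
    next
      case False
      then have "s \<otimes> f = (b \<otimes> a [^] i) \<otimes> (b [^] j \<otimes> z [^] k)"
        using s ab zc by (simp add: f m_assoc)
      also have "\<dots> = z [^] i \<otimes> (a [^] i \<otimes> (b \<otimes> b [^] j) \<otimes> z [^] k)"
        unfolding central_commutator_pow[OF ab z(1,2)] using ab zc by (simp add: m_assoc)
      also have "\<dots> = a [^] i \<otimes> (b \<otimes> b [^] j) \<otimes> z [^] k \<otimes> z [^] i"
      proof (rule commute_generate[of _ "{a, b, z}"])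
        show "z [^] i \<otimes> x = x \<otimes> z [^] i" if "x \<in> {a, b, z}" for x
          using that commute_pow[of x z i] ab zc z by auto
        have pow: "x [^] n \<in> generate G {a, b, z}" if "x \<in> {a, b, z}" for x and n :: nat
          using that by (induction n) (auto intro: generate.intros)
        show "a [^] i \<otimes> (b \<otimes> b [^] j) \<otimes> z [^] k \<in> generate G {a, b, z}"
          by (intro generate.eng pow) (auto intro: generate.incl)
      qed (use ab zc in auto)
      also have "\<dots> = a [^] i \<otimes> (b [^] Suc j \<otimes> z [^] (k + i))"
        using ab zc by (simp add: pow_Suc_left nat_pow_mult[symmetric] m_assoc)
      finally show ?thesis unfolding F_iff by blast
    qed
  next
    show "\<exists>n>0. s [^] (n::nat) = \<one>" if "s \<in> {a, b}" for s using that p by auto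
  qed (use ab in simp)
  ultimately show ?thesis using gen finite_subset by simp
qed

lemma pow_pow_inverse_mod:
  assumes "x \<in> carrier G" "x [^] (p::nat) = \<one>" "[e * e' = m] (mod p)"
  shows "(x [^] e) [^] e' = x [^] (m::nat)"
  using assms pow_mod_eq[OF assms(1,2)] by (metis cong_def nat_pow_pow)

lemma conj_pow:
  assumes "b \<in> carrier G" "x \<in> carrier G"
  shows "b \<otimes> x [^] (n::nat) \<otimes> inv b = (b \<otimes> x \<otimes> inv b) [^] n"
proof (induction n)
  case (Suc n)
  have "b \<otimes> x [^] Suc n \<otimes> inv b = (b \<otimes> x [^] n \<otimes> inv b) \<otimes> (b \<otimes> x \<otimes> inv b)"
    using assms by (simp add: m_assoc) (simp add: m_assoc[symmetric])
  then show ?case using Suc by simp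
qed (use assms in simp)

lemma commute_of_pow:
  assumes "x \<in> carrier G" "y \<in> carrier G" "y [^] (p::nat) = \<one>" "[e * e' = 1] (mod p)"
    "x \<otimes> y [^] (e::nat) = y [^] e \<otimes> x"
  shows "x \<otimes> y = y \<otimes> x"
  using commute_pow[of x "y [^] e" e'] pow_pow_inverse_mod[OF assms(2-4)] assms by simp

text \<open>\<open>c = [b, a\<^sup>e]\<close> commutes with \<open>a\<close>, hence \<open>[b, a\<^sup>e\<^sup>n] = c\<^sup>n\<close> and \<open>c\<^sup>p = 1\<close>; a generator of
  \<open>\<langle>c\<rangle>\<close> commutes with \<open>b\<close>.\<close>

lemma commutator_central:
  assumes ab: "a \<in> carrier G" "b \<in> carrier G" and p: "prime p" "a [^] p = \<one>"
    and e: "\<not> p dvd e" "\<not> p dvd f" "\<not> p dvd e'"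
    and comm_a: "commutator G b (a [^] (e::nat)) \<otimes> a [^] (f::nat) = a [^] f \<otimes> commutator G b (a [^] e)"
    and comm_b: "commutator G b (a [^] (e'::nat)) \<otimes> b = b \<otimes> commutator G b (a [^] e')"
  shows "commutator G b a \<otimes> a = a \<otimes> commutator G b a" "commutator G b a \<otimes> b = b \<otimes> commutator G b a"
proof -
  note solve = prime_cong_solve[OF p(1)]
  define c where "c = commutator G b (a [^] e)"
  have c: "c \<in> carrier G" using ab by (simp add: c_def)
  obtain f' where "[f * f' = 1] (mod p)" using solve e(2) by blast
  then have ca: "c \<otimes> a = a \<otimes> c"
    using commute_of_pow[OF c ab(1) p(2)] comm_a by (simp add: c_def)
  have cae: "c \<otimes> a [^] e = a [^] e \<otimes> c" using commute_pow[OF c ab(1) ca] .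
  have pow: "commutator G b ((a [^] e) [^] n) = c [^] n" for n :: nat
    by (rule commutator_eqI) (use central_commutator_pow[of "a [^] e" b c n] ab c cae in \<open>simp_all add: c_def\<close>)
  have "c [^] p = commutator G b \<one>"
    using pow[of p] ab p by (simp add: nat_pow_pow mult.commute[of e] nat_pow_pow[symmetric] nat_pow_one)
  then have cp: "c [^] p = \<one>" using ab by (simp add: commutator_def)
  \<comment> \<open>Now \<open>c [^] n\<close> is the commutator of \<open>b\<close> with
    \<open>a [^] e'\<close>, which commutes with \<open>b\<close>. As \<open>p\<close> does not
    divide \<open>e'\<close>, it does not divide \<open>n\<close> either, so \<open>c\<close> is a
    power of \<open>c [^] n\<close>.\<close>
  obtain n where n: "[e * n = e'] (mod p)" using solve e(1) by blast
  have "\<not> p dvd n" using n e(3) by (metis cong_dvd_iff dvd_mult)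
  then obtain n' where n': "[n * n' = 1] (mod p)" using solve by blast
  have "b \<otimes> c [^] n = c [^] n \<otimes> b"
    using comm_b pow[of n] pow_pow_inverse_mod[OF ab(1) p(2) n] by simp
  then have cb: "b \<otimes> c = c \<otimes> b" using commute_of_pow[OF ab(2) c cp n'] by simp
  obtain m where m: "[e * m = 1] (mod p)" using solve e(1) by blast
  then have "commutator G b a = c [^] m"
    using pow[of m] pow_pow_inverse_mod[OF ab(1) p(2) m] ab by simp
  then show "commutator G b a \<otimes> a = a \<otimes> commutator G b a" "commutator G b a \<otimes> b = b \<otimes> commutator G b a"
    using commute_pow[of a c m] commute_pow[of b c m] ca cb ab c by simp_all
qed

text \<open>Conjugating \<open>b\<close> by \<open>a [^] i\<close> multiplies it by the inverse of
  \<open>z [^] i\<close>, so all these conjugates lie in the abelian subgroup generated by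
  \<open>z\<close> and \<open>b\<close>.\<close>

lemma conjugates_commute:
  assumes ab: "a \<in> carrier G" "b \<in> carrier G"
    and z: "z = commutator G b a" "z \<otimes> a = a \<otimes> z" "z \<otimes> b = b \<otimes> z"
  shows "commutator G (a [^] (i::nat) \<otimes> b \<otimes> inv (a [^] i)) (a [^] (j::nat) \<otimes> b \<otimes> inv (a [^] j)) = \<one>"
proof -
  have zc: "z \<in> carrier G" using ab z by simp
  have zi: "z [^] i \<otimes> b = b \<otimes> z [^] i" for i :: nat using commute_pow[of b z i] ab zc z by simp
  have eq: "a [^] i \<otimes> b \<otimes> inv (a [^] i) = inv (z [^] i) \<otimes> b" for i :: nat
  proof -
    have "inv (z [^] i) \<otimes> b = inv (z [^] i) \<otimes> (b \<otimes> a [^] i) \<otimes> inv (a [^] i)" using ab zc by (simp add: m_assoc)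
    also have "\<dots> = a [^] i \<otimes> b \<otimes> inv (a [^] i)"
      unfolding central_commutator_pow[OF ab z(1,2)] using ab zc by (simp add: m_assoc[symmetric])
    finally show ?thesis by simp
  qed
  have gen: "g \<otimes> h = h \<otimes> g" if "g \<in> generate G {z, b}" "h \<in> generate G {z, b}" for g h
  proof (rule commute_generate[OF _ _ _ that(2)])
    show "g \<in> carrier G" using that(1) generate_in_carrier[of "{z, b}"] ab zc by simp
    show "g \<otimes> s = s \<otimes> g" if s: "s \<in> {z, b}" for s
      by (rule commute_generate[OF _ _ _ \<open>g \<in> generate G {z, b}\<close>, symmetric])
        (use s ab zc z in auto)
  qed (use ab zc in auto)
  have "inv (z [^] i) \<otimes> b \<in> generate G {z, b}" for i :: nat
  proof -
    have "z [^] i \<in> generate G {z, b}" by (induction i) (auto intro: generate.intros)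
    then have "inv (z [^] i) \<in> generate G {z, b}" using generate_m_inv_closed[of "{z, b}"] ab zc by simp
    then show ?thesis by (intro generate.eng) (auto intro: generate.incl)
  qed
  then show ?thesis unfolding eq using gen ab zc by (simp add: commutator_eq_one_iff)
qed

text \<open>\<open>x\<close> and \<open>y\<close> generate a dihedral group with rotation
  \<open>r = x \<otimes> y\<close>, and \<open>t\<close> is central with trivial square; products of
  powers of \<open>t\<close>, \<open>r\<close>, \<open>x\<close> in this order exhaust the
  group.\<close>

lemma finite_dihedral:
  assumes xyt: "x \<in> carrier G" "y \<in> carrier G" "t \<in> carrier G"
    and inv: "x \<otimes> x = \<one>" "y \<otimes> y = \<one>" "t \<otimes> t = \<one>"
    and n: "0 < n" "(x \<otimes> y) [^] (n::nat) = \<one>"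
    and t: "t \<otimes> x = x \<otimes> t" "t \<otimes> y = y \<otimes> t"
  shows "finite (generate G {t, x, y})"
proof -
  define r where "r = x \<otimes> y"
  have r: "r \<in> carrier G" using xyt by (simp add: r_def)
  have sq: "s [^] (2::nat) = \<one>" if "s \<in> {t, x, y}" for s
    using that inv xyt by (auto simp: numeral_2_eq_2)
  define F where "F = {t [^] i \<otimes> (r [^] j \<otimes> x [^] k) | (i::nat) (j::nat) (k::nat). True}"
  have F_iff: "g \<in> F \<longleftrightarrow> (\<exists>(i::nat) (j::nat) (k::nat). g = t [^] i \<otimes> (r [^] j \<otimes> x [^] k))" for g
    by (auto simp: F_def)
  have "finite F"
    unfolding F_def
    by (rule finite_power_products[of _ _ _ 2 n 2]) (use xyt r sq n in \<open>simp_all add: r_def\<close>)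
  have Fc: "F \<subseteq> carrier G" using xyt r by (auto simp: F_iff)
  \<comment> \<open>The inverse of \<open>r\<close> is written as \<open>r [^] (n - 1)\<close> to
    keep all exponents natural.\<close>
  have xr: "x \<otimes> r [^] j = (r [^] (n - 1)) [^] j \<otimes> x" for j :: nat
  proof -
    have "r [^] (n - 1) \<otimes> r = \<one>" using n by (metis Suc_diff_1 nat_pow_Suc r_def)
    then have "r [^] (n - 1) = inv r" using r by (simp add: inv_equality[symmetric])
    moreover have "inv r = x \<otimes> r \<otimes> inv x"
    proof -
      have "inv x = x" "inv y = y" using inv xyt by (simp_all add: inv_equality)
      then show ?thesis using xyt inv by (simp add: r_def inv_mult_group m_assoc[symmetric])
    qed
    ultimately have "(r [^] (n - 1)) [^] j = x \<otimes> r [^] j \<otimes> inv x"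
      using conj_pow[of x r j] xyt r by simp
    then show ?thesis using xyt r by (simp add: m_assoc)
  qed
  have xF: "x \<otimes> f \<in> F" if fF: "f \<in> F" for f
  proof -
    obtain i j k :: nat where f: "f = t [^] i \<otimes> (r [^] j \<otimes> x [^] k)" using fF by (auto simp: F_iff)
    have "x \<otimes> f = (x \<otimes> t [^] i) \<otimes> (r [^] j \<otimes> x [^] k)" using f xyt r by (simp add: m_assoc)
    also have "x \<otimes> t [^] i = t [^] i \<otimes> x" using commute_pow[of x t i] xyt t by simp
    also have "t [^] i \<otimes> x \<otimes> (r [^] j \<otimes> x [^] k) = t [^] i \<otimes> ((x \<otimes> r [^] j) \<otimes> x [^] k)"
      using xyt r by (simp add: m_assoc)
    also have "\<dots> = t [^] i \<otimes> (r [^] ((n - 1) * j) \<otimes> x [^] Suc k)"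
      unfolding xr using xyt r by (simp add: nat_pow_pow pow_Suc_left nat_pow_Suc2[symmetric] m_assoc)
    finally show ?thesis unfolding F_iff by blast
  qed
  have rF: "r \<otimes> f \<in> F" if fF: "f \<in> F" for f
  proof -
    obtain i j k :: nat where f: "f = t [^] i \<otimes> (r [^] j \<otimes> x [^] k)" using fF by (auto simp: F_iff)
    have "r \<otimes> t = x \<otimes> (t \<otimes> y)" unfolding r_def t(2) using xyt by (simp add: m_assoc)
    also have "\<dots> = (t \<otimes> x) \<otimes> y" unfolding t(1) using xyt by (simp add: m_assoc)
    also have "\<dots> = t \<otimes> r" using xyt by (simp add: r_def m_assoc)
    finally have rt: "r \<otimes> t [^] i = t [^] i \<otimes> r" using commute_pow[of r t i] xyt r by simp
    have "r \<otimes> f = (r \<otimes> t [^] i) \<otimes> (r [^] j \<otimes> x [^] k)" using f xyt r by (simp add: m_assoc)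
    also have "\<dots> = t [^] i \<otimes> (r [^] Suc j \<otimes> x [^] k)"
      unfolding rt using xyt r by (simp add: pow_Suc_left m_assoc)
    finally show ?thesis unfolding F_iff by blast
  qed
  have "generate G {t, x, y} \<subseteq> F"
  proof (rule generate_subset_of_closed)
    show "\<one> \<in> F" unfolding F_iff by (rule exI[of _ 0], rule exI[of _ 0], rule exI[of _ 0]) simp
    show "\<exists>n>0. s [^] (n::nat) = \<one>" if "s \<in> {t, x, y}" for s
      using sq[OF that] by (intro exI[of _ 2]) simp
    fix s f assume s: "s \<in> {t, x, y}" and fF: "f \<in> F"
    have fc: "f \<in> carrier G" using fF Fc by auto
    have "t \<otimes> f \<in> F"
    proof -
      obtain i j k :: nat where f: "f = t [^] i \<otimes> (r [^] j \<otimes> x [^] k)" using fF by (auto simp: F_iff)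
      have "t \<otimes> f = t [^] Suc i \<otimes> (r [^] j \<otimes> x [^] k)"
        unfolding f using xyt r by (simp add: pow_Suc_left m_assoc)
      then show ?thesis unfolding F_iff by blast
    qed
    moreover have "y \<otimes> f = x \<otimes> (r \<otimes> f)" using xyt fc inv by (simp add: r_def m_assoc[symmetric])
    then have "y \<otimes> f \<in> F" using xF rF fF by simp
    ultimately show "s \<otimes> f \<in> F" using s xF fF by auto
  qed (use xyt Fc in simp_all)
  then show ?thesis using \<open>finite F\<close> finite_subset by blast
qed

end

section \<open>Self-similar groups containing the rotation\<close>

text \<open>Phrased with the operations of the ambient \<open>A\<close>, so that relations checked
  as identities of tree automorphisms can be pushed to \<open>H\<close> directly.\<close>

locale quotient_map = group A + H: group H for A (structure) and H +
  fixes C \<pi>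
  assumes C: "subgroup C A" and onto: "carrier H = \<pi> ` C"
    and map_mult: "g \<in> C \<Longrightarrow> h \<in> C \<Longrightarrow> \<pi> (g \<otimes> h) = \<pi> g \<otimes>\<^bsub>H\<^esub> \<pi> h"
begin

lemma in_carrier [simp]: "g \<in> C \<Longrightarrow> g \<in> carrier A"
  using C subgroup.mem_carrier by fastforce

lemma map_closed [simp]: "g \<in> C \<Longrightarrow> \<pi> g \<in> carrier H"
  using onto by blast

lemma map_group_hom: "group_hom (A\<lparr>carrier := C\<rparr>) H \<pi>"
  using C subgroup_imp_group
  by (intro group_hom.intro group_hom_axioms.intro homI) (simp_all add: map_mult H.is_group)

lemma map_one: "\<pi> \<one> = \<one>\<^bsub>H\<^esub>"
  using group_hom.hom_one[OF map_group_hom] by simp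

lemma map_inv: "g \<in> C \<Longrightarrow> \<pi> (inv g) = inv\<^bsub>H\<^esub> (\<pi> g)"
  using group_hom.hom_inv[OF map_group_hom, of g] m_inv_consistent[OF C, of g] by simp

lemma map_pow: "g \<in> C \<Longrightarrow> \<pi> (g [^] (n::nat)) = \<pi> g [^]\<^bsub>H\<^esub> n"
proof (induction n)
  case (Suc n)
  have "g [^] n \<in> C" using Suc.prems C by (rule_tac subgroup_pow)
  then show ?case using Suc by (simp add: map_mult)
qed (simp add: map_one)

lemma map_commutator:
  "g \<in> C \<Longrightarrow> h \<in> C \<Longrightarrow> \<pi> (commutator A g h) = commutator H (\<pi> g) (\<pi> h)"
  using C by (simp add: commutator_def map_mult map_inv subgroup.m_closed subgroup.m_inv_closed)

lemma map_generate:
  assumes "C = generate A S" "S \<subseteq> carrier A"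
  shows "carrier H = generate H (\<pi> ` S)"
proof -
  have SC: "S \<subseteq> C" using assms(1) by (auto intro: generate.incl)
  then have "generate H (\<pi> ` S) = \<pi> ` generate (A\<lparr>carrier := C\<rparr>) S"
    using group_hom.generate_img[OF map_group_hom] by simp
  also have "generate (A\<lparr>carrier := C\<rparr>) S = C"
    using generate_consistent[OF SC C] assms(1) by simp
  finally show ?thesis using onto by simp
qed

end

text \<open>\<open>sec_generator\<close> makes the group self-similar, and
  \<open>generator_is_sec\<close> makes it self-replicating at the letter 0; the rotation in
  \<open>C\<close> transports this to the other letters.\<close>

locale rot_group = regular_tree_auts d A for d and A (structure) +
  fixes S C :: "(nat list \<Rightarrow> nat list) set"
  assumes two_le: "2 \<le> d"
    and S: "finite S" "S \<subseteq> carrier A" and C_eq: "C = generate A S"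
    and rot_in: "rot \<in> C"
    and sec_generator: "s \<in> S \<Longrightarrow> x < d \<Longrightarrow> sec x s \<in> C"
    and generator_is_sec: "s \<in> S \<Longrightarrow> \<exists>h\<in>C. lead h 0 = 0 \<and> sec 0 h = s"
begin

abbreviation "\<Gamma> \<equiv> A\<lparr>carrier := C\<rparr>"

lemma C: "subgroup C A"
  unfolding C_eq using S(2) by (rule generate_is_subgroup)

lemma C_carrier [simp]: "g \<in> C \<Longrightarrow> g \<in> carrier A"
  using C subgroup.mem_carrier by fastforce

lemma C_closed [simp]:
  "\<one> \<in> C" "g \<in> C \<Longrightarrow> h \<in> C \<Longrightarrow> g \<otimes> h \<in> C" "g \<in> C \<Longrightarrow> inv g \<in> C"
  using C by (simp_all add: subgroup.one_closed subgroup.m_closed subgroup.m_inv_closed)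

lemma C_pow [simp]: "g \<in> C \<Longrightarrow> g [^] (n::nat) \<in> C"
  by (rule subgroup_pow[OF C])

lemma C_commutator [simp]: "g \<in> C \<Longrightarrow> h \<in> C \<Longrightarrow> commutator A g h \<in> C"
  by (simp add: commutator_def)

lemma sec_in: "g \<in> C \<Longrightarrow> x < d \<Longrightarrow> sec x g \<in> C"
  unfolding C_eq
proof (induction arbitrary: x rule: generate.induct)
  case (incl s)
  then show ?case using sec_generator by (simp add: C_eq)
next
  case (inv s)
  then have "s \<in> carrier A" using S by auto
  then show ?case
    using sec_inv[of s x] inv sec_generator C_closed(3) by (simp add: C_eq)
next
  case (eng g h)
  then have "g \<in> carrier A" "h \<in> carrier A" using generate_in_carrier[OF S(2)] by auto
  then show ?case using eng by (simp add: sec_mult generate.eng)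
qed (simp add: generate.one)

lemma zero_less: "0 < d"
  using two_le by simp

lemma sec_onto: "g \<in> C \<Longrightarrow> \<exists>h\<in>C. lead h 0 = 0 \<and> sec 0 h = g"
  unfolding C_eq
proof (induction rule: generate.induct)
  case one
  show ?case using zero_less by (intro bexI[of _ \<one>]) (simp_all add: generate.one)
next
  case (incl s)
  then show ?case using generator_is_sec by (simp add: C_eq)
next
  case (inv s)
  then obtain h where h: "h \<in> C" "lead h 0 = 0" "sec 0 h = s" using generator_is_sec by blast
  have "lead (inv h) 0 = 0" using lead_inv(1)[of h 0] h zero_less by simp
  then have "sec 0 (inv h) = inv s" using sec_inv[of h 0] h zero_less by simp
  then show ?case using \<open>lead (inv h) 0 = 0\<close> C_closed(3)[OF h(1)] C_eq by blast
next
  case (eng g1 g2)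
  then obtain h1 h2 where h: "h1 \<in> C" "lead h1 0 = 0" "sec 0 h1 = g1"
    "h2 \<in> C" "lead h2 0 = 0" "sec 0 h2 = g2" using C_eq by blast
  then have "lead (h1 \<otimes> h2) 0 = 0" "sec 0 (h1 \<otimes> h2) = g1 \<otimes> g2" "h1 \<otimes> h2 \<in> C"
    using zero_less by (simp_all add: lead_mult sec_mult)
  then show ?case using C_eq by blast
qed

section \<open>Normal subgroups, quotients and normal closures\<close>

definition normal_in :: "(nat list \<Rightarrow> nat list) set \<Rightarrow> bool" where
  "normal_in N \<longleftrightarrow> subgroup N A \<and> N \<subseteq> C \<and> (\<forall>g\<in>C. \<forall>k\<in>N. g \<otimes> k \<otimes> inv g \<in> N)"

text \<open>Turns membership in \<open>N\<close> into an equation in \<open>H\<close>, so that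
  relations can be manipulated in a group instead of modulo \<open>N\<close>.\<close>

lemma quotient:
  assumes "normal_in N"
  obtains H :: "(nat list \<Rightarrow> nat list) set monoid" and \<pi> where
    "quotient_map A H C \<pi>" "\<forall>g\<in>C. \<pi> g = \<one>\<^bsub>H\<^esub> \<longleftrightarrow> g \<in> N"
    "finite (carrier H) \<longrightarrow> finite_index \<Gamma> N"
proof -
  interpret \<Gamma>: group \<Gamma> using C subgroup_imp_group by blast
  have sub: "subgroup N \<Gamma>" using assms subgroup_incl[OF _ C] by (simp add: normal_in_def)
  have "N \<lhd> \<Gamma>"
    using assms sub m_inv_consistent[OF C] by (auto simp: \<Gamma>.normal_inv_iff normal_in_def)
  then interpret N: normal N \<Gamma> .
  let ?H = "\<Gamma> Mod N" and ?\<pi> = "\<lambda>g. N #>\<^bsub>\<Gamma>\<^esub> g"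
  have "group ?H" by (rule N.factorgroup_is_group)
  then have "quotient_map A ?H C ?\<pi>"
    using C N.rcos_sum is_group
    by (intro quotient_map.intro quotient_map_axioms.intro) (simp_all add: carrier_FactGroup)
  moreover have "?\<pi> g = \<one>\<^bsub>?H\<^esub> \<longleftrightarrow> g \<in> N" if g: "g \<in> C" for g
  proof -
    have "inv\<^bsub>\<Gamma>\<^esub> \<one> = \<one>" using m_inv_consistent[OF C, of \<one>] by simp
    moreover have "N #>\<^bsub>\<Gamma>\<^esub> \<one> = N"
      using \<Gamma>.coset_join2[OF _ sub subgroup.one_closed[OF sub]] by simp
    ultimately show ?thesis using \<Gamma>.rcos_eq_iff[OF sub, of g \<one>] g by simp
  qed
  moreover have "finite_index \<Gamma> N" if "finite (carrier ?H)"
    using that by (simp add: finite_index_def FactGroup_def)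
  ultimately show ?thesis using that by blast
qed

definition normal_closure :: "(nat list \<Rightarrow> nat list) set \<Rightarrow> (nat list \<Rightarrow> nat list) set" where
  "normal_closure X = generate A {g \<otimes> x \<otimes> inv g | g x. g \<in> C \<and> x \<in> X}"

context
  fixes X assumes X: "X \<subseteq> C"
begin

lemma conjugates_subset: "{g \<otimes> x \<otimes> inv g | g x. g \<in> C \<and> x \<in> X} \<subseteq> C"
  using X by auto

lemma normal_closure_normal: "normal_in (normal_closure X)"
proof -
  let ?Y = "{g \<otimes> x \<otimes> inv g | g x. g \<in> C \<and> x \<in> X}"
  have Y: "?Y \<subseteq> carrier A" using conjugates_subset C_carrier by blast
  have sub: "subgroup (generate A ?Y) A" by (rule generate_is_subgroup[OF Y])
  have "g \<otimes> k \<otimes> inv g \<in> generate A ?Y" if g: "g \<in> C" and k: "k \<in> generate A ?Y" for g k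
    using k
  proof induction
    case one
    then show ?case using g by (simp add: generate.one)
  next
    case (incl y)
    then obtain h x where hx: "y = h \<otimes> x \<otimes> inv h" "h \<in> C" "x \<in> X" by blast
    then have "g \<otimes> y \<otimes> inv g = (g \<otimes> h) \<otimes> x \<otimes> inv (g \<otimes> h)"
      using g X by (simp add: m_assoc inv_mult_group subsetD)
    moreover have "g \<otimes> h \<in> C" using g hx by simp
    ultimately show ?case using hx by (intro generate.incl) blast
  next
    case (inv y)
    then obtain h x where hx: "y = h \<otimes> x \<otimes> inv h" "h \<in> C" "x \<in> X" by blast
    then have "g \<otimes> inv y \<otimes> inv g = inv ((g \<otimes> h) \<otimes> x \<otimes> inv (g \<otimes> h))"
      using g X by (simp add: m_assoc inv_mult_group subsetD)
    moreover have "g \<otimes> h \<in> C" using g hx by simp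
    ultimately show ?case using hx generate.inv[of "(g \<otimes> h) \<otimes> x \<otimes> inv (g \<otimes> h)" ?Y A] by auto
  next
    case (eng k l)
    then have kl: "k \<in> carrier A" "l \<in> carrier A" using generate_in_carrier[OF Y] by auto
    have "g \<otimes> (k \<otimes> l) \<otimes> inv g = (g \<otimes> k \<otimes> inv g) \<otimes> (g \<otimes> l \<otimes> inv g)"
      using kl g by (simp add: m_assoc) (simp add: m_assoc[symmetric])
    then show ?case using eng by (simp add: generate.eng)
  qed
  moreover have "generate A ?Y \<subseteq> C" by (rule generate_subgroup_incl[OF conjugates_subset C])
  ultimately show ?thesis using sub by (simp add: normal_in_def normal_closure_def)
qed

lemma normal_closure_incl:
  assumes "x \<in> X"
  shows "x \<in> normal_closure X"
proof -
  have "x = \<one> \<otimes> x \<otimes> inv \<one>" using assms X by (simp add: subsetD)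
  then show ?thesis
    unfolding normal_closure_def using assms C_closed(1) by (intro generate.incl CollectI exI conjI)
qed

lemma normal_closure_minimal:
  assumes "normal_in N" "X \<subseteq> N"
  shows "normal_closure X \<subseteq> N"
  unfolding normal_closure_def
  by (rule generate_subgroup_incl) (use assms in \<open>auto simp: normal_in_def\<close>)

end

text \<open>Conjugation by \<open>rot [^] x\<close> carries the letter 0 to \<open>x\<close>, so one
  letter decides for all.\<close>

lemma emb_rot_iff:
  assumes "normal_in N" "x < d" "k \<in> C"
  shows "emb x k \<in> N \<longleftrightarrow> emb 0 k \<in> N"
proof -
  let ?r = "rot [^] x"
  have r: "?r \<in> C" using rot_in by simp
  have eq: "?r \<otimes> emb 0 k \<otimes> inv ?r = emb x k"
    using assms by (simp add: conj_emb lead_rot_pow)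
  have "inv ?r \<otimes> (?r \<otimes> emb 0 k \<otimes> inv ?r) \<otimes> ?r = (inv ?r \<otimes> ?r) \<otimes> emb 0 k \<otimes> (inv ?r \<otimes> ?r)"
    using r assms(3) by (simp only: m_assoc m_closed inv_closed emb_closed C_carrier)
  then have "inv ?r \<otimes> emb x k \<otimes> inv (inv ?r) = emb 0 k"
    using r assms(3) by (simp add: eq)
  then show ?thesis using assms(1) r eq unfolding normal_in_def by (metis C_closed(3))
qed

text \<open>That \<open>K\<close> contains its own copy below 0 means that \<open>K\<close> is a
  subset of \<open>emb_preimage K\<close>. As this preimage is normal, the inclusion has to be
  checked only on elements whose normal closure is \<open>K\<close>.\<close>

definition emb_preimage :: "(nat list \<Rightarrow> nat list) set \<Rightarrow> (nat list \<Rightarrow> nat list) set" where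
  "emb_preimage N = {g \<in> C. emb 0 g \<in> N}"

text \<open>Conjugation by \<open>g\<close> below the letter 0 is realized by an element of
  \<open>C\<close> that fixes this letter and has section \<open>g\<close> there;
  \<open>sec_onto\<close> provides it.\<close>

lemma emb_preimage_normal:
  assumes "normal_in N"
  shows "normal_in (emb_preimage N)"
proof -
  have N: "subgroup N A" using assms by (simp add: normal_in_def)
  have "subgroup (emb_preimage N) A"
  proof (rule subgroupI)
    show "emb_preimage N \<subseteq> carrier A" by (auto simp: emb_preimage_def)
    have "\<one> \<in> emb_preimage N" using N by (simp add: emb_preimage_def subgroup.one_closed)
    then show "emb_preimage N \<noteq> {}" by blast
  qed (use N in \<open>auto simp: emb_preimage_def emb_inv emb_mult subgroup.m_closed subgroup.m_inv_closed\<close>)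
  moreover have "g \<otimes> k \<otimes> inv g \<in> emb_preimage N" if "g \<in> C" "k \<in> emb_preimage N" for g k
  proof -
    obtain h where h: "h \<in> C" "lead h 0 = 0" "sec 0 h = g" using sec_onto[OF \<open>g \<in> C\<close>] by blast
    have "h \<otimes> emb 0 k \<otimes> inv h = emb 0 (g \<otimes> k \<otimes> inv g)"
      using conj_emb[of h k 0] h that zero_less by (simp add: emb_preimage_def)
    moreover have "h \<otimes> emb 0 k \<otimes> inv h \<in> N"
      using assms h(1) that(2) by (simp add: emb_preimage_def normal_in_def)
    ultimately show ?thesis using that by (simp add: emb_preimage_def)
  qed
  ultimately show ?thesis by (auto simp: normal_in_def emb_preimage_def)
qed

end

section \<open>Branching over a normal subgroup\<close>

text \<open>Regular branching over \<open>K\<close>. Both \<open>K_emb\<close> and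
  \<open>generated_by_fixator\<close> speak of the letter 0 only, because the rotation, which lies
  in \<open>Q\<close>, carries it to every other letter.\<close>

locale branching_group = rot_group d A S C for d and A (structure) and S C +
  fixes K Q :: "(nat list \<Rightarrow> nat list) set"
  assumes K_normal: "normal_in K" and K_finite_index: "finite_index \<Gamma> K"
    and K_emb: "k \<in> K \<Longrightarrow> emb 0 k \<in> K"
    and Q: "subgroup Q A" "Q \<subseteq> C" "finite Q" "rot \<in> Q"
    and generated_by_fixator: "subgroup M A \<Longrightarrow> Q \<subseteq> M \<Longrightarrow>
      (\<And>g. g \<in> C \<Longrightarrow> (\<And>w. w \<in> T \<Longrightarrow> g (0 # w) = 0 # w) \<Longrightarrow> g \<in> M) \<Longrightarrow> C \<subseteq> M"
begin

lemma K: "subgroup K A" "K \<subseteq> C"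
  using K_normal by (simp_all add: normal_in_def)

lemma K_carrier [simp]: "k \<in> K \<Longrightarrow> k \<in> carrier A"
  using K(2) by auto

lemma Gamma_group: "group \<Gamma>"
  using C subgroup_imp_group by blast

lemma Gamma_inv: "g \<in> C \<Longrightarrow> inv\<^bsub>\<Gamma>\<^esub> g = inv g"
  using m_inv_consistent[OF C] by simp

lemma Gamma_subgroup: "subgroup H A \<Longrightarrow> H \<subseteq> C \<Longrightarrow> subgroup H \<Gamma>"
  using subgroup_incl C by blast

lemma Gamma_tree_action: "tree_action \<Gamma> T (\<lambda>g. g)"
  by (rule tree_action_faithfulI[OF rooted_regular_tree faithful_action_subgroup[OF C]])
    (simp add: carrier_eq[symmetric])

lemma emb_in:
  assumes "k \<in> K" "x < d"
  shows "emb x k \<in> K"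
  using emb_rot_iff[OF K_normal assms(2)] K_emb assms(1) K(2) by blast

lemma transitive_from_zero:
  assumes "length w = n" "w \<in> T"
  shows "\<exists>g\<in>C. g (replicate n 0) = w"
  using assms
proof (induction w arbitrary: n)
  case Nil
  then show ?case using C by (intro bexI[of _ \<one>]) (simp_all add: subgroup.one_closed)
next
  case (Cons x w)
  have zero: "replicate m 0 \<in> T" for m using two_le by (auto simp: regular_tree_def)
  have d0: "0 < d" using two_le by simp
  obtain g where g: "g \<in> C" "g (replicate (length w) 0) = w" using Cons by auto
  obtain h where h: "h \<in> C" "lead h 0 = 0" "sec 0 h = g" using sec_onto[OF g(1)] by blast
  have "(rot [^] x \<otimes> h) (0 # replicate (length w) 0) = x # w"
    using h g zero Cons.prems d0 rot_in
    by (simp add: mult_apply apply_Cons[of h] apply_Cons[of "rot [^] x"] lead_rot_pow)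
  moreover have "rot [^] x \<otimes> h \<in> C" using h(1) rot_in C by (simp add: subgroup.m_closed)
  ultimately show ?case using Cons.prems by auto
qed

lemma transitive:
  assumes "u \<in> level T n" "v \<in> level T n"
  shows "\<exists>g\<in>C. g u = v"
proof -
  obtain g h where g: "g \<in> C" "g (replicate n 0) = u" and h: "h \<in> C" "h (replicate n 0) = v"
    using transitive_from_zero assms unfolding level_def by blast
  have zero: "replicate n 0 \<in> T" using two_le by (auto simp: regular_tree_def)
  have "(inv g) u = replicate n 0" using g apply_inv[of g "replicate n 0"] zero by simp
  then have "(h \<otimes> inv g) u = v" using g(1) h assms by (simp add: mult_apply level_def)
  moreover have "h \<otimes> inv g \<in> C" using g(1) h(1) C by (simp add: subgroup.m_closed subgroup.m_inv_closed)
  ultimately show ?thesis by blast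
qed

lemma infinite_C: "infinite C"
proof
  assume fin: "finite C"
  define n where "n = card C"
  have "level T n \<subseteq> (\<lambda>g. g (replicate n 0)) ` C"
  proof
    fix w assume "w \<in> level T n"
    then obtain g where "g \<in> C" "g (replicate n 0) = w"
      using transitive_from_zero unfolding level_def by blast
    then show "w \<in> (\<lambda>g. g (replicate n 0)) ` C" by blast
  qed
  then have "card (level T n) \<le> n" unfolding n_def by (rule surj_card_le[OF fin])
  then show False using less_card_level_regular_tree[OF two_le, of n] by simp
qed

lemma infinite_K: "infinite K"
  using group.infinite_of_finite_index[OF Gamma_group K_finite_index Gamma_subgroup[OF K(1,2)]] infinite_C by simp

primrec embv :: "nat list \<Rightarrow> (nat list \<Rightarrow> nat list) \<Rightarrow> nat list \<Rightarrow> nat list" where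
  "embv [] k = k"
| "embv (x # v) k = emb x (embv v k)"

lemma embv_in: "v \<in> T \<Longrightarrow> k \<in> K \<Longrightarrow> embv v k \<in> K"
  by (induction v) (auto simp: emb_in)

lemma embv_inj: "v \<in> T \<Longrightarrow> k \<in> K \<Longrightarrow> l \<in> K \<Longrightarrow> embv v k = embv v l \<Longrightarrow> k = l"
  by (induction v) (auto simp: emb_inj embv_in)

lemma emb_apply:
  assumes "k \<in> carrier A" "y < d" "w \<in> T"
  shows "emb x k (y # w) = y # (if y = x then k w else w)"
  using assms by (simp add: emb_def dir_apply)

lemma embv_in_rist:
  assumes "v \<in> T" "k \<in> K"
  shows "embv v k \<in> rist \<Gamma> T (\<lambda>g. g) v"
proof -
  have "embv v k u = u" if "u \<in> T" "\<not> prefix v u" for u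
    using assms that
  proof (induction v arbitrary: u)
    case (Cons x v)
    then show ?case by (cases u) (auto simp: emb_apply embv_in)
  qed simp
  then show ?thesis using embv_in[OF assms] K(2) by (auto simp: rist_def subtree_at_def)
qed

lemma infinite_rist:
  assumes "v \<in> T"
  shows "infinite (rist \<Gamma> T (\<lambda>g. g) v)"
proof -
  have "inj_on (embv v) K" using embv_inj[OF assms] by (auto simp: inj_on_def)
  then have "infinite (embv v ` K)" using infinite_K finite_imageD by blast
  moreover have "embv v ` K \<subseteq> rist \<Gamma> T (\<lambda>g. g) v" using embv_in_rist[OF assms] by blast
  ultimately show ?thesis using infinite_super by blast
qed

text \<open>The geometric power \<open>K\<^sup>d\<^sup>^\<^sup>n\<close>: the elements that fix level \<open>n\<close> and whose sections there lie
  in \<open>K\<close>.\<close>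

primrec K_level :: "nat \<Rightarrow> (nat list \<Rightarrow> nat list) set" where
  "K_level 0 = K"
| "K_level (Suc n) = {g \<in> C. \<forall>x<d. lead g x = x \<and> sec x g \<in> K_level n}"

lemma K_level_subgroup: "subgroup (K_level n) A \<and> K_level n \<subseteq> C"
proof (induction n)
  case (Suc n)
  have "subgroup (K_level (Suc n)) A"
  proof (rule subgroupI)
    have "\<one> \<in> K_level (Suc n)" using Suc C by (auto simp: subgroup.one_closed)
    then show "K_level (Suc n) \<noteq> {}" by blast
    show "inv g \<in> K_level (Suc n)" if g: "g \<in> K_level (Suc n)" for g
    proof -
      have gC: "g \<in> C" and gx: "\<And>x. x < d \<Longrightarrow> lead g x = x" "\<And>x. x < d \<Longrightarrow> sec x g \<in> K_level n"
        using g by auto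
      have "lead (inv g) x = x \<and> sec x (inv g) \<in> K_level n" if x: "x < d" for x
        using lead_inv(1)[of g x] sec_inv[of g x] gx[OF x] gC x Suc
        by (simp add: subgroup.m_inv_closed)
      then show ?thesis using gC C by (simp add: subgroup.m_inv_closed)
    qed
    show "g \<otimes> h \<in> K_level (Suc n)" if "g \<in> K_level (Suc n)" "h \<in> K_level (Suc n)" for g h
      using that C Suc by (auto simp: lead_mult sec_mult subgroup.m_closed)
  qed auto
  then show ?case by auto
qed (use K in simp)

text \<open>The permutation of the first level and the cosets of the sections form an invariant with
  finitely many values, by induction.\<close>

lemma K_level_finite_index: "finite_index \<Gamma> (K_level n)"
proof (induction n)
  case (Suc n)
  interpret \<Gamma>: group \<Gamma> by (rule Gamma_group)
  have sub: "subgroup (K_level n) \<Gamma>" "subgroup (K_level (Suc n)) \<Gamma>"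
    using K_level_subgroup Gamma_subgroup by blast+
  let ?c = "\<lambda>g. \<lambda>x\<in>{..<d}. (lead g x, K_level n #>\<^bsub>\<Gamma>\<^esub> sec x g)"
  show ?case
  proof (rule \<Gamma>.finite_index_mapI[OF sub(2), of ?c])
    have "?c ` carrier \<Gamma> \<subseteq> {..<d} \<rightarrow>\<^sub>E ({..<d} \<times> rcosets\<^bsub>\<Gamma>\<^esub> (K_level n))"
      using sec_in by (intro image_subsetI PiE_I) (auto simp: \<Gamma>.rcosets_image)
    moreover have "finite ({..<d} \<rightarrow>\<^sub>E ({..<d} \<times> rcosets\<^bsub>\<Gamma>\<^esub> (K_level n)))"
      using Suc by (intro finite_PiE) (auto simp: finite_index_def)
    ultimately show "finite (?c ` carrier \<Gamma>)" by (rule finite_subset)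
  next
    fix g h assume "g \<in> carrier \<Gamma>" "h \<in> carrier \<Gamma>" and c: "?c g = ?c h"
    then have gh: "g \<in> C" "h \<in> C" by simp_all
    have eq: "lead g x = lead h x" "K_level n #>\<^bsub>\<Gamma>\<^esub> sec x g = K_level n #>\<^bsub>\<Gamma>\<^esub> sec x h" if "x < d" for x
      using fun_cong[OF c, of x] that by simp_all
    have "lead (g \<otimes> inv h) y = y \<and> sec y (g \<otimes> inv h) \<in> K_level n" if y: "y < d" for y
    proof -
      \<comment> \<open>At \<open>y\<close> the element \<open>inv h\<close> first leads to
        \<open>x\<close>, where the sections of \<open>g\<close> and \<open>h\<close> are then
        compared.\<close>
      define x where "x = lead (inv h) y"
      have x: "x < d" using y gh by (simp add: x_def)
      have hx: "lead h x = y" using lead_inv(2)[of h y] gh y by (simp add: x_def)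
      have "sec y (inv h) = inv (sec x h)" using sec_inv[of h y] gh y by (simp add: x_def)
      then have "sec y (g \<otimes> inv h) = sec x g \<otimes> inv (sec x h)"
        using gh y by (simp add: sec_mult x_def)
      moreover have "sec x g \<otimes> inv (sec x h) \<in> K_level n"
        using eq(2)[OF x] \<Gamma>.rcos_eq_iff[OF sub(1), of "sec x g" "sec x h"] sec_in gh x
        by (simp add: Gamma_inv)
      ultimately show ?thesis using gh y hx eq(1)[OF x] by (simp add: lead_mult x_def[symmetric])
    qed
    then show "g \<otimes>\<^bsub>\<Gamma>\<^esub> inv\<^bsub>\<Gamma>\<^esub> h \<in> K_level (Suc n)"
      using gh C by (simp add: Gamma_inv subgroup.m_closed subgroup.m_inv_closed)
  qed
qed (use K_finite_index in simp)

lemma emb_generate: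
  assumes "X \<subseteq> carrier A" "k \<in> generate A X"
  shows "emb x k \<in> generate A (emb x ` X)"
  using assms(2)
proof induction
  case one
  then show ?case by (simp add: generate.one)
next
  case (incl h)
  then show ?case by (intro generate.incl) simp
next
  case (inv h)
  then have "emb x (inv h) = inv (emb x h)" using assms(1) by (intro emb_inv) auto
  then show ?case using inv by (simp add: generate.inv)
next
  case (eng h1 h2)
  then show ?case using generate_in_carrier[OF assms(1)] by (simp add: emb_mult generate.eng)
qed

text \<open>An element fixing the first level is the product of its sections, each placed below its
  letter; they are collected letter by letter, and \<open>m\<close> counts those already
  treated.\<close>

lemma K_level_generated: "K_level n \<subseteq> generate A (\<Union>v\<in>level T n. embv v ` K)"
proof (induction n)
  case 0
  have "K \<subseteq> (\<Union>v\<in>level T 0. embv v ` K)" by (force simp: level_def)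
  then show ?case by (auto intro: generate.incl)
next
  case (Suc n)
  let ?X = "\<lambda>n. \<Union>v\<in>level T n. embv v ` K"
  have X: "?X m \<subseteq> carrier A" for m using embv_in by (auto simp: level_def)
  have embX: "emb x ` ?X n \<subseteq> ?X (Suc n)" if x: "x < d" for x
  proof
    fix g assume "g \<in> emb x ` ?X n"
    then obtain v k where "v \<in> level T n" "k \<in> K" "g = embv (x # v) k" by auto
    moreover from this have "x # v \<in> level T (Suc n)" using x by (simp add: level_def)
    ultimately show "g \<in> ?X (Suc n)" by blast
  qed
  show ?case
  proof
    fix g assume "g \<in> K_level (Suc n)"
    then have gC: "g \<in> C" and gx: "\<And>x. x < d \<Longrightarrow> lead g x = x" "\<And>x. x < d \<Longrightarrow> sec x g \<in> K_level n"
      by auto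
    have "dir (\<lambda>x. if x < m then sec x g else \<one>) \<in> generate A (?X (Suc n))" if "m \<le> d" for m
      using that
    proof (induction m)
      case 0
      then show ?case by (simp add: dir_one generate.one)
    next
      case (Suc m)
      have m: "m < d" using Suc by simp
      have "dir (\<lambda>x. if x < Suc m then sec x g else \<one>) =
          dir (\<lambda>x. if x < m then sec x g else \<one>) \<otimes> emb m (sec m g)"
        unfolding emb_def using gC m by (subst dir_mult) (auto intro!: dir_eqI)
      moreover have "emb m (sec m g) \<in> generate A (?X (Suc n))"
        using emb_generate[OF X, of "sec m g" n m] gx(2)[OF m] \<open>K_level n \<subseteq> _\<close>
          mono_generate[OF embX[OF m]] by blast
      ultimately show ?case using Suc by (simp add: generate.eng)
    qed
    from this[of d] have "dir (\<lambda>x. if x < d then sec x g else \<one>) \<in> generate A (?X (Suc n))" by simp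
    moreover have "dir (\<lambda>x. if x < d then sec x g else \<one>) = dir (\<lambda>x. sec x g)" by (rule dir_eqI) simp
    ultimately show "g \<in> generate A (?X (Suc n))" using dir_sec[of g] gC gx(1) by simp
  qed
qed

lemma rist_level_finite_index: "finite_index \<Gamma> (rist_level \<Gamma> T (\<lambda>g. g) n)"
proof -
  interpret \<Gamma>: group \<Gamma> by (rule Gamma_group)
  let ?R = "\<Union>v\<in>level T n. rist \<Gamma> T (\<lambda>g. g) v"
  have R: "?R \<subseteq> C" by (auto simp: rist_def)
  then have eq: "rist_level \<Gamma> T (\<lambda>g. g) n = generate A ?R"
    unfolding rist_level_def by (rule generate_consistent[OF _ C])
  have "(\<Union>v\<in>level T n. embv v ` K) \<subseteq> ?R" using embv_in_rist by (fastforce simp: level_def)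
  then have "K_level n \<subseteq> generate A ?R"
    using K_level_generated[of n] mono_generate by blast
  moreover have "subgroup (generate A ?R) \<Gamma>"
    unfolding eq[symmetric] rist_level_def using R by (intro \<Gamma>.generate_is_subgroup) simp
  ultimately show ?thesis
    unfolding eq using \<Gamma>.finite_index_mono[OF K_level_finite_index] K_level_subgroup Gamma_subgroup by blast
qed

text \<open>Conjugation by \<open>rot [^] x\<close> carries the fixator of the subtree of 0 to that
  of \<open>x\<close>, and \<open>rot\<close> lies in \<open>Q\<close>.\<close>

lemma generate_Q_fixator:
  assumes x: "x < d"
  shows "generate \<Gamma> (Q \<union> {g \<in> carrier \<Gamma>. \<forall>u\<in>T. prefix [x] u \<longrightarrow> g u = u}) = carrier \<Gamma>"
proof -
  let ?X = "Q \<union> {g \<in> C. \<forall>u\<in>T. prefix [x] u \<longrightarrow> g u = u}"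
  define M where "M = generate A ?X"
  have XC: "?X \<subseteq> C" using Q by auto
  have XA: "?X \<subseteq> carrier A" using XC by auto
  have M: "subgroup M A" unfolding M_def by (rule generate_is_subgroup[OF XA])
  have "C \<subseteq> M"
  proof (rule generated_by_fixator[OF M])
    show QM: "Q \<subseteq> M" by (auto simp: M_def intro: generate.incl)
    fix g assume g: "g \<in> C" "\<And>w. w \<in> T \<Longrightarrow> g (0 # w) = 0 # w"
    let ?r = "rot [^] x"
    define h where "h = ?r \<otimes> g \<otimes> inv ?r"
    have hC: "h \<in> C" using g(1) rot_in C by (simp add: h_def subgroup.m_closed subgroup.m_inv_closed)
    have "h u = u" if u: "u \<in> T" "prefix [x] u" for u
    proof -
      obtain w where w: "u = x # w" "w \<in> T" using u by (cases u) auto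
      have r: "?r (0 # w) = x # w" using w x by (simp add: apply_Cons lead_rot_pow)
      have "(h \<otimes> ?r) (0 # w) = (?r \<otimes> g) (0 # w)" using g(1) by (simp add: h_def m_assoc)
      then have "h (?r (0 # w)) = ?r (g (0 # w))" using hC g(1) w x by (simp add: mult_apply)
      then show ?thesis using r g(2)[OF w(2)] w by simp
    qed
    then have "h \<in> M" using hC by (auto simp: M_def intro!: generate.incl)
    moreover have "?r \<in> M"
      using Q(4) QM M by (induction x) (auto simp: subgroup.one_closed subgroup.m_closed)
    ultimately have "inv ?r \<otimes> h \<otimes> ?r \<in> M" using M by (simp add: subgroup.m_closed subgroup.m_inv_closed)
    also have "inv ?r \<otimes> h \<otimes> ?r = g"
      using g(1) by (simp add: h_def m_assoc) (simp add: m_assoc[symmetric])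
    finally show "g \<in> M" .
  qed
  moreover have "M \<subseteq> C" unfolding M_def using generate_subgroup_incl[OF XC C] .
  moreover have "generate \<Gamma> ?X = M" unfolding M_def using generate_consistent[OF XC C] .
  ultimately show ?thesis by simp
qed

sublocale branch: branch_with_finite_subgroup \<Gamma> d "\<lambda>g. g" S Q
proof (intro branch_with_finite_subgroup.intro branch_with_finite_subgroup_axioms.intro)
  show "tree_action \<Gamma> T (\<lambda>g. g)" by (rule Gamma_tree_action)
  have SC: "S \<subseteq> C" unfolding C_eq by (auto intro: generate.incl)
  show "carrier \<Gamma> = generate \<Gamma> S" using generate_consistent[OF SC C] C_eq by simp
  show "\<exists>g\<in>carrier \<Gamma>. g u = v" if "u \<in> level T n" "v \<in> level T n" for u v n
    using transitive[OF that] by simp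
qed (use two_le S infinite_rist rist_level_finite_index Gamma_subgroup[OF Q(1,2)] Q(3)
    generate_Q_fixator in \<open>simp_all\<close>)

end

context rot_group
begin

lemma branching_group_normal_closure:
  assumes X: "X \<subseteq> C" "X \<subseteq> emb_preimage (normal_closure X)" "finite_index \<Gamma> (normal_closure X)"
    and Q: "subgroup Q A" "Q \<subseteq> C" "finite Q" "rot \<in> Q"
    and gen: "\<And>M. subgroup M A \<Longrightarrow> Q \<subseteq> M \<Longrightarrow>
      (\<And>g. g \<in> C \<Longrightarrow> (\<And>w. w \<in> T \<Longrightarrow> g (0 # w) = 0 # w) \<Longrightarrow> g \<in> M) \<Longrightarrow> S \<subseteq> M"
  shows "branching_group d A S C (normal_closure X) Q"
proof (intro branching_group.intro branching_group_axioms.intro rot_group_axioms)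
  let ?K = "normal_closure X"
  show K: "normal_in ?K" by (rule normal_closure_normal[OF X(1)])
  have "?K \<subseteq> emb_preimage ?K"
    by (rule normal_closure_minimal[OF X(1) emb_preimage_normal[OF K] X(2)])
  then show "\<And>k. k \<in> ?K \<Longrightarrow> emb 0 k \<in> ?K" by (auto simp: emb_preimage_def)
  show "C \<subseteq> M" if "subgroup M A" "Q \<subseteq> M"
    "\<And>g. g \<in> C \<Longrightarrow> (\<And>w. w \<in> T \<Longrightarrow> g (0 # w) = 0 # w) \<Longrightarrow> g \<in> M" for M
    unfolding C_eq by (rule generate_subgroup_incl[OF gen[OF that] that(1)])
qed (use X(3) Q in simp_all)

end

section \<open>The first Grigorchuk group\<close>

lemma grig_length [simp]:
  "length (grig_a w) = length w"
  "length (grig_b w) = length w" "length (grig_c w) = length w" "length (grig_d w) = length w"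
proof -
  show a: "length (grig_a w) = length w" for w by (cases w) auto
  show "length (grig_b w) = length w" "length (grig_c w) = length w" "length (grig_d w) = length w"
    by (induction w) (auto simp: a)
qed

lemma grig_take:
  "take n (grig_b w) = grig_b (take n w)" "take n (grig_c w) = grig_c (take n w)"
  "take n (grig_d w) = grig_d (take n w)"
proof -
  have a: "take n (grig_a w) = grig_a (take n w)" for n w by (cases w; cases n) auto
  have "take n (grig_b w) = grig_b (take n w) \<and> take n (grig_c w) = grig_c (take n w) \<and>
      take n (grig_d w) = grig_d (take n w)"
  proof (induction w arbitrary: n)
    case (Cons x w)
    then show ?case by (cases n) (auto simp: a)
  qed simp
  then show "take n (grig_b w) = grig_b (take n w)" "take n (grig_c w) = grig_c (take n w)"
    "take n (grig_d w) = grig_d (take n w)" by simp_all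
qed

lemma grig_in:
  assumes "w \<in> regular_tree 2"
  shows "grig_b w \<in> regular_tree 2" "grig_c w \<in> regular_tree 2" "grig_d w \<in> regular_tree 2"
proof -
  have a: "grig_a w \<in> regular_tree 2" if "w \<in> regular_tree 2" for w using that by (cases w) auto
  have "grig_b w \<in> regular_tree 2 \<and> grig_c w \<in> regular_tree 2 \<and> grig_d w \<in> regular_tree 2"
    using assms by (induction w) (auto simp: a)
  then show "grig_b w \<in> regular_tree 2" "grig_c w \<in> regular_tree 2" "grig_d w \<in> regular_tree 2"
    by simp_all
qed

lemma grig_klein:
  assumes "w \<in> regular_tree 2"
  shows "grig_b (grig_b w) = w" "grig_c (grig_c w) = w" "grig_d (grig_d w) = w"
    "grig_b (grig_d w) = grig_c w" "grig_d (grig_b w) = grig_c w"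
proof -
  have a: "grig_a (grig_a w) = w" if "w \<in> regular_tree 2" for w using that by (cases w) auto
  \<comment> \<open>All products of two of b, c, d are treated together, since passing to the letter
    1 permutes these generators cyclically.\<close>
  have "grig_b (grig_b w) = w \<and> grig_c (grig_c w) = w \<and> grig_d (grig_d w) = w \<and>
      grig_b (grig_d w) = grig_c w \<and> grig_d (grig_b w) = grig_c w \<and>
      grig_b (grig_c w) = grig_d w \<and> grig_c (grig_b w) = grig_d w \<and>
      grig_c (grig_d w) = grig_b w \<and> grig_d (grig_c w) = grig_b w"
    using assms by (induction w) (auto simp: a)
  then show "grig_b (grig_b w) = w" "grig_c (grig_c w) = w" "grig_d (grig_d w) = w"
    "grig_b (grig_d w) = grig_c w" "grig_d (grig_b w) = grig_c w" by simp_all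
qed

locale grigorchuk = regular_tree_auts 2 A for A (structure)
begin

definition "gb = restrict grig_b T"
definition "gc = restrict grig_c T"
definition "gd = restrict grig_d T"

lemma grig_a_rot: "restrict grig_a T = rot"
  unfolding rot_def
proof (rule restrict_ext)
  fix w assume "w \<in> T"
  then show "grig_a w = ggs_a 2 w" by (cases w) (auto simp: less_2_cases_iff)
qed

lemma gens_closed [simp]: "gb \<in> carrier A" "gc \<in> carrier A" "gd \<in> carrier A"
proof -
  have inj: "inj_on (restrict f T) T" if "\<And>w. w \<in> T \<Longrightarrow> f (f w) = w" for f
    by (rule inj_onI) (use that in \<open>metis restrict_apply'\<close>)
  show "gb \<in> carrier A" "gc \<in> carrier A" "gd \<in> carrier A"
    unfolding carrier_eq gb_def gc_def gd_def
    by (rule regular_tree_autI; (rule inj)?; simp add: grig_in grig_take grig_klein)+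
qed

lemma apply_gens:
  assumes "x < 2" "w \<in> T"
  shows "gb (x # w) = x # (if x = 0 then rot else gc) w" "gc (x # w) = x # (if x = 0 then rot else gd) w"
    "gd (x # w) = x # (if x = 0 then \<one> else gb) w"
  using assms by (simp_all add: gb_def gc_def gd_def grig_a_rot[symmetric])

lemma lead_gens [simp]: "x < 2 \<Longrightarrow> lead gb x = x" "x < 2 \<Longrightarrow> lead gc x = x" "x < 2 \<Longrightarrow> lead gd x = x"
  and sec_gens [simp]: "x < 2 \<Longrightarrow> sec x gb = (if x = 0 then rot else gc)"
    "x < 2 \<Longrightarrow> sec x gc = (if x = 0 then rot else gd)" "x < 2 \<Longrightarrow> sec x gd = (if x = 0 then \<one> else gb)"
proof -
  have *: "lead g x = x \<and> sec x g = k"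
    if "g \<in> carrier A" "k \<in> carrier A" "x < 2" "\<And>w. w \<in> T \<Longrightarrow> g (x # w) = x # k w" for g k x
    using secI[where f = g and k = k and x = x and y = x] that by simp
  show "x < 2 \<Longrightarrow> lead gb x = x" "x < 2 \<Longrightarrow> lead gc x = x" "x < 2 \<Longrightarrow> lead gd x = x"
    "x < 2 \<Longrightarrow> sec x gb = (if x = 0 then rot else gc)"
    "x < 2 \<Longrightarrow> sec x gc = (if x = 0 then rot else gd)"
    "x < 2 \<Longrightarrow> sec x gd = (if x = 0 then \<one> else gb)"
    using *[of gb "if x = 0 then rot else gc" x] *[of gc "if x = 0 then rot else gd" x]
      *[of gd "if x = 0 then \<one> else gb" x] by (simp_all add: apply_gens)
qed

lemma rot_pos [simp]: "lead rot 0 = Suc 0" "lead rot (Suc 0) = 0" "sec 0 rot = \<one>" "sec (Suc 0) rot = \<one>"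
  by (simp_all add: lead_rot sec_rot)

lemma rot_rot: "rot \<otimes> rot = \<one>"
  using rot_pow_d by (simp add: pow_two)

lemma inv_rot [simp]: "inv rot = rot"
  using rot_rot by (simp add: inv_equality)

lemma klein: "gb \<otimes> gb = \<one>" "gc \<otimes> gc = \<one>" "gd \<otimes> gd = \<one>" "gb \<otimes> gd = gc" "gd \<otimes> gb = gc"
proof -
  have u: "gb u = grig_b u" "gc u = grig_c u" "gd u = grig_d u" if "u \<in> T" for u
    using that by (simp_all add: gb_def gc_def gd_def)
  show "gb \<otimes> gb = \<one>" "gc \<otimes> gc = \<one>" "gd \<otimes> gd = \<one>" "gb \<otimes> gd = gc" "gd \<otimes> gb = gc"
    by (rule apply_eqI; simp add: mult_apply u grig_klein grig_in)+
qed

lemma two_sec_eqI: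
  assumes "f \<in> carrier A" "g \<in> carrier A" "lead f 0 = lead g 0" "lead f (Suc 0) = lead g (Suc 0)"
    "sec 0 f = sec 0 g" "sec (Suc 0) f = sec (Suc 0) g"
  shows "f = g"
  by (rule sec_eqI) (use assms in \<open>auto simp: less_2_cases_iff\<close>)

text \<open>The squares of ad and da are both \<open>(b, b)_1\<close>, an involution.\<close>

lemma rot_gd_pow: "(rot \<otimes> gd) [^] (4::nat) = \<one>" "(gd \<otimes> rot) [^] (4::nat) = \<one>"
proof -
  have sq: "dir (\<lambda>_. gb) \<otimes> dir (\<lambda>_. gb) = \<one>" by (simp add: dir_mult klein dir_one)
  have pow4: "s [^] (4::nat) = \<one>" if "s \<in> carrier A" "s \<otimes> s = dir (\<lambda>_. gb)" for s
  proof -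
    have "s [^] (4::nat) = (s \<otimes> s) \<otimes> (s \<otimes> s)" using that(1) by (simp add: numeral_eq_Suc m_assoc)
    then show ?thesis using that(2) sq by simp
  qed
  show "(rot \<otimes> gd) [^] (4::nat) = \<one>"
    by (rule pow4; (rule two_sec_eqI)?) (simp_all add: lead_mult sec_mult lead_dir sec_dir)
  show "(gd \<otimes> rot) [^] (4::nat) = \<one>"
    by (rule pow4; (rule two_sec_eqI)?) (simp_all add: lead_mult sec_mult lead_dir sec_dir)
qed

text \<open>The square of ac is \<open>(da, ad)_1\<close>, whose entries have trivial fourth
  power.\<close>

lemma rot_gc_pow: "(rot \<otimes> gc) [^] (8::nat) = \<one>"
proof -
  let ?F = "\<lambda>x::nat. if x = 0 then gd \<otimes> rot else rot \<otimes> gd"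
  have "(rot \<otimes> gc) \<otimes> (rot \<otimes> gc) = dir ?F"
    by (rule two_sec_eqI) (simp_all add: lead_mult sec_mult lead_dir sec_dir)
  then have "(rot \<otimes> gc) [^] (2::nat) = dir ?F" by (simp add: pow_two)
  then have "((rot \<otimes> gc) [^] (2::nat)) [^] (4::nat) = dir (\<lambda>x. ?F x [^] (4::nat))" by (simp add: dir_pow)
  also have "\<dots> = dir (\<lambda>_. \<one>)" by (rule dir_eqI) (simp add: rot_gd_pow)
  finally show ?thesis by (simp add: nat_pow_pow dir_one)
qed

definition "S = {rot, gb, gc, gd}"
definition "C = generate A S"

lemma gens_in: "rot \<in> C" "gb \<in> C" "gc \<in> C" "gd \<in> C"
  by (auto simp: C_def S_def intro: generate.incl)

sublocale rot_group 2 A S C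
proof
  show "finite S" "S \<subseteq> carrier A" by (auto simp: S_def)
  then have sub: "subgroup C A" unfolding C_def by (simp add: generate_is_subgroup)
  show "sec x s \<in> C" if "s \<in> S" "x < 2" for s x
    using that gens_in sub by (auto simp: S_def less_2_cases_iff subgroup.one_closed)
  have *: "\<exists>h\<in>C. lead h 0 = 0 \<and> sec 0 h = sec (Suc 0) g" if "g \<in> {gb, gc, gd}" for g
  proof (rule bexI[of _ "rot \<otimes> g \<otimes> rot"])
    show "lead (rot \<otimes> g \<otimes> rot) 0 = 0 \<and> sec 0 (rot \<otimes> g \<otimes> rot) = sec (Suc 0) g"
      using that by (auto simp: lead_mult sec_mult)
    show "rot \<otimes> g \<otimes> rot \<in> C" using that gens_in sub by (auto simp: subgroup.m_closed)
  qed
  have "\<exists>h\<in>C. lead h 0 = 0 \<and> sec 0 h = rot" using gens_in by (intro bexI[of _ gb]) auto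
  then show "\<exists>h\<in>C. lead h 0 = 0 \<and> sec 0 h = s" if "s \<in> S" for s
    using that *[of gb] *[of gc] *[of gd] by (auto simp: S_def)
qed (use gens_in C_def in auto)

text \<open>Dropping c = bd leaves a triple of the shape of \<open>finite_dihedral\<close>: modulo
  [b, a] the generator b becomes central, and a, d are the two involutions.\<close>

lemma C_generated: "C = generate A {gb, rot, gd}"
proof
  have "gb \<otimes> gd \<in> generate A {gb, rot, gd}" by (intro generate.eng generate.incl) auto
  then have "S \<subseteq> generate A {gb, rot, gd}" using klein(4) by (auto simp: S_def intro: generate.incl)
  then show "C \<subseteq> generate A {gb, rot, gd}"
    unfolding C_def by (intro generate_subgroup_incl generate_is_subgroup) auto
  show "generate A {gb, rot, gd} \<subseteq> C" unfolding C_def by (rule mono_generate) (auto simp: S_def)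
qed

text \<open>As a and b are involutions, this commutator is (ba)^2; its normal closure is the usual
  subgroup over which the Grigorchuk group is regular branch.\<close>

definition "X = {commutator A gb rot}"
definition "Q = generate A {rot, gc}"

lemma X_subset: "X \<subseteq> C"
  using gens_in by (simp add: X_def)

lemma finite_Q: "finite Q"
proof -
  have "finite (generate A {\<one>, rot, gc})"
    by (rule finite_dihedral[of _ _ _ 8]) (simp_all add: rot_gc_pow rot_rot klein)
  moreover have "Q \<subseteq> generate A {\<one>, rot, gc}" unfolding Q_def by (rule mono_generate) auto
  ultimately show ?thesis using finite_subset by blast
qed

text \<open>In the quotient, \<open>b\<close> commutes with \<open>a\<close> and \<open>d\<close>.  The commutator of \<open>d = (1, b)\<^sub>1\<close> and
  \<open>aba = (c, a)\<^sub>1\<close> is \<open>(1, [b, a])\<^sub>1\<close>.\<close>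

lemma closure_finite_index: "finite_index \<Gamma> (normal_closure X)"
  and closure_emb: "X \<subseteq> emb_preimage (normal_closure X)"
proof -
  have norm: "normal_in (normal_closure X)" by (rule normal_closure_normal[OF X_subset])
  obtain H :: "(nat list \<Rightarrow> nat list) set monoid" and \<pi> where
    "quotient_map A H C \<pi>" and ker': "\<forall>g\<in>C. \<pi> g = \<one>\<^bsub>H\<^esub> \<longleftrightarrow> g \<in> normal_closure X"
    and fin: "finite (carrier H) \<longrightarrow> finite_index \<Gamma> (normal_closure X)"
    by (rule quotient[OF norm], rule that)
  interpret q: quotient_map A H C \<pi> by fact
  have ker: "\<pi> g = \<one>\<^bsub>H\<^esub> \<longleftrightarrow> g \<in> normal_closure X" if "g \<in> C" for g using ker' that by blast
  have "\<pi> (commutator A gb rot) = \<one>\<^bsub>H\<^esub>"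
    using normal_closure_incl[OF X_subset] gens_in by (simp add: ker X_def)
  then have ba: "\<pi> gb \<otimes>\<^bsub>H\<^esub> \<pi> rot = \<pi> rot \<otimes>\<^bsub>H\<^esub> \<pi> gb"
    using gens_in by (simp add: q.map_commutator q.H.commutator_eq_one_iff)
  have bd: "\<pi> gb \<otimes>\<^bsub>H\<^esub> \<pi> gd = \<pi> gd \<otimes>\<^bsub>H\<^esub> \<pi> gb"
    using gens_in klein by (simp add: q.map_mult[symmetric])
  have sq: "\<pi> g \<otimes>\<^bsub>H\<^esub> \<pi> g = \<one>\<^bsub>H\<^esub>" if "g \<in> C" "g \<otimes> g = \<one>" for g
    using that by (simp add: q.map_mult[symmetric] q.map_one)
  have "finite (generate H {\<pi> gb, \<pi> rot, \<pi> gd})"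
  proof (rule q.H.finite_dihedral[of _ _ _ 4])
    show "(\<pi> rot \<otimes>\<^bsub>H\<^esub> \<pi> gd) [^]\<^bsub>H\<^esub> (4::nat) = \<one>\<^bsub>H\<^esub>"
      using gens_in rot_gd_pow(1) by (simp add: q.map_mult[symmetric] q.map_pow[symmetric] q.map_one)
  qed (use gens_in ba bd sq klein rot_rot in simp_all)
  then show "finite_index \<Gamma> (normal_closure X)"
    using q.map_generate[OF C_generated] fin by simp
  have "commutator A gd (rot \<otimes> gb \<otimes> rot) = emb 1 (commutator A gb rot)"
  proof -
    have "gd = dir (\<lambda>x. if x = 0 then \<one> else gb)"
      by (rule two_sec_eqI) (simp_all add: lead_dir sec_dir)
    moreover have "rot \<otimes> gb \<otimes> rot = dir (\<lambda>x. if x = 0 then gc else rot)"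
      by (rule two_sec_eqI) (simp_all add: lead_mult sec_mult lead_dir sec_dir)
    ultimately have "commutator A gd (rot \<otimes> gb \<otimes> rot) =
        dir (\<lambda>x. commutator A (if x = 0 then \<one> else gb) (if x = 0 then gc else rot))"
      using dir_commutator[of "\<lambda>x. if x = 0 then \<one> else gb" "\<lambda>x. if x = 0 then gc else rot"] by simp
    also have "\<dots> = emb 1 (commutator A gb rot)"
      unfolding emb_def by (rule dir_eqI) (auto simp: less_2_cases_iff commutator_eq_one_iff)
    finally show ?thesis .
  qed
  moreover have "\<pi> (commutator A gd (rot \<otimes> gb \<otimes> rot)) = \<one>\<^bsub>H\<^esub>"
  proof -
    have "\<pi> (rot \<otimes> gb \<otimes> rot) = \<pi> gb \<otimes>\<^bsub>H\<^esub> (\<pi> rot \<otimes>\<^bsub>H\<^esub> \<pi> rot)"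
      using gens_in ba by (simp add: q.map_mult q.H.m_assoc[symmetric])
    then have "\<pi> (rot \<otimes> gb \<otimes> rot) = \<pi> gb" using sq[OF gens_in(1) rot_rot] gens_in by simp
    then show ?thesis using gens_in bd by (simp add: q.map_commutator q.H.commutator_eq_one_iff)
  qed
  moreover from this have "commutator A gd (rot \<otimes> gb \<otimes> rot) \<in> normal_closure X"
    by (subst ker[symmetric]) (use gens_in in simp_all)
  ultimately have "emb 1 (commutator A gb rot) \<in> normal_closure X" by simp
  then show "X \<subseteq> emb_preimage (normal_closure X)"
    using emb_rot_iff[OF norm, of 1] gens_in by (simp add: X_def emb_preimage_def)
qed

lemma branching: "branching_group 2 A S C (normal_closure X) Q"
proof (rule branching_group_normal_closure[OF X_subset closure_emb closure_finite_index])
  show "subgroup Q A" unfolding Q_def by (rule generate_is_subgroup) simp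
  show "Q \<subseteq> C" unfolding Q_def by (rule generate_subgroup_incl[OF _ C]) (use gens_in in auto)
  show "finite Q" by (rule finite_Q)
  show "rot \<in> Q" by (auto simp: Q_def intro: generate.incl)
  fix M assume M: "subgroup M A" "Q \<subseteq> M" "\<And>g. g \<in> C \<Longrightarrow> (\<And>w. w \<in> T \<Longrightarrow> g (0 # w) = 0 # w) \<Longrightarrow> g \<in> M"
  have "gd \<in> M" using M(3)[OF gens_in(4)] by (simp add: apply_gens)
  moreover have "rot \<in> M" "gc \<in> M" using M(2) by (auto simp: Q_def intro: generate.incl)
  moreover have "gc \<otimes> gd = gb"
    unfolding klein(4)[symmetric] by (simp add: m_assoc klein(3))
  ultimately show "S \<subseteq> M" using subgroup.m_closed[OF M(1), of gc gd] by (simp add: S_def)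
qed

end

section \<open>GGS groups\<close>

locale ggs = regular_tree_auts p A for p and A (structure) +
  fixes E :: "nat list"
  assumes prime: "prime p" and E: "defining_vector p E" and nonzero: "\<exists>\<epsilon>\<in>set E. \<epsilon> \<noteq> 0"
begin

lemma p_pos: "0 < p" "1 < p"
  using prime prime_gt_0_nat prime_gt_1_nat by blast+

definition "gb = restrict (ggs_b p E) T"

lemma rot_eq: "w \<in> T \<Longrightarrow> rot w = ggs_a p w"
  by (simp add: rot_def)

lemma funpow_rot: "w \<in> T \<Longrightarrow> (ggs_a p ^^ k) w = (rot [^] k) w"
proof (induction k)
  case (Suc k)
  have "(rot [^] Suc k) w = (rot \<otimes> rot [^] k) w" using nat_pow_Suc2[OF rot_closed] by simp
  also have "\<dots> = rot ((rot [^] k) w)" using Suc.prems by (simp add: mult_apply)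
  also have "\<dots> = ggs_a p ((rot [^] k) w)"
    using Suc.prems by (intro rot_eq) simp
  finally show ?case using Suc by simp
qed simp

lemma ggs_b_rot:
  assumes "x < p" "w \<in> T"
  shows "ggs_b p E (x # w) = x # (if x < p - 1 then (rot [^] (E ! x)) w else ggs_b p E w)"
  using assms by (simp add: funpow_rot)

lemma ggs_b_in: "w \<in> T \<Longrightarrow> ggs_b p E w \<in> T"
  by (induction w) (simp_all add: ggs_b_rot del: ggs_b.simps(2))

lemma gb_closed [simp]: "gb \<in> carrier A"
  unfolding carrier_eq
proof (rule regular_tree_autI)
  have "u = v" if "u \<in> T" "v \<in> T" "ggs_b p E u = ggs_b p E v" for u v
    using that
  proof (induction u arbitrary: v)
    case Nil
    then show ?case by (cases v) auto
  next
    case (Cons x u)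
    then obtain y w where v: "v = y # w" by (cases v) auto
    have uw: "x < p" "u \<in> T" "y < p" "w \<in> T" using Cons.prems v by simp_all
    have xy: "x = y" using Cons.prems(3) v uw by (simp add: ggs_b_rot del: ggs_b.simps(2))
    show ?case
    proof (cases "x < p - 1")
      case True
      then have "(rot [^] (E ! x)) u = (rot [^] (E ! x)) w"
        using Cons.prems(3) v uw xy by (simp add: ggs_b_rot del: ggs_b.simps(2))
      then show ?thesis using uw v xy apply_inj[of "rot [^] (E ! x)" u w] by simp
    next
      case False
      then have "ggs_b p E u = ggs_b p E w"
        using Cons.prems(3) v uw xy by (simp add: ggs_b_rot del: ggs_b.simps(2))
      then show ?thesis using Cons.IH uw v xy by simp
    qed
  qed
  then show "inj_on gb T" by (auto simp: inj_on_def gb_def)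
  have len: "length (ggs_b p E u) = length u" if "u \<in> T" for u
    using that by (induction u) (simp_all add: ggs_b_rot del: ggs_b.simps(2))
  have take: "take n (ggs_b p E u) = ggs_b p E (take n u)" if "u \<in> T" for u n
    using that
  proof (induction u arbitrary: n)
    case (Cons x u)
    then show ?case by (cases n) (simp_all add: ggs_b_rot apply_take del: ggs_b.simps(2))
  qed simp
  fix u n assume "u \<in> T"
  then show "gb u \<in> T" "length (gb u) = length u" "take n (gb u) = gb (take n u)"
    using len take ggs_b_in by (simp_all add: gb_def)
qed (simp add: gb_def)

text \<open>\<open>sv i\<close> is the entry \<open>\<epsilon>\<^sub>i\<close> of the defining vector, as the automorphism \<open>a\<^sup>\<epsilon>\<^sup>i\<close>, with the
  index read modulo \<open>p\<close> and with \<open>b\<close> at the index \<open>0\<close>.  The \<open>\<beta> t\<close> are the conjugates of \<open>b\<close> by the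
  powers of \<open>a\<close>; the entry \<open>b\<close> of \<open>\<beta> t\<close> is at the letter \<open>t\<close>.\<close>

definition eps :: "int \<Rightarrow> nat" where
  "eps i = E ! (nat (i mod int p) - 1)"

definition sv :: "int \<Rightarrow> nat list \<Rightarrow> nat list" where
  "sv i = (if int p dvd i then gb else rot [^] eps i)"

definition \<beta> :: "int \<Rightarrow> nat list \<Rightarrow> nat list" where
  "\<beta> t = dir (\<lambda>x. sv (int x - t))"

lemma sv_closed [simp]: "sv i \<in> carrier A"
  by (simp add: sv_def)

lemma \<beta>_closed [simp]: "\<beta> t \<in> carrier A"
  by (simp add: \<beta>_def)

lemma sv_cong: "i mod int p = j mod int p \<Longrightarrow> sv i = sv j"
  by (simp add: sv_def eps_def dvd_eq_mod_eq_0)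

lemma \<beta>_cong:
  assumes "s mod int p = t mod int p"
  shows "\<beta> s = \<beta> t"
  unfolding \<beta>_def by (rule dir_eqI, rule sv_cong) (metis assms mod_diff_right_eq)

lemma eps_less: "\<not> int p dvd i \<Longrightarrow> eps i < p"
proof -
  assume i: "\<not> int p dvd i"
  have "i mod int p \<noteq> 0" "0 \<le> i mod int p" "i mod int p < int p"
    using i p_pos by (simp_all add: dvd_eq_mod_eq_0)
  then have "nat (i mod int p) - 1 < length E" using E by (simp add: defining_vector_def)
  then show "eps i < p" using E nth_mem by (simp add: eps_def defining_vector_def)
qed

lemma eps_of_nat: "x < p - 1 \<Longrightarrow> \<not> int p dvd int x + 1 \<and> eps (int x + 1) = E ! x"
proof -
  assume x: "x < p - 1"
  then have "(int x + 1) mod int p = int x + 1" by simp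
  then show ?thesis by (auto simp: dvd_eq_mod_eq_0 eps_def nat_add_distrib)
qed

text \<open>Letters start at 0, so the entry of b at the letter \<open>x\<close> has index
  \<open>x + 1\<close>, and the entry b itself stands at the letter \<open>p - 1\<close>, that is -1
  modulo \<open>p\<close>.\<close>

lemma gb_eq_\<beta>: "gb = \<beta> (-1)"
proof (rule apply_eqI)
  fix u assume u: "u \<in> T"
  show "gb u = \<beta> (-1) u"
  proof (cases u)
    case (Cons x w)
    then have xw: "x < p" "w \<in> T" using u by auto
    have "gb (x # w) = x # sv (int x + 1) w"
    proof (cases "x < p - 1")
      case True
      then show ?thesis
        using xw eps_of_nat[OF True] by (simp add: gb_def ggs_b_rot sv_def del: ggs_b.simps(2))
    next
      case False
      then have "int x + 1 = int p" using xw by simp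
      then show ?thesis
        using xw False by (simp add: gb_def ggs_b_rot sv_def del: ggs_b.simps(2))
    qed
    then show ?thesis using Cons xw by (simp add: \<beta>_def dir_apply)
  qed simp
qed simp_all

lemma
  assumes "x < p"
  shows lead_\<beta>: "lead (\<beta> t) x = x" and sec_\<beta>: "sec x (\<beta> t) = sv (int x - t)"
  using assms by (simp_all add: \<beta>_def lead_dir sec_dir)

lemma \<beta>_apply: "x < p \<Longrightarrow> w \<in> T \<Longrightarrow> \<beta> t (x # w) = x # sv (int x - t) w"
  by (simp add: \<beta>_def dir_apply)

lemma \<beta>_shift: "rot [^] n \<otimes> \<beta> t \<otimes> inv (rot [^] n) = \<beta> (t + int n)"
proof -
  have "rot [^] n \<otimes> \<beta> t = \<beta> (t + int n) \<otimes> rot [^] n"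
  proof (rule sec_eqI)
    fix x assume x: "x < p"
    have y: "(x + n) mod p < p" using p_pos by simp
    show "lead (rot [^] n \<otimes> \<beta> t) x = lead (\<beta> (t + int n) \<otimes> rot [^] n) x"
      using x y by (simp add: lead_mult lead_\<beta> lead_rot_pow)
    have "(int ((x + n) mod p) - (t + int n)) mod int p = (int x - t) mod int p"
      by (simp add: zmod_int mod_diff_left_eq)
    then have "sv (int ((x + n) mod p) - (t + int n)) = sv (int x - t)" by (rule sv_cong)
    then show "sec x (rot [^] n \<otimes> \<beta> t) = sec x (\<beta> (t + int n) \<otimes> rot [^] n)"
      using x y by (simp add: sec_mult lead_\<beta> sec_\<beta> lead_rot_pow)
  qed simp_all
  then show ?thesis by (simp add: m_assoc)
qed

lemma \<beta>_conj: "rot [^] nat ((t - s) mod int p) \<otimes> \<beta> s \<otimes> inv (rot [^] nat ((t - s) mod int p)) = \<beta> t"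
  unfolding \<beta>_shift
proof (rule \<beta>_cong)
  show "(s + int (nat ((t - s) mod int p))) mod int p = t mod int p"
    using p_pos by (simp add: mod_add_right_eq)
qed

text \<open>Each section of the power is the p-th power of a rotation, hence trivial, or of b
  itself; induction on the word finishes.\<close>

lemma gb_pow: "gb [^] p = \<one>"
proof (rule apply_eqI)
  have eq: "gb [^] p = dir (\<lambda>x. sv (int x + 1) [^] p)"
    by (subst (1) gb_eq_\<beta>) (simp add: \<beta>_def dir_pow)
  have rot_p: "(rot [^] k) [^] p = \<one>" for k :: nat
    using rot_pow_d by (simp add: nat_pow_pow mult.commute[of k] nat_pow_pow[symmetric] nat_pow_one)
  show "(gb [^] p) u = \<one> u" if "u \<in> T" for u
    using that
  proof (induction u)
    case (Cons x w)
    then have "(gb [^] p) (x # w) = x # (sv (int x + 1) [^] p) w" by (subst eq) (simp add: dir_apply)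
    then show ?case using Cons by (simp add: sv_def rot_p)
  qed simp
qed simp_all

definition "S = {rot, gb}"
definition "C = generate A S"

lemma gens_in: "rot \<in> C" "gb \<in> C"
  by (auto simp: C_def S_def intro: generate.incl)

lemma subgroup_C: "subgroup C A"
  unfolding C_def by (rule generate_is_subgroup) (simp add: S_def)

lemma \<beta>_in_subgroup:
  assumes "subgroup M A" "rot \<in> M" "\<beta> s \<in> M"
  shows "\<beta> t \<in> M"
proof -
  show ?thesis
    using \<beta>_conj[of t s] assms subgroup_pow[OF assms(1,2)]
    by (metis subgroup.m_closed subgroup.m_inv_closed)
qed

lemma \<beta>_in: "\<beta> t \<in> C"
  using \<beta>_in_subgroup[OF subgroup_C gens_in(1), of "-1"] gens_in(2) gb_eq_\<beta> by simp

lemma exists_nonzero: "\<exists>m. \<not> int p dvd m \<and> eps m \<noteq> 0"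
proof -
  obtain x where "x < length E" "E ! x \<noteq> 0" using nonzero by (auto simp: in_set_conv_nth)
  then show ?thesis using eps_of_nat[of x] E by (auto simp: defining_vector_def)
qed

lemma eps_not_dvd: "\<not> int p dvd m \<Longrightarrow> eps m \<noteq> 0 \<Longrightarrow> \<not> p dvd eps m"
  using eps_less nat_dvd_not_less by blast

sublocale rot_group p A S C
proof
  show "finite S" "S \<subseteq> carrier A" by (auto simp: S_def)
  have sv_in: "sv i \<in> C" for i
    using gens_in by (simp add: sv_def subgroup_pow[OF subgroup_C])
  show "sec x s \<in> C" if "s \<in> S" "x < p" for s x
  proof (cases "s = rot")
    case True
    then show ?thesis using that subgroup_C by (simp add: sec_rot subgroup.one_closed)
  next
    case False
    then have "s = \<beta> (-1)" using that gb_eq_\<beta> by (simp add: S_def)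
    then show ?thesis using sec_\<beta>[OF that(2), of "-1"] sv_in by simp
  qed
  show "\<exists>h\<in>C. lead h 0 = 0 \<and> sec 0 h = s" if "s \<in> S" for s
  proof (cases "s = rot")
    case True
    \<comment> \<open>The conjugate \<open>\<beta> (-m)\<close> has the entry \<open>sv m\<close> at
      0, a nontrivial power of a; a suitable power of this conjugate then has the section a
      itself.\<close>
    obtain m where m: "\<not> int p dvd m" "eps m \<noteq> 0" using exists_nonzero by blast
    obtain n where n: "[eps m * n = 1] (mod p)"
      using prime_cong_solve[OF prime eps_not_dvd[OF m]] by blast
    have eq: "\<beta> (-m) [^] n = dir (\<lambda>x. sv (int x + m) [^] n)" by (simp add: \<beta>_def dir_pow)
    have "sv m [^] n = rot [^] (1::nat)"
      using m pow_pow_inverse_mod[OF rot_closed rot_pow_d n] by (simp add: sv_def)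
    then have "lead (\<beta> (-m) [^] n) 0 = 0 \<and> sec 0 (\<beta> (-m) [^] n) = s"
      unfolding eq using p_pos True by (simp add: lead_dir sec_dir)
    moreover have "\<beta> (-m) [^] n \<in> C" by (rule subgroup_pow[OF subgroup_C \<beta>_in])
    ultimately show ?thesis by blast
  next
    case False
    then have "s = sv 0" using that by (simp add: S_def sv_def)
    then show ?thesis using \<beta>_in[of 0] p_pos by (intro bexI[of _ "\<beta> 0"]) (simp_all add: lead_\<beta> sec_\<beta>)
  qed
qed (use p_pos gens_in C_def in auto)

definition "z = commutator A gb rot"

lemma z_in: "z \<in> C"
  using gens_in by (simp add: z_def)

text \<open>If \<open>z = [b, a]\<close> is central modulo \<open>N\<close>, then the conjugates of \<open>b\<close> by powers of \<open>a\<close> differ from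
  \<open>b\<close> by powers of \<open>z\<close>.\<close>

lemma z_central:
  assumes N: "normal_in N" "commutator A z rot \<in> N" "commutator A z gb \<in> N"
  shows "finite_index \<Gamma> N" "commutator A (\<beta> s) (\<beta> t) \<in> N"
proof -
  obtain H :: "(nat list \<Rightarrow> nat list) set monoid" and \<pi> where
    "quotient_map A H C \<pi>" and ker': "\<forall>g\<in>C. \<pi> g = \<one>\<^bsub>H\<^esub> \<longleftrightarrow> g \<in> N"
    and fin: "finite (carrier H) \<longrightarrow> finite_index \<Gamma> N"
    by (rule quotient[OF N(1)], rule that)
  interpret q: quotient_map A H C \<pi> by fact
  have ker: "\<pi> g = \<one>\<^bsub>H\<^esub> \<longleftrightarrow> g \<in> N" if "g \<in> C" for g using ker' that by blast
  have z: "\<pi> z = commutator H (\<pi> gb) (\<pi> rot)" using gens_in by (simp add: z_def q.map_commutator)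
  have comm: "\<pi> z \<otimes>\<^bsub>H\<^esub> \<pi> g = \<pi> g \<otimes>\<^bsub>H\<^esub> \<pi> z" if "g \<in> C" "commutator A z g \<in> N" for g
    using that z_in ker[of "commutator A z g"]
    by (simp add: q.map_commutator q.H.commutator_eq_one_iff)
  note zc = z comm[OF gens_in(1) N(2)] comm[OF gens_in(2) N(3)]
  have "finite (carrier H)"
  proof (rule q.H.finite_class_two[OF _ _ _ p_pos(1) _ _ zc])
    have "carrier H = generate H (\<pi> ` S)" by (rule q.map_generate[OF C_def]) (simp add: S_def)
    then show "carrier H = generate H {\<pi> rot, \<pi> gb}" by (simp add: S_def)
    show "\<pi> rot [^]\<^bsub>H\<^esub> p = \<one>\<^bsub>H\<^esub>" "\<pi> gb [^]\<^bsub>H\<^esub> p = \<one>\<^bsub>H\<^esub>"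
      using gens_in gb_pow rot_pow_d by (simp_all add: q.map_pow[symmetric] q.map_one)
  qed (use gens_in in simp_all)
  then show "finite_index \<Gamma> N" using fin by blast
  have "\<exists>n::nat. \<pi> (\<beta> t) = \<pi> rot [^]\<^bsub>H\<^esub> n \<otimes>\<^bsub>H\<^esub> \<pi> gb \<otimes>\<^bsub>H\<^esub> inv\<^bsub>H\<^esub> (\<pi> rot [^]\<^bsub>H\<^esub> n)" for t
    unfolding \<beta>_conj[of t "-1", symmetric] gb_eq_\<beta>[symmetric]
    using gens_in by (auto simp: q.map_mult q.map_inv q.map_pow)
  then have "commutator H (\<pi> (\<beta> s)) (\<pi> (\<beta> t)) = \<one>\<^bsub>H\<^esub>"
    using q.H.conjugates_commute[OF _ _ zc] gens_in by (metis q.map_closed)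
  then show "commutator A (\<beta> s) (\<beta> t) \<in> N"
    using ker[of "commutator A (\<beta> s) (\<beta> t)"] \<beta>_in by (simp add: q.map_commutator)
qed

lemma commutator_in_normal:
  assumes "normal_in N" "k \<in> N" "g \<in> C"
  shows "commutator A k g \<in> N"
proof -
  have k: "k \<in> C" "inv k \<in> N" using assms by (auto simp: normal_in_def subgroup.m_inv_closed)
  then have "k \<otimes> (g \<otimes> inv k \<otimes> inv g) \<in> N"
    using assms by (simp add: normal_in_def subgroup.m_closed)
  then show ?thesis using k assms(3) by (simp add: commutator_def m_assoc)
qed

lemma finite_Q: "finite (generate A {rot})"
proof -
  have "generate A {rot} \<subseteq> range (\<lambda>n::nat. rot [^] n)"
  proof (rule generate_subset_of_closed)
    show "\<one> \<in> range (\<lambda>n::nat. rot [^] n)" by (rule image_eqI[of _ _ 0]) simp_all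
    show "s \<otimes> f \<in> range (\<lambda>n::nat. rot [^] n)" if "s \<in> {rot}" "f \<in> range (\<lambda>n::nat. rot [^] n)" for s f
    proof -
      obtain n :: nat where "f = rot [^] n" using \<open>f \<in> _\<close> by blast
      then have "s \<otimes> f = rot [^] Suc n" using \<open>s \<in> _\<close> nat_pow_Suc2[OF rot_closed, of n] by simp
      then show ?thesis by blast
    qed
    show "\<exists>n>0. s [^] (n::nat) = \<one>" if "s \<in> {rot}" for s
      using that rot_pow_d p_pos by (intro exI[of _ p]) simp
  qed auto
  then show ?thesis using finite_powers[OF rot_closed rot_pow_d p_pos(1)] finite_subset by blast
qed

lemma branching_group_ggs:
  assumes X: "X \<subseteq> C" "X \<subseteq> emb_preimage (normal_closure X)" "finite_index \<Gamma> (normal_closure X)"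
    and gen: "\<And>M. subgroup M A \<Longrightarrow> rot \<in> M \<Longrightarrow>
      (\<And>g. g \<in> C \<Longrightarrow> (\<And>w. w \<in> T \<Longrightarrow> g (0 # w) = 0 # w) \<Longrightarrow> g \<in> M) \<Longrightarrow> \<exists>t. \<beta> t \<in> M"
  shows "branching_group p A S C (normal_closure X) (generate A {rot})"
proof (rule branching_group_normal_closure[OF X])
  show "subgroup (generate A {rot}) A" by (rule generate_is_subgroup) simp
  show "generate A {rot} \<subseteq> C" by (rule generate_subgroup_incl[OF _ C]) (use gens_in in auto)
  show "finite (generate A {rot})" by (rule finite_Q)
  show rot: "rot \<in> generate A {rot}" by (auto intro: generate.incl)
  fix M assume M: "subgroup M A" "generate A {rot} \<subseteq> M"
    "\<And>g. g \<in> C \<Longrightarrow> (\<And>w. w \<in> T \<Longrightarrow> g (0 # w) = 0 # w) \<Longrightarrow> g \<in> M"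
  have "rot \<in> M" using M(2) rot by blast
  moreover obtain t where "\<beta> t \<in> M" using gen[OF M(1) \<open>rot \<in> M\<close> M(3)] by blast
  ultimately show "S \<subseteq> M"
    using \<beta>_in_subgroup[OF M(1), of t "-1"] by (simp add: S_def gb_eq_\<beta>)
qed

end

subsection \<open>Defining vectors with a zero entry\<close>

locale ggs_zero = ggs +
  assumes zero: "0 \<in> set E"
begin

lemma exists_zero: "\<exists>i. \<not> int p dvd i \<and> eps i = 0"
proof -
  obtain x where "x < length E" "E ! x = 0" using zero by (auto simp: in_set_conv_nth)
  then show ?thesis using eps_of_nat[of x] E by (auto simp: defining_vector_def)
qed

text \<open>These elements normally generate the third term of the lower central series, since
  \<open>z = [b, a]\<close> normally generates the second.\<close>

definition "X = {commutator A z rot, commutator A z gb}"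

lemma X_subset: "X \<subseteq> C"
  using gens_in z_in by (simp add: X_def)

abbreviation "K \<equiv> normal_closure X"

lemma K_normal: "normal_in K"
  by (rule normal_closure_normal[OF X_subset])

lemma finite_index_K: "finite_index \<Gamma> K"
  and commutator_\<beta>_in_K: "commutator A (\<beta> s) (\<beta> t) \<in> K"
  using z_central[OF K_normal] normal_closure_incl[OF X_subset] by (simp_all add: X_def)

text \<open>Coordinates of commutators of the \<open>\<beta> t\<close> contain powers of a given by
  the defining vector, not a itself. Since these exponents are units modulo \<open>p\<close>,
  \<open>commutator_central\<close> recovers the relations for a.\<close>

lemma X_in_normal:
  assumes N: "normal_in N" and e: "\<not> p dvd e" "\<not> p dvd f" "\<not> p dvd e'"
    and rel: "commutator A (commutator A gb (rot [^] (e::nat))) (rot [^] (f::nat)) \<in> N"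
      "commutator A (commutator A gb (rot [^] (e'::nat))) gb \<in> N"
  shows "X \<subseteq> N"
proof -
  obtain H :: "(nat list \<Rightarrow> nat list) set monoid" and \<pi> where
    "quotient_map A H C \<pi>" and ker': "\<forall>g\<in>C. \<pi> g = \<one>\<^bsub>H\<^esub> \<longleftrightarrow> g \<in> N"
    and fin: "finite (carrier H) \<longrightarrow> finite_index \<Gamma> N"
    by (rule quotient[OF N], rule that)
  interpret q: quotient_map A H C \<pi> by fact
  have ker: "\<pi> g = \<one>\<^bsub>H\<^esub> \<longleftrightarrow> g \<in> N" if "g \<in> C" for g using ker' that by blast
  have comm: "\<pi> (commutator A g h) = \<one>\<^bsub>H\<^esub> \<longleftrightarrow> \<pi> g \<otimes>\<^bsub>H\<^esub> \<pi> h = \<pi> h \<otimes>\<^bsub>H\<^esub> \<pi> g"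
    if "g \<in> C" "h \<in> C" for g h
    using that by (simp add: q.map_commutator q.H.commutator_eq_one_iff)
  have "\<pi> rot [^]\<^bsub>H\<^esub> p = \<one>\<^bsub>H\<^esub>"
    using gens_in rot_pow_d by (simp add: q.map_pow[symmetric] q.map_one)
  moreover have "\<pi> (commutator A gb (rot [^] e)) \<otimes>\<^bsub>H\<^esub> \<pi> (rot [^] f) =
      \<pi> (rot [^] f) \<otimes>\<^bsub>H\<^esub> \<pi> (commutator A gb (rot [^] e))"
    by (rule comm[THEN iffD1]) (use rel(1) ker gens_in in simp_all)
  moreover have "\<pi> (commutator A gb (rot [^] e')) \<otimes>\<^bsub>H\<^esub> \<pi> gb =
      \<pi> gb \<otimes>\<^bsub>H\<^esub> \<pi> (commutator A gb (rot [^] e'))"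
    by (rule comm[THEN iffD1]) (use rel(2) ker gens_in in simp_all)
  ultimately have "commutator H (\<pi> gb) (\<pi> rot) \<otimes>\<^bsub>H\<^esub> \<pi> rot = \<pi> rot \<otimes>\<^bsub>H\<^esub> commutator H (\<pi> gb) (\<pi> rot)"
    "commutator H (\<pi> gb) (\<pi> rot) \<otimes>\<^bsub>H\<^esub> \<pi> gb = \<pi> gb \<otimes>\<^bsub>H\<^esub> commutator H (\<pi> gb) (\<pi> rot)"
    using q.H.commutator_central[OF _ _ prime _ e, of "\<pi> rot" "\<pi> gb"] gens_in
    by (simp_all add: q.map_commutator q.map_pow)
  then have "\<pi> z \<otimes>\<^bsub>H\<^esub> \<pi> rot = \<pi> rot \<otimes>\<^bsub>H\<^esub> \<pi> z" "\<pi> z \<otimes>\<^bsub>H\<^esub> \<pi> gb = \<pi> gb \<otimes>\<^bsub>H\<^esub> \<pi> z"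
    using gens_in by (simp_all add: z_def q.map_commutator)
  then show ?thesis
    using comm[OF z_in] ker gens_in z_in by (simp add: X_def)
qed

text \<open>The entries of \<open>[\<beta> 0, \<beta> l]\<close> are trivial except at the letters \<open>0\<close> and \<open>l\<close>.\<close>

lemma commutator_\<beta>: "commutator A (\<beta> 0) (\<beta> l) = dir (\<lambda>x. commutator A (sv (int x)) (sv (int x - l)))"
  unfolding \<beta>_def by (subst dir_commutator) simp_all

lemma sv_commute:
  assumes "\<not> int p dvd i" "\<not> int p dvd j"
  shows "commutator A (sv i) (sv j) = \<one>"
  using assms by (simp add: sv_def commutator_eq_one_iff nat_pow_mult add.commute)

lemma commutator_one [simp]:
  "g \<in> carrier A \<Longrightarrow> commutator A \<one> g = \<one>" "g \<in> carrier A \<Longrightarrow> commutator A g \<one> = \<one>"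
  by (simp_all add: commutator_eq_one_iff)

lemma sv_zero: "int p dvd i - j \<Longrightarrow> \<not> int p dvd j \<Longrightarrow> eps j = 0 \<Longrightarrow> sv i = \<one>"
  using sv_cong[of i j] by (simp add: mod_eq_dvd_iff) (simp add: sv_def)

lemma sv_gb: "int p dvd i \<Longrightarrow> sv i = gb"
  by (simp add: sv_def)

lemma dvd_letter: "x < p \<Longrightarrow> int p dvd int x \<longleftrightarrow> x = 0"
  using nat_dvd_not_less by (auto simp: int_dvd_int_iff)

text \<open>Case of a nonsymmetric zero pattern: \<open>\<epsilon>\<^sub>m \<noteq> 0\<close> and \<open>\<epsilon>\<^sub>-\<^sub>m = 0\<close>, so that \<open>[\<beta> 0, \<beta> (-m)]\<close> has only
  one nontrivial entry.\<close>

lemma preimage_nonsymmetric: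
  assumes m: "\<not> int p dvd m" "eps m \<noteq> 0" "eps (-m) = 0"
  shows "X \<subseteq> emb_preimage K"
proof -
  let ?c = "commutator A gb (rot [^] eps m)"
  have "commutator A (\<beta> 0) (\<beta> (-m)) = emb 0 ?c"
    unfolding commutator_\<beta> emb_def
  proof (rule dir_eqI)
    fix x assume x: "x < p"
    show "commutator A (sv (int x)) (sv (int x - - m)) = (if x = 0 then ?c else \<one>)"
    proof (cases "x = 0 \<or> int p dvd int x + m")
      case True
      then show ?thesis using sv_zero[of "int x" "-m"] m sv_gb[of 0] by (auto simp: sv_def)
    qed (use sv_commute[of "int x" "int x + m"] dvd_letter[OF x] in auto)
  qed
  then have "?c \<in> emb_preimage K" using commutator_\<beta>_in_K[of 0 "-m"] gens_in by (simp add: emb_preimage_def)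
  moreover have N: "normal_in (emb_preimage K)" by (rule emb_preimage_normal[OF K_normal])
  moreover have "\<not> p dvd eps m" using eps_not_dvd m by blast
  moreover have "\<not> p dvd 1" using p_pos by simp
  \<comment> \<open>The single commutator \<open>?c\<close> already lies in the preimage, so both
    double commutators required by \<open>X_in_normal\<close> do as well.\<close>
  ultimately show ?thesis
    using X_in_normal[OF N, of "eps m" 1 "eps m"] commutator_in_normal[OF N] gens_in by simp
qed

text \<open>Otherwise commute \<open>[\<beta> 0, \<beta> l]\<close> with an element whose entry at \<open>l\<close> is trivial, and whose
  entry at \<open>0\<close> is a power of \<open>a\<close> or equal to \<open>b\<close>.\<close>

lemma preimage_symmetric:
  assumes i: "\<not> int p dvd i" "eps i = 0" and m: "\<not> int p dvd m" "eps m \<noteq> 0" "eps (-m) \<noteq> 0"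
    and mi: "\<not> int p dvd m + i" "eps (m + i) \<noteq> 0"
  shows "X \<subseteq> emb_preimage K"
proof -
  have N: "normal_in (emb_preimage K)" by (rule emb_preimage_normal[OF K_normal])
  let ?u = "commutator A gb (rot [^] eps m)" and ?v = "commutator A gb (rot [^] eps (-m))"
  \<comment> \<open>The index \<open>-m-i\<close> makes the entry of the third factor trivial at the
    letter congruent to -m, where its index is congruent to \<open>i\<close>, while at 0 it is the
    nontrivial power with exponent \<open>eps (m + i)\<close>.\<close>
  have "commutator A (commutator A (\<beta> 0) (\<beta> (-m))) (\<beta> (-m-i)) =
      dir (\<lambda>x. commutator A (commutator A (sv (int x)) (sv (int x - - m))) (sv (int x - (-m-i))))"
    unfolding commutator_\<beta> unfolding \<beta>_def by (rule dir_commutator) simp_all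
  also have "\<dots> = emb 0 (commutator A ?u (rot [^] eps (m + i)))"
    unfolding emb_def
  proof (rule dir_eqI)
    fix x assume x: "x < p"
    consider "x = 0" | "x \<noteq> 0" "int p dvd int x + m" | "x \<noteq> 0" "\<not> int p dvd int x + m" by blast
    then show "commutator A (commutator A (sv (int x)) (sv (int x - - m))) (sv (int x - (-m-i))) =
        (if x = 0 then commutator A ?u (rot [^] eps (m + i)) else \<one>)"
    proof cases
      case 1
      then show ?thesis using m mi sv_gb[of 0] by (simp add: sv_def add.commute)
    next
      case 2
      then have "sv (int x - (-m-i)) = \<one>" using sv_zero[of "int x + m + i" i] i by (simp add: algebra_simps)
      then show ?thesis using 2 by simp
    next
      case 3
      then show ?thesis using sv_commute[of "int x" "int x + m"] dvd_letter[OF x] by simp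
    qed
  qed
  finally have 1: "commutator A ?u (rot [^] eps (m + i)) \<in> emb_preimage K"
    using commutator_in_normal[OF K_normal commutator_\<beta>_in_K \<beta>_in, of 0 "-m" "-m-i"] gens_in
    by (simp add: emb_preimage_def)
  \<comment> \<open>\<open>t\<close> is chosen so that
    \<open>\<beta> 0 \<otimes> \<beta> (-i) [^] t\<close> has trivial entry at the letter congruent
    to \<open>m\<close>; its entry at 0 is b because \<open>eps i = 0\<close>.\<close>
  obtain t where t: "[eps (m + i) * t = p - eps m] (mod p)"
    using prime_cong_solve[OF prime eps_not_dvd[OF mi]] by blast
  have "[eps m + eps (m + i) * t = eps m + (p - eps m)] (mod p)" using t by (intro cong_add) simp_all
  then have "(eps m + eps (m + i) * t) mod p = 0" using eps_less[OF m(1)] by (simp add: cong_def)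
  then have "rot [^] (eps m + eps (m + i) * t) = \<one>"
    using pow_mod_eq[OF rot_closed rot_pow_d, of "eps m + eps (m + i) * t"] by simp
  then have l_entry: "rot [^] eps m \<otimes> (rot [^] eps (m + i)) [^] t = \<one>"
    by (simp add: nat_pow_pow nat_pow_mult)
  have w: "\<beta> 0 \<otimes> \<beta> (-i) [^] t = dir (\<lambda>x. sv (int x) \<otimes> sv (int x + i) [^] t)"
    unfolding \<beta>_def by (simp add: dir_pow dir_mult)
  have "commutator A (commutator A (\<beta> 0) (\<beta> m)) (\<beta> 0 \<otimes> \<beta> (-i) [^] t) =
      dir (\<lambda>x. commutator A (commutator A (sv (int x)) (sv (int x - m))) (sv (int x) \<otimes> sv (int x + i) [^] t))"
    unfolding commutator_\<beta> w by (subst dir_commutator) simp_all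
  also have "\<dots> = emb 0 (commutator A ?v gb)"
    unfolding emb_def
  proof (rule dir_eqI)
    fix x assume x: "x < p"
    consider "x = 0" | "x \<noteq> 0" "int p dvd int x - m" | "x \<noteq> 0" "\<not> int p dvd int x - m" by blast
    then show "commutator A (commutator A (sv (int x)) (sv (int x - m))) (sv (int x) \<otimes> sv (int x + i) [^] t) =
        (if x = 0 then commutator A ?v gb else \<one>)"
    proof cases
      case 1
      then show ?thesis using m i sv_gb[of 0] by (simp add: sv_def nat_pow_one)
    next
      case 2
      have "sv (int x) = sv m" "sv (int x + i) = sv (m + i)"
        using 2 by (auto intro!: sv_cong simp: mod_eq_dvd_iff)
      then have "sv (int x) \<otimes> sv (int x + i) [^] t = \<one>" using l_entry m mi by (simp add: sv_def)
      then show ?thesis using 2 by simp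
    next
      case 3
      then show ?thesis using sv_commute[of "int x" "int x - m"] dvd_letter[OF x] by simp
    qed
  qed
  finally have 2: "commutator A ?v gb \<in> emb_preimage K"
    using commutator_in_normal[OF K_normal commutator_\<beta>_in_K, of "\<beta> 0 \<otimes> \<beta> (-i) [^] t" 0 m] gens_in \<beta>_in
    by (simp add: emb_preimage_def)
  show ?thesis
    using X_in_normal[OF N _ _ _ 1 2] eps_not_dvd[OF m(1,2)] eps_not_dvd[OF mi] eps_not_dvd[of "-m"] m by simp
qed

text \<open>The set of zeros is not invariant under the translation by \<open>m\<close>, as it is neither empty nor
  everything.\<close>

lemma closure_emb: "X \<subseteq> emb_preimage K"
proof -
  obtain m where m: "\<not> int p dvd m" "eps m \<noteq> 0" using exists_nonzero by blast
  obtain i where i: "\<not> int p dvd i" "eps i = 0" using exists_zero by blast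
  have eps_mod: "eps a = eps b" if "int p dvd a - b" for a b
    using that by (simp add: eps_def mod_eq_dvd_iff[symmetric])
  show ?thesis
  proof (cases "eps (-m) = 0")
    case True
    then show ?thesis using preimage_nonsymmetric m by blast
  next
    case nz: False
    have "\<exists>j. \<not> int p dvd j \<and> eps j = 0 \<and> \<not> (\<not> int p dvd m + j \<and> eps (m + j) = 0)"
    proof (rule ccontr)
      assume no: "\<not> ?thesis"
      \<comment> \<open>Otherwise the zero at \<open>i\<close> propagates along the progression with
        difference \<open>m\<close>, which never meets the index 0 modulo \<open>p\<close>.\<close>
      have all: "\<not> int p dvd (i + int n * m) \<and> eps (i + int n * m) = 0" for n
      proof (induction n)
        case (Suc n)
        have "i + int (Suc n) * m = m + (i + int n * m)" by (simp add: algebra_simps)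
        then show ?case using no Suc by metis
      qed (use i in simp)
      have "coprime m (int p)"
        using m(1) prime by (metis coprime_commute prime_imp_coprime prime_int_nat_transfer nat_int of_nat_0_le_iff)
      then obtain k where k: "[m * k = 1] (mod int p)" using cong_solve_coprime_int by blast
      \<comment> \<open>With \<open>k\<close> inverse to \<open>m\<close>, this \<open>n\<close>
        solves i + n m = 0 modulo \<open>p\<close>, so the progression does meet 0.\<close>
      define n where "n = nat ((- i * k) mod int p)"
      have "int n = (- i * k) mod int p" using p_pos by (simp add: n_def)
      then have "(i + int n * m) mod int p = (i + (- i * k) * m) mod int p"
        by (metis mod_add_right_eq mod_mult_left_eq)
      also have "\<dots> = (i + (- i) * (m * k)) mod int p" by (simp add: algebra_simps)
      also have "\<dots> = (i + (- i) * 1) mod int p"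
      proof -
        have "[i + (- i) * (m * k) = i + (- i) * 1] (mod int p)"
          using k by (intro cong_add cong_mult cong_refl)
        then show ?thesis by (simp only: cong_def)
      qed
      finally show False using all[of n] by (simp add: dvd_eq_mod_eq_0)
    qed
    then obtain j where j: "\<not> int p dvd j" "eps j = 0" "int p dvd m + j \<or> eps (m + j) \<noteq> 0" by blast
    have "\<not> int p dvd m + j"
    proof
      assume "int p dvd m + j"
      then have "eps j = eps (-m)" by (intro eps_mod) (simp add: add.commute)
      then show False using j nz by simp
    qed
    then show ?thesis using preimage_symmetric[OF j(1,2) m nz] j(3) by blast
  qed
qed

lemma branching: "branching_group p A S C K (generate A {rot})"
proof (rule branching_group_ggs[OF X_subset closure_emb finite_index_K])
  fix M assume M: "\<And>g. g \<in> C \<Longrightarrow> (\<And>w. w \<in> T \<Longrightarrow> g (0 # w) = 0 # w) \<Longrightarrow> g \<in> M"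
  obtain i where i: "\<not> int p dvd i" "eps i = 0" using exists_zero by blast
  have "\<beta> (-i) (0 # w) = 0 # w" if "w \<in> T" for w
    using that i p_pos by (simp add: \<beta>_def dir_apply sv_def)
  then show "\<exists>t. \<beta> t \<in> M" using M[OF \<beta>_in] by blast
qed

end

subsection \<open>The defining vector \<open>(1, -1)\<close>\<close>

locale gupta_sidki = ggs +
  assumes p_eq: "p = 3" and E_eq: "E = [1, 2]"
begin

lemma sv_eq: "sv i = (if i mod 3 = 0 then gb else if i mod 3 = 1 then rot else rot [^] (2::nat))"
proof -
  have "i mod 3 = 0 \<or> i mod 3 = 1 \<or> i mod 3 = 2" by arith
  moreover have "int p dvd i \<longleftrightarrow> i mod 3 = 0" by (simp add: p_eq dvd_eq_mod_eq_0)
  moreover have "eps i = [1, 2] ! (nat (i mod 3) - 1)" unfolding eps_def by (simp add: p_eq E_eq)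
  ultimately show ?thesis unfolding sv_def by auto
qed

lemma rot_cube: "rot \<otimes> rot [^] (2::nat) = \<one>" "rot [^] (2::nat) \<otimes> rot = \<one>"
proof -
  have "rot [^] Suc 2 = \<one>" using rot_pow_d p_eq by simp
  then show "rot \<otimes> rot [^] (2::nat) = \<one>" "rot [^] (2::nat) \<otimes> rot = \<one>"
    using nat_pow_Suc2[OF rot_closed, of 2] nat_pow_Suc[of rot 2] by simp_all
qed

lemma lt3: "x < p \<longleftrightarrow> x = 0 \<or> x = 1 \<or> x = (2::nat)"
  using p_eq by auto

text \<open>Its normal closure is the derived subgroup, because a and b generate the group.\<close>

definition "X = {z}"

lemma X_subset: "X \<subseteq> C"
  using z_in by (simp add: X_def)

abbreviation "K \<equiv> normal_closure X"

lemma K_normal: "normal_in K"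
  by (rule normal_closure_normal[OF X_subset])

lemma z_in_K: "z \<in> K"
  using normal_closure_incl[OF X_subset] by (simp add: X_def)

lemma K_finite_index: "finite_index \<Gamma> K"
  using z_central(1)[OF K_normal] commutator_in_normal[OF K_normal z_in_K] gens_in by simp

text \<open>The first product has trivial entry at 0 and the second at 2, because 1 and -1 cancel
  there. Only the letter 1 keeps two nontrivial entries.\<close>

lemma commutator_emb:
  "commutator A (\<beta> 2 \<otimes> \<beta> 1) (\<beta> 0 \<otimes> \<beta> 1) = emb 1 (commutator A (rot [^] (2::nat) \<otimes> gb) (rot \<otimes> gb))"
proof -
  have "\<beta> 2 \<otimes> \<beta> 1 = dir (\<lambda>x. sv (int x - 2) \<otimes> sv (int x - 1))"
    "\<beta> 0 \<otimes> \<beta> 1 = dir (\<lambda>x. sv (int x) \<otimes> sv (int x - 1))"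
    by (simp_all add: \<beta>_def dir_mult)
  then have "commutator A (\<beta> 2 \<otimes> \<beta> 1) (\<beta> 0 \<otimes> \<beta> 1) =
      dir (\<lambda>x. commutator A (sv (int x - 2) \<otimes> sv (int x - 1)) (sv (int x) \<otimes> sv (int x - 1)))"
    by (simp add: dir_commutator)
  also have "\<dots> = emb 1 (commutator A (rot [^] (2::nat) \<otimes> gb) (rot \<otimes> gb))"
    unfolding emb_def by (rule dir_eqI) (auto simp: lt3 sv_eq rot_cube commutator_eq_one_iff)
  finally show ?thesis .
qed

lemma closure_emb: "X \<subseteq> emb_preimage K"
proof -
  \<comment> \<open>Two quotients occur. Modulo \<open>K\<close> the generators commute, so this
    commutator dies; modulo the preimage of \<open>K\<close> the commutation of a and b has to be
    derived from its one nontrivial coordinate.\<close>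
  have "commutator A (\<beta> 2 \<otimes> \<beta> 1) (\<beta> 0 \<otimes> \<beta> 1) \<in> K"
  proof -
    obtain H :: "(nat list \<Rightarrow> nat list) set monoid" and \<pi> where
      "quotient_map A H C \<pi>" and ker': "\<forall>g\<in>C. \<pi> g = \<one>\<^bsub>H\<^esub> \<longleftrightarrow> g \<in> K"
      and fin: "finite (carrier H) \<longrightarrow> finite_index \<Gamma> K"
      by (rule quotient[OF K_normal], rule that)
    interpret q: quotient_map A H C \<pi> by fact
    have ker: "\<pi> g = \<one>\<^bsub>H\<^esub> \<longleftrightarrow> g \<in> K" if "g \<in> C" for g using ker' that by blast
    have "\<pi> z = \<one>\<^bsub>H\<^esub>" using ker z_in z_in_K by simp
    then have ba: "\<pi> gb \<otimes>\<^bsub>H\<^esub> \<pi> rot = \<pi> rot \<otimes>\<^bsub>H\<^esub> \<pi> gb"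
      using gens_in by (simp add: z_def q.map_commutator q.H.commutator_eq_one_iff)
    have "\<pi> (\<beta> t) = \<pi> gb" for t
    proof -
      let ?n = "nat ((t - (-1)) mod int p)"
      have "\<pi> (\<beta> t) = \<pi> rot [^]\<^bsub>H\<^esub> ?n \<otimes>\<^bsub>H\<^esub> \<pi> gb \<otimes>\<^bsub>H\<^esub> inv\<^bsub>H\<^esub> (\<pi> rot [^]\<^bsub>H\<^esub> ?n)"
        unfolding \<beta>_conj[of t "-1", symmetric] gb_eq_\<beta>[symmetric]
        using gens_in by (simp add: q.map_mult q.map_inv q.map_pow)
      also have "\<dots> = \<pi> gb"
      proof -
        have "\<pi> gb \<otimes>\<^bsub>H\<^esub> \<pi> rot [^]\<^bsub>H\<^esub> ?n = \<pi> rot [^]\<^bsub>H\<^esub> ?n \<otimes>\<^bsub>H\<^esub> \<pi> gb"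
          by (rule q.H.commute_pow[OF _ _ ba]) (use gens_in in simp_all)
        from this[symmetric] show ?thesis using gens_in by (simp add: q.H.m_assoc)
      qed
      finally show ?thesis .
    qed
    then have "\<pi> (commutator A (\<beta> 2 \<otimes> \<beta> 1) (\<beta> 0 \<otimes> \<beta> 1)) = \<one>\<^bsub>H\<^esub>"
      using \<beta>_in gens_in by (simp add: q.map_commutator q.map_mult q.H.commutator_eq_one_iff)
    then show ?thesis using ker \<beta>_in by simp
  qed
  then have "commutator A (rot [^] (2::nat) \<otimes> gb) (rot \<otimes> gb) \<in> emb_preimage K"
    using emb_rot_iff[OF K_normal p_pos(2)] gens_in commutator_emb by (simp add: emb_preimage_def)
  moreover have norm: "normal_in (emb_preimage K)" by (rule emb_preimage_normal[OF K_normal])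
  obtain H :: "(nat list \<Rightarrow> nat list) set monoid" and \<pi> where
    "quotient_map A H C \<pi>" and ker': "\<forall>g\<in>C. \<pi> g = \<one>\<^bsub>H\<^esub> \<longleftrightarrow> g \<in> emb_preimage K"
    and fin: "finite (carrier H) \<longrightarrow> finite_index \<Gamma> (emb_preimage K)"
    by (rule quotient[OF norm], rule that)
  interpret q: quotient_map A H C \<pi> by fact
  have ker: "\<pi> g = \<one>\<^bsub>H\<^esub> \<longleftrightarrow> g \<in> emb_preimage K" if "g \<in> C" for g using ker' that by blast
  let ?a = "\<pi> rot" and ?b = "\<pi> gb"
  have c: "?a \<in> carrier H" "?b \<in> carrier H" using gens_in by simp_all
  have "?a [^]\<^bsub>H\<^esub> (2::nat) \<otimes>\<^bsub>H\<^esub> ?b \<otimes>\<^bsub>H\<^esub> (?a \<otimes>\<^bsub>H\<^esub> ?b) = ?a \<otimes>\<^bsub>H\<^esub> ?b \<otimes>\<^bsub>H\<^esub> (?a [^]\<^bsub>H\<^esub> (2::nat) \<otimes>\<^bsub>H\<^esub> ?b)"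
    using calculation ker[of "commutator A (rot [^] (2::nat) \<otimes> gb) (rot \<otimes> gb)"] gens_in
    by (simp add: q.map_commutator q.map_mult q.map_pow q.H.commutator_eq_one_iff)
  \<comment> \<open>Both sides begin with a and end with ab; cancelling these leaves ab =
    ba.\<close>
  then have "?a \<otimes>\<^bsub>H\<^esub> ((?a \<otimes>\<^bsub>H\<^esub> ?b) \<otimes>\<^bsub>H\<^esub> (?a \<otimes>\<^bsub>H\<^esub> ?b)) = ?a \<otimes>\<^bsub>H\<^esub> ((?b \<otimes>\<^bsub>H\<^esub> ?a) \<otimes>\<^bsub>H\<^esub> (?a \<otimes>\<^bsub>H\<^esub> ?b))"
    using c by (simp add: q.H.pow_two q.H.m_assoc)
  then have "?a \<otimes>\<^bsub>H\<^esub> ?b = ?b \<otimes>\<^bsub>H\<^esub> ?a" using c by simp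
  then have "\<pi> z = \<one>\<^bsub>H\<^esub>" using gens_in c by (simp add: z_def q.map_commutator q.H.commutator_eq_one_iff)
  then show ?thesis using ker z_in by (simp add: X_def)
qed

text \<open>\<open>\<beta> 2 \<beta> 1\<close> and \<open>\<beta> 1 \<beta> 2\<close> have a trivial entry at \<open>0\<close>.  With \<open>a\<close>, they generate all
  \<open>\<beta> i \<beta> j\<close> for \<open>i \<noteq> j\<close>, hence \<open>(\<beta> 0 \<beta> 1) (\<beta> 2 \<beta> 1)\<inverse> (\<beta> 2 \<beta> 0) = (\<beta> 0)\<^sup>2\<close>, which has order \<open>3\<close>.\<close>

lemma branching: "branching_group p A S C K (generate A {rot})"
proof (rule branching_group_ggs[OF X_subset closure_emb K_finite_index])
  fix M assume M: "subgroup M A" "rot \<in> M"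
    "\<And>g. g \<in> C \<Longrightarrow> (\<And>w. w \<in> T \<Longrightarrow> g (0 # w) = 0 # w) \<Longrightarrow> g \<in> M"
  have 1: "\<beta> 2 \<otimes> \<beta> 1 \<in> M" "\<beta> 1 \<otimes> \<beta> 2 \<in> M"
  proof -
    have "(\<beta> 2 \<otimes> \<beta> 1) (0 # w) = 0 # w" "(\<beta> 1 \<otimes> \<beta> 2) (0 # w) = 0 # w" if "w \<in> T" for w
    proof -
      have "(\<beta> 2 \<otimes> \<beta> 1) (0 # w) = 0 # (rot \<otimes> rot [^] (2::nat)) w"
        "(\<beta> 1 \<otimes> \<beta> 2) (0 # w) = 0 # (rot [^] (2::nat) \<otimes> rot) w"
        using that p_pos sv_eq[of "-1"] sv_eq[of "-2"] by (simp_all add: mult_apply \<beta>_apply)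
      then show "(\<beta> 2 \<otimes> \<beta> 1) (0 # w) = 0 # w" "(\<beta> 1 \<otimes> \<beta> 2) (0 # w) = 0 # w"
        using that rot_cube by simp_all
    qed
    then show "\<beta> 2 \<otimes> \<beta> 1 \<in> M" "\<beta> 1 \<otimes> \<beta> 2 \<in> M" using M(3) \<beta>_in by simp_all
  qed
  have shift: "\<beta> (s + int n) \<otimes> \<beta> (t + int n) \<in> M" if "\<beta> s \<otimes> \<beta> t \<in> M" for s t n
  proof -
    have "rot [^] n \<in> M" by (rule subgroup_pow[OF M(1,2)])
    then have "rot [^] n \<otimes> (\<beta> s \<otimes> \<beta> t) \<otimes> inv (rot [^] n) \<in> M"
      using that M(1) by (simp add: subgroup.m_closed subgroup.m_inv_closed)
    also have "rot [^] n \<otimes> (\<beta> s \<otimes> \<beta> t) \<otimes> inv (rot [^] n) =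
        (rot [^] n \<otimes> \<beta> s \<otimes> inv (rot [^] n)) \<otimes> (rot [^] n \<otimes> \<beta> t \<otimes> inv (rot [^] n))"
      by (simp add: m_assoc) (simp add: m_assoc[symmetric])
    finally show ?thesis unfolding \<beta>_shift .
  qed
  have "\<beta> 3 \<otimes> \<beta> 4 \<in> M" "\<beta> 2 \<otimes> \<beta> 3 \<in> M" using shift[OF 1(2), of 2] shift[OF 1(2), of 1] by simp_all
  moreover have "\<beta> 3 = \<beta> 0" "\<beta> 4 = \<beta> 1" by (rule \<beta>_cong; simp add: p_eq)+
  ultimately have 2: "\<beta> 0 \<otimes> \<beta> 1 \<in> M" "\<beta> 2 \<otimes> \<beta> 0 \<in> M" by simp_all
  have "(\<beta> 0 \<otimes> \<beta> 1) \<otimes> inv (\<beta> 2 \<otimes> \<beta> 1) \<otimes> (\<beta> 2 \<otimes> \<beta> 0) = \<beta> 0 \<otimes> \<beta> 0"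
    by (simp add: m_assoc inv_mult_group) (simp add: m_assoc[symmetric])
  then have sq: "\<beta> 0 \<otimes> \<beta> 0 \<in> M" using 1 2 M(1) by (metis subgroup.m_closed subgroup.m_inv_closed)
  have "\<beta> 0 [^] (3::nat) = \<one>"
  proof -
    have "\<beta> 0 = rot \<otimes> gb \<otimes> inv rot" using \<beta>_shift[of 1 "-1"] by (simp add: gb_eq_\<beta>)
    then have "n = p \<Longrightarrow> \<beta> 0 [^] n = \<one>" for n using conj_pow[of rot gb n] gb_pow by simp
    then show ?thesis using p_eq by simp
  qed
  then have "\<beta> 0 \<otimes> \<beta> 0 \<otimes> \<beta> 0 = \<one>" by (simp add: numeral_3_eq_3)
  then have "\<beta> 0 = (\<beta> 0 \<otimes> \<beta> 0) \<otimes> (\<beta> 0 \<otimes> \<beta> 0)" by (simp add: m_assoc[symmetric])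
  then show "\<exists>t. \<beta> t \<in> M" using sq M(1) by (metis subgroup.m_closed)
qed

end

theorem theorem1p3:
  fixes G :: "(nat list \<Rightarrow> nat list) monoid"
  assumes "G = grigorchuk_group \<or>
           G = GGS_group 3 [1, 3 - 1] \<or>
           (\<exists>p E. prime p \<and> defining_vector p E \<and>
                  \<not> (\<forall>\<epsilon> \<in> set E. \<epsilon> = 0) \<and> \<not> (\<forall>\<epsilon> \<in> set E. \<epsilon> \<noteq> 0) \<and>
                  G = GGS_group p E)"
  shows "\<exists>\<C>. uncountable \<C> \<and>
           (\<forall>C \<in> \<C>. (\<exists>W. weakly_maximal G W \<and> C = aut_class G W) \<and>
                    (\<forall>T \<phi> P. spherically_regular_tree T \<longrightarrow> branch_action G T \<phi> \<longrightarrow>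
                       P \<in> parabolic_subgroups G T \<phi> \<longrightarrow> C \<noteq> aut_class G P))"
proof -
  consider (grig) "G = grigorchuk_group" | (gs) "G = GGS_group 3 [1, 2]"
    | (vec) p E where "prime p" "defining_vector p E" "\<exists>\<epsilon>\<in>set E. \<epsilon> \<noteq> 0" "0 \<in> set E"
      "G = GGS_group p E"
    using assms by auto
  then show ?thesis
  proof cases
    case grig
    interpret grigorchuk "tree_aut_group (regular_tree 2)" by unfold_locales simp
    interpret B: branching_group 2 "tree_aut_group (regular_tree 2)" S C "normal_closure X" Q
      by (rule branching)
    have "G = \<Gamma>"
      by (simp add: grig grigorchuk_group_def C_def S_def grig_a_rot gb_def gc_def gd_def)
    then show ?thesis by (simp only: B.branch.uncountably_many_classes)
  next
    case gs
    interpret gupta_sidki 3 "tree_aut_group (regular_tree 3)" "[1, 2]"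
      by unfold_locales (auto simp: defining_vector_def)
    interpret B: branching_group 3 "tree_aut_group (regular_tree 3)" S C K
      "generate (tree_aut_group (regular_tree 3)) {rot}"
      by (rule branching)
    have "G = \<Gamma>"
      by (simp only: gs GGS_group_def C_def S_def rot_def gb_def image_insert image_empty)
    then show ?thesis by (simp only: B.branch.uncountably_many_classes)
  next
    case vec
    interpret ggs_zero p "tree_aut_group (regular_tree p)" E
      by unfold_locales (use vec in simp_all)
    interpret B: branching_group p "tree_aut_group (regular_tree p)" S C K
      "generate (tree_aut_group (regular_tree p)) {rot}"
      by (rule branching)
    have "G = \<Gamma>"
      by (simp only: vec(5) GGS_group_def C_def S_def rot_def gb_def image_insert image_empty)
    then show ?thesis by (simp only: B.branch.uncountably_many_classes)
  qed
qed

end
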